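(* Let $\gamma\in(0,2)$, and let $u\in C^{n_0+2}(\mathbb{T})$ be a real function with a finite number of critical points $\bar y_1,\dots,\bar y_N$, where $n_0\in\mathbb{N}$ denotes the maximal order of vanishing of $u'$ at the critical points. Let $H$ be the space of $f\in L^2(\mathbb{T}^2)$ such that $\int_{\mathbb{T}}f(x,y)\,dx=0$ for a.e. $y\in\mathbb{T}$, with the $L^2$ norm. Then there exists a constant $c_\gamma>0$ such that for every $\nu\in(0,1)$ and every $f^{in}\in H$, the solution $f^\nu$ of $$\partial_tf^\nu+u(y)\,\partial_xf^\nu+\nu\Lambda^\gamma f^\nu=0\quad\text{on }\mathbb{T}^2,\qquad f^\nu(0)=f^{in},$$ satisfies $$\|f^\nu(t)\|_H\le e^{-c_\gamma\nu^{q_{n_0,\gamma}}t}\,\|f^{in}\|_H,\qquad\forall t>\frac{1}{\nu^{q_{n_0,\gamma}}},$$ with $$q_{n_0,\gamma}=\frac{2}{2+\frac{\gamma}{2(n_0+1)}} .$$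
   Context: $\mathbb{T}$ is the one-dimensional torus (period $2\pi$), and $(x,y)\in\mathbb{T}^2$. $\Lambda=\sqrt{-\Delta}$, so $\Lambda^\gamma=(-\Delta)^{\gamma/2}$ is the fractional Laplacian on $\mathbb{T}^2$. The order of vanishing of $u'$ at a critical point $\bar y_i$ is the integer $m_i\ge1$ with $u^{(j)}(\bar y_i)=0$ for $1\le j\le m_i$ and $u^{(m_i+1)}(\bar y_i)\ne0$; $n_0=\max_im_i$. The constant $c_\gamma$ may depend on $u$ and $\gamma$ but not on $\nu$, $t$ or $f^{in}$. *)

theory Defs
  imports "HOL-Analysis.Analysis"
begin

text \<open>
  The torus of period \<open>2\<pi>\<close> is represented by the fundamental domain \<open>[0, 2\<pi>)\<close>.
  Smooth objects (the shear \<open>u\<close>, the test functions) are periodic functions on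
  the whole line or plane; elements of \<open>L\<^sup>2\<close> are functions of which only the values on the
  fundamental domain matter.
\<close>

definition torus1 :: "real measure" where
  "torus1 = restrict_space lborel {0..<2 * pi}"

definition torus2 :: "(real \<times> real) measure" where
  "torus2 = torus1 \<Otimes>\<^sub>M torus1"

definition L2_torus :: "(real \<times> real \<Rightarrow> complex) set" where
  "L2_torus = {f. f \<in> borel_measurable torus2 \<and> integrable torus2 (\<lambda>z. (cmod (f z))\<^sup>2)}"

definition L2_torus_norm :: "(real \<times> real \<Rightarrow> complex) \<Rightarrow> real" where
  "L2_torus_norm f = sqrt (LINT z|torus2. (cmod (f z))\<^sup>2)"

text \<open>For almost every \<open>y\<close> the slice is integrable, by Fubini, so the convention that the
  integral of a non-integrable function is 0 plays no role below.\<close>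

definition H_space :: "(real \<times> real \<Rightarrow> complex) set" where
  "H_space = {f \<in> L2_torus. AE y in torus1. (LINT x|torus1. f (x, y)) = 0}"

subsection \<open>The shear profile\<close>

definition C_torus :: "nat \<Rightarrow> (real \<Rightarrow> real) \<Rightarrow> bool" where
  "C_torus n u \<longleftrightarrow>
     (\<forall>y. u (y + 2 * pi) = u y) \<and>
     (\<forall>j<n. \<forall>y. (deriv ^^ j) u field_differentiable at y) \<and>
     continuous_on UNIV ((deriv ^^ n) u)"

definition critical_points :: "(real \<Rightarrow> real) \<Rightarrow> real set" where
  "critical_points u = {y \<in> {0..<2 * pi}. deriv u y = 0}"

definition vanishing_order :: "(real \<Rightarrow> real) \<Rightarrow> real \<Rightarrow> nat \<Rightarrow> bool" where
  "vanishing_order u y m \<longleftrightarrow>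
     m \<ge> 1 \<and> (\<forall>j\<in>{1..m}. (deriv ^^ j) u y = 0) \<and> (deriv ^^ (m + 1)) u y \<noteq> 0"

subsection \<open>Test functions and the fractional Laplacian\<close>

definition partial_x :: "(real \<times> real \<Rightarrow> complex) \<Rightarrow> real \<times> real \<Rightarrow> complex" where
  "partial_x \<phi> = (\<lambda>(x, y). vector_derivative (\<lambda>s. \<phi> (s, y)) (at x))"

definition partial_y :: "(real \<times> real \<Rightarrow> complex) \<Rightarrow> real \<times> real \<Rightarrow> complex" where
  "partial_y \<phi> = (\<lambda>(x, y). vector_derivative (\<lambda>s. \<phi> (x, s)) (at y))"

text \<open>The space \<open>C\<^sup>\<infinity>\<close> of the torus. Total differentiability of all the listed partial
  derivatives makes them continuous and makes mixed partials commute, so that the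
  fixed order of differentiation is no restriction.\<close>

definition test_function :: "(real \<times> real \<Rightarrow> complex) \<Rightarrow> bool" where
  "test_function \<phi> \<longleftrightarrow>
     (\<forall>x y. \<phi> (x + 2 * pi, y) = \<phi> (x, y) \<and> \<phi> (x, y + 2 * pi) = \<phi> (x, y)) \<and>
     (\<forall>a b p. ((partial_x ^^ a) ((partial_y ^^ b) \<phi>)) differentiable (at p))"

definition fourier_coeff :: "(real \<times> real \<Rightarrow> complex) \<Rightarrow> int \<Rightarrow> int \<Rightarrow> complex" where
  "fourier_coeff \<phi> k l =
     (LINT (x, y)|torus2. \<phi> (x, y) * cis (- (of_int k * x + of_int l * y))) / (2 * pi)\<^sup>2"

text \<open>\<open>\<Lambda>\<^sup>\<gamma> = (-\<Delta>)\<^bsup>\<gamma>/2\<^esup>\<close> has Fourier symbol \<open>(k\<^sup>2 + l\<^sup>2)\<^bsup>\<gamma>/2\<^esup>\<close>, which is 0 at the zero mode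
  because \<open>0 powr a = 0\<close>. It is applied to test functions only, for which
  the series converges absolutely.\<close>

definition frac_laplacian ::
    "real \<Rightarrow> (real \<times> real \<Rightarrow> complex) \<Rightarrow> real \<times> real \<Rightarrow> complex" where
  "frac_laplacian \<gamma> \<phi> = (\<lambda>(x, y).
     \<Sum>\<^sub>\<infinity>(k, l)\<in>UNIV. of_real ((of_int k ^ 2 + of_int l ^ 2) powr (\<gamma> / 2)) *
       fourier_coeff \<phi> k l * cis (of_int k * x + of_int l * y))"

subsection \<open>Solutions\<close>

text \<open>
  Weak solutions in \<open>C([0,\<infinity>); L\<^sup>2)\<close> of
  \<open>\<partial>\<^sub>t f + u(y) \<partial>\<^sub>x f + \<nu> \<Lambda>\<^sup>\<gamma> f = 0\<close>, \<open>f(0) = fin\<close>; this is the class in which the problem is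
  well posed for every \<open>fin\<close> in \<open>L\<^sup>2\<close>. The pairing with test functions is bilinear (no complex
  conjugate): the transpose of \<open>u(y) \<partial>\<^sub>x\<close> is \<open>- u(y) \<partial>\<^sub>x\<close>, and \<open>\<Lambda>\<^sup>\<gamma>\<close> is its own transpose
  because its symbol is even.
\<close>

definition is_solution ::
    "real \<Rightarrow> (real \<Rightarrow> real) \<Rightarrow> real \<Rightarrow> (real \<times> real \<Rightarrow> complex) \<Rightarrow>
     (real \<Rightarrow> real \<times> real \<Rightarrow> complex) \<Rightarrow> bool" where
  "is_solution \<gamma> u \<nu> fin f \<longleftrightarrow>
     (\<forall>t\<ge>0. f t \<in> L2_torus) \<and>
     (\<forall>t\<ge>0. ((\<lambda>s. L2_torus_norm (\<lambda>z. f s z - f t z)) \<longlongrightarrow> 0) (at t within {0..})) \<and>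
     (AE z in torus2. f 0 z = fin z) \<and>
     (\<forall>\<phi>. test_function \<phi> \<longrightarrow>
       (\<forall>t\<ge>0. ((\<lambda>s. LINT z|torus2. f s z * \<phi> z) has_vector_derivative
          (LINT z|torus2. f t z *
             (of_real (u (snd z)) * partial_x \<phi> z - of_real \<nu> * frac_laplacian \<gamma> \<phi> z)))
          (at t within {0..})))"

definition q_exponent :: "nat \<Rightarrow> real \<Rightarrow> real" where
  "q_exponent n \<gamma> = 2 / (2 + \<gamma> / (2 * (real n + 1)))"

end

theory Submission
  imports Defs "HOL-Real_Asymp.Real_Asymp"
begin

text \<open>
  The Fourier coefficient \<open>g\<close> of the solution at frequency \<open>k \<noteq> 0\<close> in \<open>x\<close> is a function of
  \<open>(t, y)\<close>, and it suffices to contract its \<open>L\<^sup>2\<close> norm by a fixed factor over every time window of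
  length \<open>\<tau> = \<nu>\<^bsup>-q\<^esup>\<close>. By the energy identity the squared norm loses at least
  \<open>2\<nu>N\<^sup>\<gamma> \<integral> \<parallel>P\<^bsub>>N\<^esub> g\<parallel>\<^sup>2\<close> over the window, where \<open>P\<^bsub>>N\<^esub>\<close> projects to the frequencies \<open>\<bar>l\<bar> > N\<close>
  in \<open>y\<close>; with \<open>N \<approx> \<nu>\<^bsup>-q/(4(n\<^sub>0+1))\<^esup>\<close> one has \<open>\<nu>N\<^sup>\<gamma>\<tau> \<ge> 1\<close>, so only a solution which is concentrated
  on the frequencies \<open>\<bar>l\<bar> \<le> N\<close> could fail to contract. Mixing forbids this. Let \<open>\<phi> = P\<^bsub>\<le>N\<^esub> g(s)\<close>
  and transport it backwards along the inviscid flow, for a time \<open>T\<close> with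
  \<open>\<bar>k\<bar>T = K N\<^bsup>n\<^sub>0+1\<^esup>\<close>, which is much smaller than \<open>\<tau>\<close>. Then \<open>\<langle>g(s), \<phi>\<rangle>\<close> differs from
  \<open>\<langle>g(s-T), e\<^bsup>ikTu\<^esup> \<phi>\<rangle>\<close> by at most \<open>\<nu>T\<close> times the \<open>H\<^sup>2\<close> norm of the transported function, which is small,
  and the oscillatory integral bound \<open>\<bar>\<integral> e\<^bsup>i\<theta>u\<^esup> w\<bar> \<lesssim> \<bar>\<theta>\<bar>\<^bsup>-1/(n\<^sub>0+1)\<^esup>\<close> makes the contribution of
  \<open>P\<^bsub>\<le>N\<^esub> g(s-T)\<close> small. Hence \<open>\<parallel>P\<^bsub>\<le>N\<^esub> g(s)\<parallel> \<le> \<parallel>P\<^bsub>>N\<^esub> g(s-T)\<parallel>\<close> up to a small multiple of the initial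
  norm, so the high frequencies carry a fixed fraction of the energy on average.
\<close>

section \<open>Square-integrable functions\<close>

text \<open>Two requirements fix the exponent. Put m = \<open>n\<^sub>0 + 1\<close>, N =
  \<open>\<nu>\<close> powr -beta and let the window have length \<open>\<nu>\<close> powr -q.
  Damping of the high frequencies over a window asks for beta * gamma = 1 - q. Mixing needs |k| T of
  order N^m, and the duality error is then of order \<open>\<nu>\<close> N^(3m+1): N^m from T,
  N^(2m) from two y-derivatives of the transported function, and N from the sup norm of a
  trigonometric polynomial. With beta * m = q/4 this is a positive power of \<open>\<nu>\<close>,
  and the two equations together give the stated q. The obstacle is that the fractional Laplacian is
  nonlocal and does not interact simply with the phase of the inviscid flow. Its symbol is therefore
  only bounded by k^2 + l^2, so that classical derivatives of the transported function suffice. The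
  rate must not depend on k. Hence T is inversely proportional to |k|, and frequencies |k| > N are
  left to the damping alone. Since the solution is merely weak, every balance law is derived for
  finitely many Fourier coefficients and then passed to the limit.\<close>

lemma norm_add_power2_le:
  fixes z w :: "'a :: real_normed_vector"
  shows "(norm (z + w))\<^sup>2 \<le> 2 * (norm z)\<^sup>2 + 2 * (norm w)\<^sup>2"
proof -
  have "(norm (z + w))\<^sup>2 \<le> (norm z + norm w)\<^sup>2"
    by (intro power_mono norm_triangle_ineq) auto
  also have "\<dots> \<le> 2 * (norm z)\<^sup>2 + 2 * (norm w)\<^sup>2"
    using sum_squares_bound[of "norm z" "norm w"] by (simp add: power2_sum)
  finally show ?thesis .
qed

lemma continuous_interval_bounded:
  fixes f :: "real \<Rightarrow> 'a :: real_normed_vector"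
  assumes "continuous_on {a..b} f"
  obtains K where "\<And>y. y \<in> {a..b} \<Longrightarrow> norm (f y) \<le> K"
proof -
  have "bounded (f ` {a..b})"
    using assms by (intro compact_imp_bounded compact_continuous_image) auto
  then show ?thesis using that unfolding bounded_iff by blast
qed

text \<open>One predicate serves both the circle and the torus. Its members are functions, not
  classes modulo null sets, so almost-everywhere equality has to be passed through integrals
  explicitly.\<close>

definition sqint :: "'a measure \<Rightarrow> ('a \<Rightarrow> complex) set" where
  "sqint M = {f \<in> borel_measurable M. integrable M (\<lambda>x. (cmod (f x))\<^sup>2)}"

lemma sqintI: "f \<in> borel_measurable M \<Longrightarrow> integrable M (\<lambda>x. (cmod (f x))\<^sup>2) \<Longrightarrow> f \<in> sqint M"
  by (simp add: sqint_def)

lemma sqint_measurable: "f \<in> sqint M \<Longrightarrow> f \<in> borel_measurable M"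
  by (simp add: sqint_def)

lemma sqint_integrable: "f \<in> sqint M \<Longrightarrow> integrable M (\<lambda>x. (cmod (f x))\<^sup>2)"
  by (simp add: sqint_def)

lemma sqint_mult_norm_integrable:
  assumes "f \<in> sqint M" "g \<in> sqint M"
  shows "integrable M (\<lambda>x. cmod (f x) * cmod (g x))"
proof -
  have [measurable]: "f \<in> borel_measurable M" "g \<in> borel_measurable M"
    using assms by (auto simp: sqint_measurable)
  have "integrable M (\<lambda>x. (cmod (f x))\<^sup>2 + (cmod (g x))\<^sup>2)"
    using assms by (auto simp: sqint_integrable)
  then show ?thesis
  proof (rule Bochner_Integration.integrable_bound)
    have "a * b \<le> a\<^sup>2 + b\<^sup>2" if "0 \<le> a" "0 \<le> b" for a b :: real
      using sum_squares_bound[of a b] mult_nonneg_nonneg[OF that] by linarith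
    then show "AE x in M. norm (cmod (f x) * cmod (g x)) \<le> norm ((cmod (f x))\<^sup>2 + (cmod (g x))\<^sup>2)"
      by (intro AE_I2) (simp add: abs_mult)
  qed measurable
qed

lemma sqint_mult_cnj_integrable:
  assumes "f \<in> sqint M" "g \<in> sqint M"
  shows "integrable M (\<lambda>x. f x * cnj (g x))"
proof -
  have [measurable]: "f \<in> borel_measurable M" "g \<in> borel_measurable M"
    using assms by (auto simp: sqint_measurable)
  have [measurable]: "(\<lambda>x. cnj (g x)) \<in> borel_measurable M"
    by (rule borel_measurable_continuous_onI[THEN measurable_compose_rev, of cnj])
       (auto intro: continuous_intros)
  show ?thesis
    by (rule Bochner_Integration.integrable_bound[OF sqint_mult_norm_integrable[OF assms]])
       (auto simp: norm_mult)
qed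

text \<open>The integral of the square of |f| - s |g| is a polynomial in the real variable s that is
  never negative.\<close>

lemma sqint_cauchy_schwarz_norm:
  assumes "f \<in> sqint M" "g \<in> sqint M"
  shows "(\<integral>x. cmod (f x) * cmod (g x) \<partial>M)\<^sup>2 \<le> (\<integral>x. (cmod (f x))\<^sup>2 \<partial>M) * (\<integral>x. (cmod (g x))\<^sup>2 \<partial>M)"
proof -
  define a where "a = (\<integral>x. (cmod (f x))\<^sup>2 \<partial>M)"
  define b where "b = (\<integral>x. (cmod (g x))\<^sup>2 \<partial>M)"
  define c where "c = (\<integral>x. cmod (f x) * cmod (g x) \<partial>M)"
  note int = sqint_integrable[OF assms(1)] sqint_integrable[OF assms(2)]
    sqint_mult_norm_integrable[OF assms]
  have nn: "0 \<le> a" "0 \<le> b" "0 \<le> c"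
    unfolding a_def b_def c_def by (auto intro!: integral_nonneg_AE)
  have *: "0 \<le> a - 2 * s * c + s\<^sup>2 * b" for s :: real
  proof -
    have "0 \<le> (\<integral>x. (cmod (f x) - s * cmod (g x))\<^sup>2 \<partial>M)"
      by (auto intro!: integral_nonneg_AE)
    also have "\<dots> = (\<integral>x. (cmod (f x))\<^sup>2 - 2 * s * (cmod (f x) * cmod (g x)) + s\<^sup>2 * (cmod (g x))\<^sup>2 \<partial>M)"
      by (intro Bochner_Integration.integral_cong refl) (simp add: power2_eq_square algebra_simps)
    also have "\<dots> = a - 2 * s * c + s\<^sup>2 * b"
      using int by (simp add: a_def b_def c_def)
    finally show ?thesis .
  qed
  show ?thesis
  proof (cases "b = 0")
    case True
    have "c = 0"
    proof (rule ccontr)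
      assume "c \<noteq> 0"
      \<comment> \<open>For \<open>b = 0\<close> the polynomial is affine in \<open>s\<close>, and
        at this point it would take the value -1.\<close>
      with *[of "(a + 1) / (2 * c)"] nn True show False by (simp add: field_simps)
    qed
    then show ?thesis using True by (simp add: a_def[symmetric] b_def[symmetric] c_def[symmetric])
  next
    case False
    then have "b > 0" using nn by simp
    \<comment> \<open>The minimum of the polynomial is attained here.\<close>
    with *[of "c / b"] have "0 \<le> a - c\<^sup>2 / b"
      by (simp add: power2_eq_square field_simps)
    then have "c\<^sup>2 \<le> a * b" using \<open>b > 0\<close> by (simp add: field_simps)
    then show ?thesis by (simp add: a_def b_def c_def)
  qed
qed

lemma sqint_scale:
  assumes "f \<in> sqint M" shows "(\<lambda>x. c * f x) \<in> sqint M"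
  using assms by (auto simp: sqint_def norm_mult power_mult_distrib)

lemma sqint_add:
  assumes "f \<in> sqint M" "g \<in> sqint M" shows "(\<lambda>x. f x + g x) \<in> sqint M"
proof -
  have [measurable]: "f \<in> borel_measurable M" "g \<in> borel_measurable M"
    using assms by (auto simp: sqint_measurable)
  have "integrable M (\<lambda>x. (cmod (f x + g x))\<^sup>2)"
  proof (rule Bochner_Integration.integrable_bound)
    show "integrable M (\<lambda>x. 2 * (cmod (f x))\<^sup>2 + 2 * (cmod (g x))\<^sup>2)"
      using assms by (auto simp: sqint_integrable)
    show "AE x in M. norm ((cmod (f x + g x))\<^sup>2) \<le> norm (2 * (cmod (f x))\<^sup>2 + 2 * (cmod (g x))\<^sup>2)"
      using norm_add_power2_le by (intro AE_I2) fastforce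
  qed measurable
  then show ?thesis by (intro sqintI) measurable
qed

lemma sqint_diff:
  assumes "f \<in> sqint M" "g \<in> sqint M" shows "(\<lambda>x. f x - g x) \<in> sqint M"
  using sqint_add[OF assms(1) sqint_scale[OF assms(2), of "-1"]] by simp

lemma sqint_sum:
  assumes "\<And>i. i \<in> I \<Longrightarrow> f i \<in> sqint M" shows "(\<lambda>x. \<Sum>i\<in>I. f i x) \<in> sqint M"
  using assms
proof (induction I rule: infinite_finite_induct)
  case (insert i I)
  then show ?case using sqint_add[of "f i" M "\<lambda>x. \<Sum>i\<in>I. f i x"] by auto
qed (auto simp: sqint_def)

lemma sqint_bounded_mult:
  assumes "f \<in> sqint M" "h \<in> borel_measurable M" "\<And>x. x \<in> space M \<Longrightarrow> cmod (h x) \<le> B"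
  shows "(\<lambda>x. h x * f x) \<in> sqint M"
proof -
  have [measurable]: "f \<in> borel_measurable M" "h \<in> borel_measurable M"
    using assms by (auto simp: sqint_measurable)
  have "integrable M (\<lambda>x. (cmod (h x * f x))\<^sup>2)"
  proof (rule Bochner_Integration.integrable_bound)
    show "integrable M (\<lambda>x. B\<^sup>2 * (cmod (f x))\<^sup>2)"
      using assms by (auto simp: sqint_integrable)
    show "AE x in M. norm ((cmod (h x * f x))\<^sup>2) \<le> norm (B\<^sup>2 * (cmod (f x))\<^sup>2)"
      using assms(3) by (intro AE_I2) (auto simp: norm_mult power_mult_distrib intro!: mult_right_mono power_mono)
  qed measurable
  then show ?thesis by (intro sqintI) measurable
qed

lemma (in finite_measure) sqint_bounded:
  assumes "h \<in> borel_measurable M" "\<And>x. x \<in> space M \<Longrightarrow> cmod (h x) \<le> B"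
  shows "h \<in> sqint M"
proof -
  have "(\<lambda>x. 1) \<in> sqint M" by (auto simp: sqint_def)
  from sqint_bounded_mult[OF this assms] show ?thesis by simp
qed

section \<open>Integration over one period\<close>

lemma space_torus1: "space torus1 = {0..<2*pi}"
  by (simp add: torus1_def space_restrict_space)

lemma borel_measurable_torus1: "f \<in> borel_measurable borel \<Longrightarrow> f \<in> borel_measurable torus1"
  unfolding torus1_def by (rule measurable_restrict_space1) simp

lemma emeasure_torus1: "emeasure torus1 (space torus1) = ennreal (2*pi)"
  unfolding torus1_def by (subst emeasure_restrict_space) (auto simp: space_restrict_space)

interpretation torus1: finite_measure torus1
  by standard (simp add: emeasure_torus1)

interpretation torus_pair: pair_sigma_finite torus1 torus1 ..

lemma measure_torus1: "measure torus1 (space torus1) = 2*pi"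
  by (simp add: measure_def emeasure_torus1)

text \<open>The two domains differ by the null point 2 pi. The gauge integral on the right gives
  access to the fundamental theorem of calculus, the Lebesgue integral on the left to L^2
  theory.\<close>

lemma integral_torus1:
  fixes f :: "real \<Rightarrow> 'a :: euclidean_space"
  assumes "continuous_on UNIV f"
  shows "(LINT y|torus1. f y) = integral {0..2*pi} f"
proof -
  have c: "continuous_on {0..2*pi} f" using assms continuous_on_subset by blast
  have "(LINT y|torus1. f y) = set_lebesgue_integral lborel {0..<2*pi} f"
    by (simp add: torus1_def integral_restrict_space set_lebesgue_integral_def)
  also have "\<dots> = set_lebesgue_integral lborel {0..2*pi} f"
  proof (rule set_integral_cong_set)
    show "AE x in lborel. (x \<in> {0..2*pi}) = (x \<in> {0..<2*pi})"
      using AE_lborel_singleton[of "2*pi"] by eventually_elim auto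
  qed (use borel_measurable_continuous_onI[OF assms] in \<open>auto simp: set_borel_measurable_def\<close>)
  also have "\<dots> = integral {0..2*pi} f"
    using borel_integrable_atLeastAtMost'[OF c] by (rule set_borel_integral_eq_integral)
  finally show ?thesis .
qed

section \<open>Fourier series on the circle\<close>

text \<open>The factor 1/(2 pi) makes the modes orthonormal, so Bessel and Parseval carry no
  constants.\<close>

definition ip :: "(real \<Rightarrow> complex) \<Rightarrow> (real \<Rightarrow> complex) \<Rightarrow> complex" where
  "ip f g = (LINT y|torus1. f y * cnj (g y)) / of_real (2*pi)"

definition nsq :: "(real \<Rightarrow> complex) \<Rightarrow> real" where
  "nsq f = (LINT y|torus1. (cmod (f y))\<^sup>2) / (2*pi)"

definition mode :: "int \<Rightarrow> real \<Rightarrow> complex" where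
  "mode l y = cis (of_int l * y)"

abbreviation fc :: "(real \<Rightarrow> complex) \<Rightarrow> int \<Rightarrow> complex" where
  "fc f l \<equiv> ip f (mode l)"

definition proj :: "int set \<Rightarrow> (real \<Rightarrow> complex) \<Rightarrow> real \<Rightarrow> complex" where
  "proj S f y = (\<Sum>l\<in>S. fc f l * mode l y)"

lemma continuous_mode: "continuous_on UNIV (mode l)"
  unfolding mode_def by (intro continuous_intros)

lemma mode_measurable: "mode l \<in> borel_measurable borel"
  by (rule borel_measurable_continuous_onI[OF continuous_mode])

lemma mode_measurable_torus1 [measurable]: "mode l \<in> borel_measurable torus1"
  by (rule borel_measurable_torus1[OF mode_measurable])

lemma norm_mode [simp]: "cmod (mode l y) = 1"
  by (simp add: mode_def)

lemma mode_sqint: "mode l \<in> sqint torus1"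
  by (rule torus1.sqint_bounded[of _ 1]) auto

lemma proj_sqint: "proj S f \<in> sqint torus1"
  unfolding proj_def by (intro sqint_sum sqint_scale mode_sqint)

lemma nsq_nonneg: "0 \<le> nsq f"
  unfolding nsq_def by (auto intro!: divide_nonneg_pos integral_nonneg_AE)

lemma ip_self: "ip f f = of_real (nsq f)"
proof -
  have "(LINT y|torus1. f y * cnj (f y)) = (LINT y|torus1. complex_of_real ((cmod (f y))\<^sup>2))"
    by (intro Bochner_Integration.integral_cong refl) (simp add: complex_norm_square del: of_real_power)
  then show ?thesis unfolding ip_def nsq_def by (simp only: integral_complex_of_real of_real_divide)
qed

lemma ip_commute: "ip g f = cnj (ip f g)"
proof -
  have "(LINT y|torus1. g y * cnj (f y)) = (LINT y|torus1. cnj (f y * cnj (g y)))"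
    by (intro Bochner_Integration.integral_cong refl) (simp add: mult.commute)
  then show ?thesis unfolding ip_def by (simp only: Bochner_Integration.integral_cnj complex_cnj_divide complex_cnj_complex_of_real)
qed

lemma ip_add_left:
  assumes "f \<in> sqint torus1" "g \<in> sqint torus1" "h \<in> sqint torus1"
  shows "ip (\<lambda>y. f y + g y) h = ip f h + ip g h"
  using assms by (simp add: ip_def ring_distribs sqint_mult_cnj_integrable add_divide_distrib)

lemma ip_diff_left:
  assumes "f \<in> sqint torus1" "g \<in> sqint torus1" "h \<in> sqint torus1"
  shows "ip (\<lambda>y. f y - g y) h = ip f h - ip g h"
  using assms by (simp add: ip_def ring_distribs sqint_mult_cnj_integrable diff_divide_distrib)

lemma ip_scale_left: "ip (\<lambda>y. c * f y) h = c * ip f h"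
  by (simp add: ip_def mult.assoc)

lemma ip_diff_right:
  assumes "f \<in> sqint torus1" "g \<in> sqint torus1" "h \<in> sqint torus1"
  shows "ip h (\<lambda>y. f y - g y) = ip h f - ip h g"
  using assms by (simp add: ip_commute[of h] ip_diff_left)

lemma ip_sum_left:
  assumes "\<And>i. i \<in> I \<Longrightarrow> f i \<in> sqint torus1" "h \<in> sqint torus1"
  shows "ip (\<lambda>y. \<Sum>i\<in>I. f i y) h = (\<Sum>i\<in>I. ip (f i) h)"
  using assms
proof (induction I rule: infinite_finite_induct)
  case (insert i I)
  then show ?case by (simp add: ip_add_left sqint_sum)
qed (auto simp: ip_def)

lemma ip_cauchy_schwarz:
  assumes "f \<in> sqint torus1" "g \<in> sqint torus1"
  shows "(cmod (ip f g))\<^sup>2 \<le> nsq f * nsq g"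
proof -
  have "cmod (LINT y|torus1. f y * cnj (g y)) \<le> (LINT y|torus1. cmod (f y) * cmod (g y))"
    using integral_norm_bound[of torus1 "\<lambda>y. f y * cnj (g y)"] by (simp add: norm_mult)
  then have "(cmod (LINT y|torus1. f y * cnj (g y)))\<^sup>2 \<le> (LINT y|torus1. cmod (f y) * cmod (g y))\<^sup>2"
    by (intro power_mono) auto
  also have "\<dots> \<le> (LINT y|torus1. (cmod (f y))\<^sup>2) * (LINT y|torus1. (cmod (g y))\<^sup>2)"
    by (rule sqint_cauchy_schwarz_norm[OF assms])
  finally show ?thesis
    by (simp add: ip_def nsq_def norm_divide power_divide power2_eq_square norm_mult divide_simps)
qed

lemma has_vector_derivative_cis_comp:
  assumes "(g has_real_derivative g') (at y within S)"
  shows "((\<lambda>y. cis (g y)) has_vector_derivative \<i> * of_real g' * cis (g y)) (at y within S)"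
proof -
  have "(cis has_vector_derivative \<i> * cis x) (at x within T)" for x T
  proof -
    have "((\<lambda>z. exp (\<i> * z)) has_field_derivative \<i> * exp (\<i> * of_real x)) (at (of_real x))"
      by (auto intro!: derivative_eq_intros)
    from has_vector_derivative_real_field[OF this, of T] show ?thesis
      by (simp add: cis_conv_exp[abs_def])
  qed
  from vector_diff_chain_within[OF assms[unfolded has_real_derivative_iff_has_vector_derivative] this]
  show ?thesis by (simp add: o_def scaleR_conv_of_real mult.commute mult.left_commute)
qed

lemma has_vector_derivative_mode:
  "(mode l has_vector_derivative \<i> * of_int l * mode l y) (at y within S)"
  unfolding mode_def[abs_def]
  by (rule has_vector_derivative_eq_rhs[OF has_vector_derivative_cis_comp[of _ "of_int l"]])
     (auto intro!: derivative_eq_intros)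

lemma ip_mode: "ip (mode l) (mode m) = of_bool (l = m)"
proof (cases "l = m")
  case True
  have "mode m y * cnj (mode m y) = 1" for y
    by (metis complex_norm_square norm_mode of_real_1 one_power2)
  then show ?thesis using True by (simp add: ip_def measure_torus1 scaleR_conv_of_real)
next
  case False
  define n where "n = l - m"
  have n: "n \<noteq> 0" using False by (simp add: n_def)
  have eq: "mode l y * cnj (mode m y) = mode n y" for y
    by (simp add: mode_def cis_mult cis_cnj n_def ring_distribs)
  define F where "F y = mode n y / (\<i> * of_int n)" for y
  have "(F has_vector_derivative mode n y) (at y within {0..2*pi})" for y
    unfolding F_def using n has_vector_derivative_divide[OF has_vector_derivative_mode[of n y "{0..2*pi}"], of "\<i> * of_int n"] by simp
  then have "(mode n has_integral (F (2*pi) - F 0)) {0..2*pi}"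
    by (intro fundamental_theorem_of_calculus) auto
  moreover have "F (2*pi) = F 0"
    unfolding F_def mode_def
    by (simp add: mult.commute[of "of_int n"] cis_multiple_2pi)
  ultimately have "integral {0..2*pi} (mode n) = 0" by (simp add: integral_unique)
  then show ?thesis using False
    by (simp add: ip_def eq integral_torus1 continuous_mode)
qed

lemma fc_proj: "finite S \<Longrightarrow> fc (proj S f) l = (if l \<in> S then fc f l else 0)"
  unfolding proj_def
  by (subst ip_sum_left) (auto simp: ip_scale_left ip_mode mode_sqint sqint_scale if_distrib cong: if_cong)

lemma ip_proj_left:
  assumes "finite S" "g \<in> sqint torus1"
  shows "ip (proj S f) g = (\<Sum>l\<in>S. fc f l * cnj (fc g l))"
  unfolding proj_def
  by (subst ip_sum_left) (auto simp: ip_scale_left mode_sqint sqint_scale assms ip_commute[of "mode _"])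

lemma nsq_proj: "finite S \<Longrightarrow> nsq (proj S f) = (\<Sum>l\<in>S. (cmod (fc f l))\<^sup>2)"
proof -
  assume S: "finite S"
  have "complex_of_real (nsq (proj S f)) = (\<Sum>l\<in>S. fc f l * cnj (fc (proj S f) l))"
    using ip_proj_left[OF S proj_sqint, of f S f] by (simp only: ip_self)
  also have "\<dots> = of_real (\<Sum>l\<in>S. (cmod (fc f l))\<^sup>2)"
    using S by (simp add: fc_proj complex_norm_square del: of_real_power)
  finally show ?thesis by (simp only: of_real_eq_iff)
qed

text \<open>Pythagoras for an orthogonal projection. Bessel's inequality is the nonnegativity of the
  left side, and Parseval's identity is its convergence to 0.\<close>

lemma nsq_diff_proj:
  assumes "f \<in> sqint torus1" "finite S"
  shows "nsq (\<lambda>y. f y - proj S f y) = nsq f - (\<Sum>l\<in>S. (cmod (fc f l))\<^sup>2)"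
proof -
  note s = assms(1) proj_sqint[of S f]
  have a: "ip (proj S f) f = of_real (\<Sum>l\<in>S. (cmod (fc f l))\<^sup>2)"
    using ip_proj_left[OF assms(2,1), of f] by (simp add: complex_norm_square del: of_real_power)
  have "complex_of_real (nsq (\<lambda>y. f y - proj S f y)) = ip f f - ip f (proj S f) - (ip (proj S f) f - ip (proj S f) (proj S f))"
    unfolding ip_self[symmetric] using s by (simp add: ip_diff_left ip_diff_right sqint_diff)
  also have "\<dots> = of_real (nsq f - (\<Sum>l\<in>S. (cmod (fc f l))\<^sup>2))"
    using assms(2) by (simp add: a ip_self nsq_proj ip_commute[of f "proj S f"])
  finally show ?thesis by (simp only: of_real_eq_iff)
qed

lemma bessel:
  assumes "f \<in> sqint torus1" "finite S"
  shows "(\<Sum>l\<in>S. (cmod (fc f l))\<^sup>2) \<le> nsq f"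
  using nsq_diff_proj[OF assms] nsq_nonneg[of "\<lambda>y. f y - proj S f y"] by simp

section \<open>Trigonometric polynomials and their density in L^2 of the circle\<close>

inductive trig_poly :: "(real \<Rightarrow> complex) \<Rightarrow> bool" where
  trig_poly_mode: "trig_poly (\<lambda>y. c * mode l y)"
| trig_poly_add: "trig_poly p \<Longrightarrow> trig_poly q \<Longrightarrow> trig_poly (\<lambda>y. p y + q y)"

lemma trig_poly_const: "trig_poly (\<lambda>y. c)"
  using trig_poly_mode[of c 0] by (simp add: mode_def)

lemma trig_poly_mult_mode: "trig_poly p \<Longrightarrow> trig_poly (\<lambda>y. c * mode l y * p y)"
proof (induction rule: trig_poly.induct)
  case (trig_poly_mode d m)
  have "(\<lambda>y. c * mode l y * (d * mode m y)) = (\<lambda>y. (c * d) * mode (l + m) y)"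
    by (auto simp: mode_def fun_eq_iff ring_distribs simp flip: cis_mult)
  then show ?case by (metis trig_poly.trig_poly_mode)
next
  case (trig_poly_add p q)
  then show ?case using trig_poly.trig_poly_add by (fastforce simp: ring_distribs)
qed

lemma trig_poly_mult: "trig_poly p \<Longrightarrow> trig_poly q \<Longrightarrow> trig_poly (\<lambda>y. p y * q y)"
proof (induction rule: trig_poly.induct)
  case (trig_poly_mode d m)
  then show ?case by (rule trig_poly_mult_mode)
next
  case (trig_poly_add p p')
  then show ?case using trig_poly.trig_poly_add by (fastforce simp: ring_distribs)
qed

lemma trig_poly_cos: "trig_poly (\<lambda>y. of_real (cos y))"
proof -
  have "(\<lambda>y. complex_of_real (cos y)) = (\<lambda>y. (1/2) * mode 1 y + (1/2) * mode (-1) y)"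
    by (auto simp: fun_eq_iff complex_eq_iff mode_def)
  then show ?thesis by (metis trig_poly.intros)
qed

lemma trig_poly_sin: "trig_poly (\<lambda>y. of_real (sin y))"
proof -
  have "(\<lambda>y. complex_of_real (sin y)) = (\<lambda>y. (-\<i>/2) * mode 1 y + (\<i>/2) * mode (-1) y)"
    by (auto simp: fun_eq_iff complex_eq_iff mode_def)
  then show ?thesis by (metis trig_poly.intros)
qed

text \<open>Stone-Weierstrass yields polynomials on the complex plane. On the unit circle a real
  linear functional is a combination of cos and sin, and the other formation rules are sums and
  products.\<close>

lemma trig_poly_real_polynomial:
  fixes p :: "complex \<Rightarrow> real"
  assumes "real_polynomial_function p"
  shows "trig_poly (\<lambda>y. of_real (p (cis y)))"
  using assms
proof (induction rule: real_polynomial_function.induct)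
  case (linear h)
  have "h (cis y) = cos y * h 1 + sin y * h \<i>" for y
  proof -
    have "cis y = cos y *\<^sub>R 1 + sin y *\<^sub>R \<i>" by (simp add: complex_eq_iff)
    then show ?thesis
      by (simp add: linear_add[OF bounded_linear.linear[OF linear]] linear_scale[OF bounded_linear.linear[OF linear]] del: cis.simps)
  qed
  then have "(\<lambda>y. complex_of_real (h (cis y))) =
     (\<lambda>y. of_real (cos y) * of_real (h 1) + of_real (sin y) * of_real (h \<i>))"
    by simp
  then show ?case
    using trig_poly_add[OF trig_poly_mult[OF trig_poly_cos trig_poly_const]
      trig_poly_mult[OF trig_poly_sin trig_poly_const]] by presburger
next
  case (const c)
  then show ?case by (rule trig_poly_const)
qed (auto intro: trig_poly_add trig_poly_mult)

lemma trig_poly_polynomial: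
  fixes p :: "complex \<Rightarrow> complex"
  assumes "polynomial_function p"
  shows "trig_poly (\<lambda>y. p (cis y))"
proof -
  have "trig_poly (\<lambda>y. of_real (Re (p (cis y))))" "trig_poly (\<lambda>y. of_real (Im (p (cis y))))"
    using assms bounded_linear_Re bounded_linear_Im trig_poly_real_polynomial
    unfolding polynomial_function_def o_def by blast+
  from trig_poly_add[OF this(1) trig_poly_mult[OF trig_poly_const[of \<i>] this(2)]]
  show ?thesis by (simp flip: complex_eq)
qed

lemma trig_poly_sqint: "trig_poly p \<Longrightarrow> p \<in> sqint torus1"
  by (induction rule: trig_poly.induct) (auto intro: sqint_add sqint_scale mode_sqint)

lemma proj_trig_poly:
  assumes "trig_poly p" shows "\<exists>M0. \<forall>M\<ge>M0. proj {-int M..int M} p = p"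
  using assms
proof (induction rule: trig_poly.induct)
  case (trig_poly_mode c l)
  have "proj {-int M..int M} (\<lambda>y. c * mode l y) = (\<lambda>y. c * mode l y)" if "M \<ge> nat \<bar>l\<bar>" for M
  proof
    fix y
    have "proj {-int M..int M} (\<lambda>y. c * mode l y) y = (\<Sum>m\<in>{-int M..int M}. if m = l then c * mode l y else 0)"
      unfolding proj_def by (intro sum.cong) (auto simp: ip_scale_left ip_mode)
    also have "\<dots> = c * mode l y" using that by (subst sum.delta) auto
    finally show "proj {-int M..int M} (\<lambda>y. c * mode l y) y = c * mode l y" .
  qed
  then show ?case by blast
next
  case (trig_poly_add p q)
  then obtain M0 M1 where *: "\<forall>M\<ge>M0. proj {-int M..int M} p = p" "\<forall>M\<ge>M1. proj {-int M..int M} q = q"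
    by auto
  have "proj S (\<lambda>y. p y + q y) = (\<lambda>y. proj S p y + proj S q y)" for S
    using trig_poly_add.hyps
    by (simp add: proj_def fun_eq_iff ip_add_left trig_poly_sqint mode_sqint ring_distribs sum.distrib)
  with * show ?case by (intro exI[of _ "max M0 M1"]) auto
qed


text \<open>Density is proved for successively larger classes: continuous functions that vanish near
  the ends of the period, bounded measurable functions, square-integrable functions.\<close>

definition approximable :: "(real \<Rightarrow> complex) \<Rightarrow> bool" where
  "approximable f \<longleftrightarrow> (\<forall>\<epsilon>>0. \<exists>p. trig_poly p \<and> nsq (\<lambda>y. f y - p y) < \<epsilon>)"

lemma nsq_triangle:
  assumes "f \<in> sqint torus1" "g \<in> sqint torus1"
  shows "nsq (\<lambda>y. f y + g y) \<le> 2 * nsq f + 2 * nsq g"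
proof -
  have "(LINT y|torus1. (cmod (f y + g y))\<^sup>2) \<le> (LINT y|torus1. 2 * (cmod (f y))\<^sup>2 + 2 * (cmod (g y))\<^sup>2)"
    using assms sqint_add[OF assms] by (intro integral_mono norm_add_power2_le) (auto simp: sqint_integrable)
  also have "\<dots> = 2 * (LINT y|torus1. (cmod (f y))\<^sup>2) + 2 * (LINT y|torus1. (cmod (g y))\<^sup>2)"
    using assms by (simp add: sqint_integrable)
  finally show ?thesis by (simp add: nsq_def divide_simps)
qed

lemma approximable_limit:
  assumes f: "f \<in> sqint torus1" and g: "\<And>n. g n \<in> sqint torus1" "\<And>n. approximable (g n)"
    and lim: "(\<lambda>n::nat. nsq (\<lambda>y. f y - g n y)) \<longlonglongrightarrow> 0"
  shows "approximable f"
  unfolding approximable_def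
proof safe
  fix \<epsilon> :: real assume "\<epsilon> > 0"
  with lim obtain n where n: "nsq (\<lambda>y. f y - g n y) < \<epsilon> / 4"
    by (metis (no_types, lifting) eventually_sequentially order_refl order_tendstoD(2) zero_less_divide_iff zero_less_numeral)
  obtain p where p: "trig_poly p" "nsq (\<lambda>y. g n y - p y) < \<epsilon> / 4"
    using g(2)[of n] \<open>\<epsilon> > 0\<close> unfolding approximable_def by (metis zero_less_divide_iff zero_less_numeral)
  have "nsq (\<lambda>y. f y - p y) \<le> 2 * nsq (\<lambda>y. f y - g n y) + 2 * nsq (\<lambda>y. g n y - p y)"
    using nsq_triangle[OF sqint_diff[OF f g(1)[of n]] sqint_diff[OF g(1)[of n] trig_poly_sqint[OF p(1)]]]
    by simp
  also have "\<dots> < \<epsilon>" using n p by linarith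
  finally show "\<exists>p. trig_poly p \<and> nsq (\<lambda>y. f y - p y) < \<epsilon>" using p by blast
qed

lemma nsq_dominated_limit:
  assumes [measurable]: "f \<in> borel_measurable torus1" "\<And>n. g n \<in> borel_measurable torus1"
    and w: "integrable torus1 w" "\<And>n y. y \<in> {0..<2*pi} \<Longrightarrow> (cmod (f y - g n y))\<^sup>2 \<le> w y"
    and lim: "AE y in torus1. (\<lambda>n. g n y) \<longlonglongrightarrow> f y"
  shows "(\<lambda>n::nat. nsq (\<lambda>y. f y - g n y)) \<longlonglongrightarrow> 0"
proof -
  have "(\<lambda>n. LINT y|torus1. (cmod (f y - g n y))\<^sup>2) \<longlonglongrightarrow> (LINT y|torus1. 0)"
  proof (rule integral_dominated_convergence[OF _ _ w(1)])
    show "AE y in torus1. (\<lambda>n. (cmod (f y - g n y))\<^sup>2) \<longlonglongrightarrow> 0"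
      using lim
    proof eventually_elim
      case (elim y)
      then have "(\<lambda>n. (cmod (f y - g n y))\<^sup>2) \<longlonglongrightarrow> (cmod (f y - f y))\<^sup>2"
        by (intro tendsto_intros)
      then show ?case by simp
    qed
  qed (use w(2) in \<open>auto simp: space_torus1 intro!: AE_I2\<close>)
  then show ?thesis unfolding nsq_def by (auto intro: tendsto_divide_zero)
qed

text \<open>Continuous functions vanishing near the end points of the period descend to continuous
  functions on the unit circle, where Stone--Weierstrass applies.\<close>

lemma approximable_cutoff:
  fixes h :: "real \<Rightarrow> complex"
  assumes h: "continuous_on UNIV h" and \<delta>: "0 < \<delta>" "\<delta> < pi"
    and zero: "\<And>y. y \<le> \<delta> \<or> y \<ge> 2*pi - \<delta> \<Longrightarrow> h y = 0"
  shows "approximable h"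
  unfolding approximable_def
proof safe
  fix \<epsilon> :: real assume "\<epsilon> > 0"
  define H where "H z = h (Arg2pi z)" for z
  have "isCont h y" for y using h by (simp add: continuous_on_eq_continuous_at)
  have H0: "H z = 0" if "cmod z = 1" "Re z > cos \<delta>" for z
  proof -
    define a where "a = Arg2pi z"
    have a: "0 \<le> a" "a < 2*pi" "cos a = Re z" using Arg2pi[of z] cos_Arg2pi[of z] that by (auto simp: a_def)
    have "a \<le> \<delta> \<or> a \<ge> 2*pi - \<delta>"
    proof (rule ccontr)
      assume "\<not> ?thesis"
      then have *: "\<delta> < a" "a < 2*pi - \<delta>" by auto
      have "cos a \<le> cos \<delta>"
      proof (cases "a \<le> pi")
        case True
        then show ?thesis using * \<delta> by (intro cos_monotone_0_pi_le) auto
      next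
        case False
        have "cos a = cos (2*pi - a)" by (simp add: cos_diff)
        also have "\<dots> \<le> cos \<delta>" using * \<delta> False by (intro cos_monotone_0_pi_le) auto
        finally show ?thesis .
      qed
      with a that show False by simp
    qed
    then show ?thesis by (simp add: H_def a_def zero)
  qed
  have "cos \<delta> < 1" using \<delta> cos_monotone_0_pi[of 0 \<delta>] by simp
  have "continuous (at z within sphere 0 1) H" if z: "z \<in> sphere 0 1" for z
  proof (cases "z \<in> \<real>\<^sub>\<ge>\<^sub>0")
    case False
    have "isCont (\<lambda>z. h (Arg2pi z)) z"
      using continuous_at_Arg2pi[OF False] \<open>\<And>y. isCont h y\<close> by (rule isCont_o2)
    then show ?thesis unfolding H_def by (rule continuous_at_imp_continuous_at_within)
  next
    case True
    \<comment> \<open>\<open>Arg2pi\<close> jumps across the nonnegative real axis, which meets the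
      circle only at 1. There the cutoff makes \<open>H\<close> vanish on a whole neighbourhood, so
      the jump is invisible.\<close>
    then have "z = 1" using z by (auto simp: complex_nonneg_Reals_iff cmod_def complex_eq_iff)
    have ev: "\<forall>\<^sub>F w in at z within sphere 0 1. H w = 0"
    proof -
      have "open {w. Re w > cos \<delta>}" by (rule open_halfspace_Re_gt)
      then have "\<forall>\<^sub>F w in at z within sphere 0 1. w \<in> {w. Re w > cos \<delta>}"
        using \<open>cos \<delta> < 1\<close> \<open>z = 1\<close> by (intro topological_tendstoD[OF tendsto_ident_at]) auto
      moreover have "\<forall>\<^sub>F w in at z within sphere 0 1. w \<in> sphere 0 1"
        by (simp add: eventually_at_filter)
      ultimately show ?thesis by eventually_elim (auto intro: H0)
    qed
    have "H z = 0" using \<open>cos \<delta> < 1\<close> \<open>z = 1\<close> by (intro H0) auto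
    then show ?thesis unfolding continuous_within by (simp add: tendsto_eventually[OF ev])
  qed
  then have cont: "continuous_on (sphere 0 1) H" by (simp add: continuous_on_eq_continuous_within)
  define \<eta> where "\<eta> = sqrt \<epsilon> / 2"
  have \<eta>: "\<eta> > 0" "\<eta>\<^sup>2 < \<epsilon>" using \<open>\<epsilon> > 0\<close> by (auto simp: \<eta>_def power_divide)
  obtain g where g: "polynomial_function g" "\<And>z. z \<in> sphere 0 1 \<Longrightarrow> cmod (H z - g z) < \<eta>"
    using Stone_Weierstrass_polynomial_function[OF compact_sphere cont \<eta>(1)] by blast
  define p where "p y = g (cis y)" for y
  have p: "trig_poly p" unfolding p_def by (rule trig_poly_polynomial[OF g(1)])
  have [measurable]: "h \<in> borel_measurable torus1"
    by (intro borel_measurable_torus1 borel_measurable_continuous_onI h)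
  have [measurable]: "p \<in> borel_measurable torus1" using trig_poly_sqint[OF p] by (rule sqint_measurable)
  have "cmod (h y - p y) \<le> \<eta>" if "y \<in> {0..<2*pi}" for y
  proof -
    have "Arg2pi (cis y) = y" using that Arg2pi_exp[of "\<i> * of_real y"] by (simp add: cis_conv_exp)
    then show ?thesis using g(2)[of "cis y"] by (simp add: H_def p_def)
  qed
  then have "(LINT y|torus1. (cmod (h y - p y))\<^sup>2) \<le> (LINT y|torus1. \<eta>\<^sup>2)"
    by (intro Bochner_Integration.integral_mono_AE' AE_I2) (auto simp: space_torus1 intro!: power_mono)
  then have "nsq (\<lambda>y. h y - p y) \<le> \<eta>\<^sup>2"
    by (simp add: nsq_def measure_torus1 field_simps)
  with \<eta> p show "\<exists>p. trig_poly p \<and> nsq (\<lambda>y. h y - p y) < \<epsilon>" by force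
qed

text \<open>Radial retraction onto the ball. It restores a uniform bound on continuous approximants
  of a bounded function without destroying their continuity or their limit, as dominated convergence
  requires.\<close>

lemma continuous_cball_retraction:
  fixes R :: real assumes "R > 0"
  obtains c :: "complex \<Rightarrow> complex"
  where "continuous_on UNIV c" "\<And>z. cmod (c z) \<le> R" "\<And>z. cmod z \<le> R \<Longrightarrow> c z = z"
proof
  define c where "c z = z * of_real (R / max R (cmod z))" for z :: complex
  have "max R (cmod z) \<noteq> 0" for z using assms(1) by linarith
  then show "continuous_on UNIV c" unfolding c_def[abs_def] by (intro continuous_intros) auto
  show "cmod (c z) \<le> R" for z
  proof -
    have "cmod (c z) = R * (cmod z / max R (cmod z))" using assms(1) by (simp add: c_def norm_mult norm_divide abs_of_pos)
    also have "\<dots> \<le> R * 1" using assms(1) by (intro mult_left_mono) (auto simp: divide_le_eq)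
    finally show ?thesis by simp
  qed
  show "c z = z" if "cmod z \<le> R" for z using that assms(1) by (simp add: c_def max_def)
qed

text \<open>A measurable function is an almost-everywhere limit of continuous ones. These are
  retracted to the ball of radius \<open>R\<close> and cut off near the ends of the period; the
  results are approximable and converge boundedly.\<close>

lemma approximable_bounded:
  assumes f: "f \<in> borel_measurable torus1" and R: "R > 0" "\<And>y. y \<in> {0..<2*pi} \<Longrightarrow> cmod (f y) \<le> R"
  shows "approximable f"
proof -
  define F where "F y = (if y \<in> {0..<2*pi} then f y else 0)" for y
  have "F \<in> borel_measurable borel"
    using f measurable_restrict_space_iff[of "{0..<2*pi}" lborel 0 borel f]
    by (simp add: torus1_def F_def[abs_def])
  then have "F measurable_on UNIV"
    by (intro lebesgue_measurable_imp_measurable_on) (auto intro: measurable_completion)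
  then obtain N g where N: "negligible N" and g: "\<And>n. continuous_on UNIV (g n)"
      "\<And>y. y \<notin> N \<Longrightarrow> (\<lambda>n. g n y) \<longlonglongrightarrow> F y"
    unfolding measurable_on_def by auto
  obtain c :: "complex \<Rightarrow> complex"
    where c: "continuous_on UNIV c" "\<And>z. cmod (c z) \<le> R" "\<And>z. cmod z \<le> R \<Longrightarrow> c z = z"
    using continuous_cball_retraction[OF R(1)] by blast
  \<comment> \<open>\<open>cut n\<close> vanishes within distance 1/n of 0 and 2 pi and equals 1 at
    distance at least 2/n from both, so it tends to 1 at every interior point.\<close>
  define cut :: "nat \<Rightarrow> real \<Rightarrow> real" where "cut n y = max 0 (min 1 (real n * y - 1)) * max 0 (min 1 (real n * (2*pi-y) - 1))" for n y
  define h where "h n y = of_real (cut n y) * c (g n y)" for n y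
  have hc: "continuous_on UNIV (h n)" for n
    unfolding h_def cut_def by (intro continuous_intros continuous_on_compose2[OF c(1) g(1)]) auto
  have h0: "h n y = 0" if "n > 0" "y \<le> 1/n \<or> y \<ge> 2*pi - 1/n" for n y
  proof -
    have "real n * y \<le> 1 \<or> real n * (2*pi-y) \<le> 1"
      using that by (auto simp: field_simps)
    then show ?thesis by (auto simp: h_def cut_def)
  qed
  have appr: "approximable (h (Suc n))" for n
  proof (rule approximable_cutoff[OF hc])
    have "1 / real (Suc n) \<le> 1" by simp
    then show "1 / real (Suc n) < pi" using pi_gt3 by linarith
  qed (use h0 in auto)
  have cut1: "0 \<le> cut n y" "cut n y \<le> 1" for n y unfolding cut_def by (auto intro!: mult_nonneg_nonneg mult_le_one)
  have hb: "cmod (h n y) \<le> R" for n y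
    using mult_mono[OF cut1(2)[of n y] c(2)[of "g n y"]] cut1[of n y] by (simp add: h_def norm_mult)
  have hm [measurable]: "h n \<in> borel_measurable torus1" for n
    by (intro borel_measurable_torus1 borel_measurable_continuous_onI hc)
  have "N \<in> null_sets lebesgue" using N by (simp add: negligible_iff_null_sets)
  then have "AE y in lebesgue. y \<notin> N" by (rule AE_not_in)
  then have "AE y in lborel. y \<notin> N" by (simp add: AE_completion_iff)
  then have AEN: "AE y in torus1. y \<notin> N \<and> y \<noteq> 0"
    unfolding torus1_def using AE_lborel_singleton[of 0]
    by (subst AE_restrict_space_iff) (auto elim: eventually_elim2)
  have lim: "AE y in torus1. (\<lambda>n. h (Suc n) y) \<longlonglongrightarrow> f y"
    using AEN AE_space
  proof eventually_elim
    case (elim y)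
    then have y: "0 < y" "y < 2*pi" "y \<notin> N" by (auto simp: space_torus1)
    have "isCont c (F y)" using c(1) by (simp add: continuous_on_eq_continuous_at)
    then have "(\<lambda>n. c (g n y)) \<longlonglongrightarrow> c (F y)" using g(2)[OF y(3)] by (rule isCont_tendsto_compose)
    moreover have "c (F y) = f y" using y R c(3) by (simp add: F_def)
    moreover have "\<forall>\<^sub>F n in sequentially. c (g n y) = h n y"
    proof -
      have "\<forall>\<^sub>F n in sequentially. real n * y \<ge> 2" "\<forall>\<^sub>F n in sequentially. real n * (2*pi - y) \<ge> 2"
        using y by real_asymp+
      then show ?thesis
      proof eventually_elim
        case (elim n)
        then have "cut n y = 1" by (simp add: cut_def)
        then show ?case by (simp add: h_def)
      qed
    qed
    ultimately have "(\<lambda>n. h n y) \<longlonglongrightarrow> f y" by (simp add: Lim_transform_eventually)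
    then show ?case by (rule LIMSEQ_Suc)
  qed
  have fs: "f \<in> sqint torus1" using torus1.sqint_bounded[OF f, of R] R by (simp add: space_torus1)
  have hs: "h n \<in> sqint torus1" for n using torus1.sqint_bounded[OF hm[of n], of R] hb by simp
  show ?thesis
  proof (rule approximable_limit[OF fs hs appr])
    show "(\<lambda>n. nsq (\<lambda>y. f y - h (Suc n) y)) \<longlonglongrightarrow> 0"
    proof (rule nsq_dominated_limit[OF f hm _ _ lim])
      show "integrable torus1 (\<lambda>y. (2*R)\<^sup>2)" by simp
      show "(cmod (f y - h (Suc n) y))\<^sup>2 \<le> (2*R)\<^sup>2" if "y \<in> {0..<2*pi}" for n y
        using norm_triangle_ineq4[of "f y" "h (Suc n) y"] R(2)[OF that] hb[of "Suc n" y]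
        by (intro power_mono) auto
    qed
  qed
qed

text \<open>Truncation by the size of \<open>f\<close>: the error is either 0 or \<open>f\<close>
  itself, so it is dominated by \<open>f\<close>.\<close>

lemma approximable_sqint:
  assumes f: "f \<in> sqint torus1" shows "approximable f"
proof -
  define g where "g n y = (if cmod (f y) \<le> real (Suc n) then f y else 0)" for n y
  have [measurable]: "f \<in> borel_measurable torus1" using f by (rule sqint_measurable)
  have gm [measurable]: "g n \<in> borel_measurable torus1" for n unfolding g_def by measurable
  have gb: "cmod (g n y) \<le> real (Suc n)" for n y by (auto simp: g_def)
  have gs: "g n \<in> sqint torus1" for n using torus1.sqint_bounded[OF gm gb] .
  have ga: "approximable (g n)" for n by (rule approximable_bounded[OF gm _ gb]) simp
  show ?thesis
  proof (rule approximable_limit[OF f gs ga], rule nsq_dominated_limit)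
    show "integrable torus1 (\<lambda>y. (cmod (f y))\<^sup>2)" using f by (rule sqint_integrable)
    show "AE y in torus1. (\<lambda>n. g n y) \<longlonglongrightarrow> f y"
    proof (intro AE_I2 tendsto_eventually)
      fix y
      have "\<forall>\<^sub>F n in sequentially. real (Suc n) \<ge> cmod (f y)" by real_asymp
      then show "\<forall>\<^sub>F n in sequentially. g n y = f y" by eventually_elim (simp add: g_def)
    qed
  qed (auto simp: g_def)
qed

text \<open>Once the window contains the frequencies of a trigonometric polynomial p, the partial
  sum reproduces p. The errors of f and of f - p then agree, and the latter is at most the norm of f
  - p by Pythagoras.\<close>

theorem nsq_diff_proj_tendsto:
  assumes f: "f \<in> sqint torus1"
  shows "(\<lambda>M. nsq (\<lambda>y. f y - proj {-int M..int M} f y)) \<longlonglongrightarrow> 0"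
proof (rule LIMSEQ_I)
  fix \<epsilon> :: real assume "\<epsilon> > 0"
  then obtain p where p: "trig_poly p" "nsq (\<lambda>y. f y - p y) < \<epsilon>"
    using approximable_sqint[OF f] unfolding approximable_def by blast
  obtain M0 where M0: "\<And>M. M \<ge> M0 \<Longrightarrow> proj {-int M..int M} p = p" using proj_trig_poly[OF p(1)] by blast
  have ps: "p \<in> sqint torus1" by (rule trig_poly_sqint[OF p(1)])
  define h where "h = (\<lambda>y. f y - p y)"
  have hs: "h \<in> sqint torus1" unfolding h_def by (rule sqint_diff[OF f ps])
  have "nsq (\<lambda>y. f y - proj {-int M..int M} f y) < \<epsilon>" if "M \<ge> M0" for M
  proof -
    have "proj S h y = proj S f y - proj S p y" for S y
      unfolding proj_def h_def using f ps by (simp add: ip_diff_left mode_sqint ring_distribs sum_subtractf)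
    then have "(\<lambda>y. f y - proj {-int M..int M} f y) = (\<lambda>y. h y - proj {-int M..int M} h y)"
      using M0[OF that] by (simp add: h_def)
    then have "nsq (\<lambda>y. f y - proj {-int M..int M} f y) = nsq (\<lambda>y. h y - proj {-int M..int M} h y)" by simp
    also have "\<dots> \<le> nsq h" unfolding nsq_diff_proj[OF hs finite_atLeastAtMost_int] by (simp add: sum_nonneg)
    also have "\<dots> < \<epsilon>" using p by (simp add: h_def)
    finally show ?thesis .
  qed
  then show "\<exists>M0. \<forall>M\<ge>M0. norm (nsq (\<lambda>y. f y - proj {-int M..int M} f y) - 0) < \<epsilon>"
    using nsq_nonneg by auto
qed

section \<open>Parseval's identity, as a limit over symmetric windows of frequencies\<close>

lemma parseval_nsq:
  assumes f: "f \<in> sqint torus1"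
  shows "(\<lambda>M. \<Sum>l\<in>{-int M..int M}. (cmod (fc f l))\<^sup>2) \<longlonglongrightarrow> nsq f"
proof -
  have "(\<lambda>M. nsq f - nsq (\<lambda>y. f y - proj {-int M..int M} f y)) \<longlonglongrightarrow> nsq f - 0"
    by (intro tendsto_intros nsq_diff_proj_tendsto[OF f])
  then show ?thesis by (simp add: nsq_diff_proj[OF f])
qed

lemma parseval:
  assumes f: "f \<in> sqint torus1" and g: "g \<in> sqint torus1"
  shows "(\<lambda>M. \<Sum>l\<in>{-int M..int M}. fc f l * cnj (fc g l)) \<longlonglongrightarrow> ip f g"
proof -
  have "(\<lambda>M. sqrt (nsq (\<lambda>y. f y - proj {-int M..int M} f y) * nsq g)) \<longlonglongrightarrow> sqrt (0 * nsq g)"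
    by (intro tendsto_intros nsq_diff_proj_tendsto[OF f])
  then have lim: "(\<lambda>M. sqrt (nsq (\<lambda>y. f y - proj {-int M..int M} f y) * nsq g)) \<longlonglongrightarrow> 0" by simp
  have "(\<lambda>M. ip f g - (\<Sum>l\<in>{-int M..int M}. fc f l * cnj (fc g l))) \<longlonglongrightarrow> 0"
  proof (rule Lim_null_comparison[OF always_eventually lim], rule allI)
    fix M
    have "ip f g - (\<Sum>l\<in>{-int M..int M}. fc f l * cnj (fc g l)) = ip (\<lambda>y. f y - proj {-int M..int M} f y) g"
      using f g by (simp add: ip_diff_left proj_sqint ip_proj_left)
    then show "norm (ip f g - (\<Sum>l\<in>{-int M..int M}. fc f l * cnj (fc g l)))
        \<le> sqrt (nsq (\<lambda>y. f y - proj {-int M..int M} f y) * nsq g)"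
      using ip_cauchy_schwarz[OF sqint_diff[OF f proj_sqint] g] by (simp add: real_le_rsqrt)
  qed
  from tendsto_diff[OF tendsto_const[of "ip f g"] this] show ?thesis by simp
qed

section \<open>Oscillatory integrals\<close>

lemma deriv_shift: "deriv f (x + p) = deriv (\<lambda>x. f (x + p)) x"
  by (simp add: deriv_def DERIV_shift)

text \<open>Lagrange's form of the remainder. The degenerate cases are included on purpose:
  \<open>n = 0\<close> occurs for the second derivative at a nondegenerate critical point, and
  \<open>y = x\<close> at the critical point itself.\<close>

lemma Taylor_vanishing:
  fixes d :: "nat \<Rightarrow> real \<Rightarrow> real"
  assumes "\<And>j t. j < n \<Longrightarrow> (d j has_real_derivative d (Suc j) t) (at t)"
    and "\<And>j. j < n \<Longrightarrow> d j x = 0"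
  shows "\<exists>t. \<bar>t - x\<bar> \<le> \<bar>y - x\<bar> \<and> d 0 y = d n t / fact n * (y - x) ^ n"
proof (cases "n = 0 \<or> y = x")
  case True
  then show ?thesis using assms(2) by (cases "n = 0") auto
next
  case False
  then obtain t where t: "if y < x then y < t \<and> t < x else x < t \<and> t < y"
      "d 0 y = (\<Sum>m<n. (d m x / fact m) * (y - x)^m) + (d n t / fact n) * (y - x)^n"
    using Taylor[of n d "d 0" "min x y" "max x y" x y] assms(1) by auto
  have "(\<Sum>m<n. (d m x / fact m) * (y - x)^m) = 0" using assms(2) by (intro sum.neutral) auto
  with t show ?thesis by (intro exI[of _ t]) (auto split: if_splits)
qed

text \<open>The order of vanishing is bounded at every critical point on the line and not only on
  the fundamental domain. Local estimates can then be made on a full neighbourhood of any point,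
  including the ends of the period.\<close>

locale shear =
  fixes u :: "real \<Rightarrow> real" and n\<^sub>0 :: nat
  assumes smooth: "C_torus (n\<^sub>0 + 2) u"
    and n0_pos: "n\<^sub>0 \<ge> 1"
    and finite_order: "\<And>y. deriv u y = 0 \<Longrightarrow> \<exists>m\<le>n\<^sub>0. vanishing_order u y m"
begin

definition D :: "nat \<Rightarrow> real \<Rightarrow> real" where "D j = (deriv ^^ j) u"

lemma D_0: "D 0 = u" by (simp add: D_def)
lemma D_1: "D 1 = deriv u" by (simp add: D_def)

lemma DERIV_D: "j < n\<^sub>0 + 2 \<Longrightarrow> (D j has_real_derivative D (Suc j) y) (at y)"
  using smooth unfolding C_torus_def D_def by (simp add: DERIV_deriv_iff_field_differentiable)

lemma continuous_D: "j \<le> n\<^sub>0 + 2 \<Longrightarrow> continuous_on S (D j)"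
proof (cases "j = n\<^sub>0 + 2")
  case True
  then show ?thesis using smooth continuous_on_subset[of UNIV "D j" S] unfolding C_torus_def D_def by auto
next
  case False
  assume "j \<le> n\<^sub>0 + 2"
  with False show ?thesis using DERIV_D[of j] by (intro continuous_at_imp_continuous_on) (auto intro: DERIV_isCont)
qed

lemma D_bounded:
  assumes "j \<le> n\<^sub>0 + 2" shows "\<exists>K. \<forall>y\<in>{a..b}. \<bar>D j y\<bar> \<le> K"
  using continuous_interval_bounded[OF continuous_D[OF assms]] by (metis real_norm_def)

lemma D_periodic: "D j (y + 2*pi) = D j y"
proof (induction j arbitrary: y)
  case 0
  then show ?case using smooth by (simp add: D_0 C_torus_def)
next
  case (Suc j)
  have "D (Suc j) (y + 2*pi) = deriv (\<lambda>y. D j (y + 2*pi)) y"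
    by (simp add: D_def deriv_shift)
  also have "\<dots> = D (Suc j) y" using Suc by (simp add: D_def)
  finally show ?case .
qed

text \<open>
  In \<open>i\<theta> \<integral> e\<^bsup>i\<theta>u\<^esup> w = \<integral> (e\<^bsup>i\<theta>u\<^esup>)' w / u'\<close> the factor \<open>1/u'\<close> is replaced by \<open>u'/(u'\<^sup>2 + \<eta>\<^sup>2)\<close>, so that one can
  integrate by parts over the whole period. The error made in doing so has weight \<open>A\<close>, and \<open>B\<close>
  bounds the derivative of the new factor.
\<close>

definition A :: "real \<Rightarrow> real \<Rightarrow> real" where "A \<eta> y = \<eta>\<^sup>2 / ((D 1 y)\<^sup>2 + \<eta>\<^sup>2)"
definition B :: "real \<Rightarrow> real \<Rightarrow> real" where "B \<eta> y = \<bar>D 2 y\<bar> / ((D 1 y)\<^sup>2 + \<eta>\<^sup>2)"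

lemma den_pos: "\<eta> > 0 \<Longrightarrow> (D 1 y)\<^sup>2 + \<eta>\<^sup>2 > 0"
  by (intro add_nonneg_pos) auto

lemma A_nonneg: "\<eta> > 0 \<Longrightarrow> 0 \<le> A \<eta> y" and B_nonneg: "\<eta> > 0 \<Longrightarrow> 0 \<le> B \<eta> y"
  unfolding A_def B_def by (auto intro: divide_nonneg_pos)

lemma continuous_A: "\<eta> > 0 \<Longrightarrow> continuous_on S (A \<eta>)"
  unfolding A_def[abs_def] using den_pos[of \<eta>] continuous_D[of 1] by (intro continuous_intros) (auto simp: less_imp_neq[symmetric])

lemma continuous_B: "\<eta> > 0 \<Longrightarrow> continuous_on S (B \<eta>)"
  unfolding B_def[abs_def] using den_pos[of \<eta>] continuous_D[of 1] continuous_D[of 2] n0_pos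
  by (intro continuous_intros) (auto simp: less_imp_neq[symmetric])

section \<open>Integrals of the weights A and B over a period\<close>

text \<open>Up to sign \<open>B \<eta>\<close> is the derivative of \<open>arctan (u'/\<eta>)/\<eta>\<close>.\<close>

lemma B_integral_monotone:
  assumes "\<eta> > 0" "a \<le> b" and sgn: "(\<forall>y\<in>{a..b}. D 2 y \<ge> 0) \<or> (\<forall>y\<in>{a..b}. D 2 y \<le> 0)"
  shows "integral {a..b} (B \<eta>) \<le> pi / \<eta>"
proof -
  define F where "F y = arctan (D 1 y / \<eta>) / \<eta>" for y
  define \<sigma> where "\<sigma> = (if \<forall>y\<in>{a..b}. D 2 y \<ge> 0 then 1 else -1 :: real)"
  have \<sigma>: "\<bar>D 2 y\<bar> = \<sigma> * D 2 y" if "y \<in> {a..b}" for y using sgn that by (auto simp: \<sigma>_def)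
  have "(F has_real_derivative D 2 y / ((D 1 y)\<^sup>2 + \<eta>\<^sup>2)) (at y)" for y
  proof -
    have "(F has_real_derivative (D 2 y / \<eta>) * inverse (1 + (D 1 y / \<eta>)\<^sup>2) / \<eta>) (at y)"
      unfolding F_def using DERIV_D[of 1 y] assms(1)
      by (auto intro!: derivative_eq_intros simp: numeral_2_eq_2)
    moreover have "(D 2 y / \<eta>) * inverse (1 + (D 1 y / \<eta>)\<^sup>2) / \<eta> = D 2 y / ((D 1 y)\<^sup>2 + \<eta>\<^sup>2)"
      using assms(1) den_pos[OF assms(1), of y] by (simp add: divide_simps power2_eq_square add_ac)
    ultimately show ?thesis by simp
  qed
  then have "((\<lambda>y. \<sigma> * F y) has_real_derivative \<sigma> * (D 2 y / ((D 1 y)\<^sup>2 + \<eta>\<^sup>2))) (at y within {a..b})" for y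
    by (intro DERIV_cmult) (rule has_field_derivative_at_within)
  then have "((\<lambda>y. \<sigma> * (D 2 y / ((D 1 y)\<^sup>2 + \<eta>\<^sup>2))) has_integral (\<sigma> * F b - \<sigma> * F a)) {a..b}"
    using assms(2) by (intro fundamental_theorem_of_calculus) (auto simp flip: has_real_derivative_iff_has_vector_derivative)
  then have "(B \<eta> has_integral (\<sigma> * F b - \<sigma> * F a)) {a..b}"
    by (rule has_integral_eq[rotated]) (auto simp: B_def \<sigma>)
  then have "integral {a..b} (B \<eta>) = \<sigma> * (F b - F a)" by (simp add: integral_unique algebra_simps)
  also have "\<dots> \<le> \<bar>F b\<bar> + \<bar>F a\<bar>" by (auto simp: \<sigma>_def)
  also have "\<dots> \<le> pi / 2 / \<eta> + pi / 2 / \<eta>"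
  proof -
    have "\<bar>F y\<bar> \<le> pi / 2 / \<eta>" for y
      unfolding F_def abs_divide using assms(1) arctan_lbound[of "D 1 y / \<eta>"] arctan_ubound[of "D 1 y / \<eta>"]
      by (intro divide_mono) auto
    then show ?thesis by (intro add_mono)
  qed
  finally show ?thesis by simp
qed

text \<open>The antiderivative is \<open>\<delta>\<close> * arctan((y - x)/\<open>\<delta>\<close>),
  so the mass on the whole line is pi * \<open>\<delta>\<close>. This kernel is the majorant of
  \<open>A\<close> near a critical point.\<close>

lemma integral_lorentzian:
  fixes \<delta> :: real assumes "\<delta> > 0" "a \<le> b"
  shows "integral {a..b} (\<lambda>y. \<delta>\<^sup>2 / (\<delta>\<^sup>2 + (y - x)\<^sup>2)) \<le> pi * \<delta>"
proof -
  define F where "F y = \<delta> * arctan ((y - x) / \<delta>)" for y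
  have pos: "\<delta>\<^sup>2 + (y - x)\<^sup>2 > 0" for y using assms(1) by (intro add_pos_nonneg) auto
  have "(F has_real_derivative \<delta>\<^sup>2 / (\<delta>\<^sup>2 + (y - x)\<^sup>2)) (at y within {a..b})" for y
  proof -
    have "(F has_real_derivative \<delta> * ((1 / \<delta>) * inverse (1 + ((y - x) / \<delta>)\<^sup>2))) (at y within {a..b})"
      unfolding F_def using assms(1) by (auto intro!: derivative_eq_intros)
    moreover have "\<delta> * ((1 / \<delta>) * inverse (1 + ((y - x) / \<delta>)\<^sup>2)) = \<delta>\<^sup>2 / (\<delta>\<^sup>2 + (y - x)\<^sup>2)"
      using assms(1) pos[of y] by (simp add: divide_simps power2_eq_square)
    ultimately show ?thesis by simp
  qed
  then have "((\<lambda>y. \<delta>\<^sup>2 / (\<delta>\<^sup>2 + (y - x)\<^sup>2)) has_integral (F b - F a)) {a..b}"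
    using assms(2) by (intro fundamental_theorem_of_calculus) (auto simp flip: has_real_derivative_iff_has_vector_derivative)
  then have "integral {a..b} (\<lambda>y. \<delta>\<^sup>2 / (\<delta>\<^sup>2 + (y - x)\<^sup>2)) = F b - F a" by (simp add: integral_unique)
  also have "\<dots> \<le> pi / 2 * \<delta> + pi / 2 * \<delta>"
  proof -
    have "F b \<le> \<delta> * (pi / 2)" "F a \<ge> \<delta> * (- (pi / 2))"
      unfolding F_def using assms(1) arctan_lbound[of "(a - x) / \<delta>"] arctan_ubound[of "(b - x) / \<delta>"]
      by (intro mult_left_mono; simp)+
    then show ?thesis by (simp add: mult.commute)
  qed
  finally show ?thesis by (simp add: mult.commute)
qed

text \<open>Near a critical point of order m the set where |u'| is at most \<open>\<eta>\<close> has
  length about \<open>\<eta>\<close> powr (1/m), which explains the first exponent; the second is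
  the total variation of arctan(u'/\<open>\<eta>\<close>)/\<open>\<eta>\<close>. As a property of an
  interval the estimate can be localised: it is additive over adjacent intervals and inherited by
  subintervals.\<close>

definition est :: "real \<Rightarrow> real \<Rightarrow> bool" where
  "est a b \<longleftrightarrow> (\<exists>C. \<forall>\<eta>. 0 < \<eta> \<and> \<eta> \<le> 1 \<longrightarrow>
     integral {a..b} (A \<eta>) \<le> C * \<eta> powr (1 / real n\<^sub>0) \<and> integral {a..b} (B \<eta>) \<le> C / \<eta>)"

lemma est_join:
  assumes "est a b" "est b c" "a \<le> b" "b \<le> c"
  shows "est a c"
proof -
  obtain C1 C2 where C: "\<And>\<eta>. 0 < \<eta> \<Longrightarrow> \<eta> \<le> 1 \<Longrightarrow>
     integral {a..b} (A \<eta>) \<le> C1 * \<eta> powr (1 / real n\<^sub>0) \<and> integral {a..b} (B \<eta>) \<le> C1 / \<eta>"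
   "\<And>\<eta>. 0 < \<eta> \<Longrightarrow> \<eta> \<le> 1 \<Longrightarrow>
     integral {b..c} (A \<eta>) \<le> C2 * \<eta> powr (1 / real n\<^sub>0) \<and> integral {b..c} (B \<eta>) \<le> C2 / \<eta>"
    using assms(1,2) unfolding est_def by meson
  have "integral {a..c} (A \<eta>) \<le> (C1 + C2) * \<eta> powr (1 / real n\<^sub>0) \<and> integral {a..c} (B \<eta>) \<le> (C1 + C2) / \<eta>"
    if "0 < \<eta>" "\<eta> \<le> 1" for \<eta>
  proof -
    have "integral {a..b} f + integral {b..c} f = integral {a..c} f" if "continuous_on {a..c} f" for f :: "real \<Rightarrow> real"
      using assms(3,4) that by (intro Henstock_Kurzweil_Integration.integral_combine integrable_continuous_interval)
    note * = this[OF continuous_A[OF \<open>0 < \<eta>\<close>]] this[OF continuous_B[OF \<open>0 < \<eta>\<close>]]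
    show ?thesis using C(1)[OF that] C(2)[OF that] unfolding *[symmetric] ring_distribs add_divide_distrib by linarith
  qed
  then show ?thesis unfolding est_def by blast
qed

lemma est_subset:
  assumes "est a b" "a \<le> a'" "b' \<le> b" shows "est a' b'"
proof -
  have sub: "integral {a'..b'} f \<le> integral {a..b} f" if "continuous_on UNIV f" "\<And>y. 0 \<le> f y" for f :: "real \<Rightarrow> real"
    using assms(2,3) that continuous_on_subset[OF that(1)]
    by (intro integral_subset_le integrable_continuous_interval) auto
  have "integral {a'..b'} (A \<eta>) \<le> integral {a..b} (A \<eta>)" "integral {a'..b'} (B \<eta>) \<le> integral {a..b} (B \<eta>)" if "0 < \<eta>" for \<eta>
    using that by (auto intro!: sub continuous_A continuous_B A_nonneg B_nonneg)
  then show ?thesis using assms(1) unfolding est_def by (meson order_trans)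
qed

lemma D_near:
  assumes "j \<le> n\<^sub>0 + 2" "D j x \<noteq> 0"
  obtains r where "r > 0" "\<And>y. \<bar>y - x\<bar> \<le> r \<Longrightarrow> \<bar>D j y\<bar> \<ge> \<bar>D j x\<bar> / 2 \<and> sgn (D j y) = sgn (D j x)"
proof -
  have "isCont (D j) x" using continuous_D[OF assms(1), of UNIV] by (simp add: continuous_on_eq_continuous_at)
  then have "\<exists>r>0. \<forall>y. \<bar>y - x\<bar> < r \<longrightarrow> \<bar>D j y - D j x\<bar> < \<bar>D j x\<bar> / 2"
    unfolding continuous_at_eps_delta dist_real_def using assms(2) by (metis zero_less_abs_iff half_gt_zero)
  then obtain r where r: "r > 0" "\<And>y. \<bar>y - x\<bar> < r \<Longrightarrow> \<bar>D j y - D j x\<bar> < \<bar>D j x\<bar> / 2" by blast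
  have "\<bar>D j y\<bar> \<ge> \<bar>D j x\<bar> / 2 \<and> sgn (D j y) = sgn (D j x)" if "\<bar>y - x\<bar> \<le> r / 2" for y
  proof -
    have "\<bar>y - x\<bar> < r" using that r(1) by linarith
    from r(2)[OF this] assms(2) show ?thesis by (simp add: abs_if sgn_if split: if_splits)
  qed
  then show ?thesis using r(1) by (intro that[OF half_gt_zero])
qed

text \<open>If |u'| is at least c, then \<open>A\<close> is at most \<open>\<eta>\<close>^2/c^2 and
  \<open>B\<close> is bounded independently of \<open>\<eta>\<close>. For \<open>\<eta>\<close> at
  most 1 both are better than required.\<close>

lemma est_noncritical:
  assumes "D 1 x \<noteq> 0" shows "\<exists>r>0. est (x - r) (x + r)"
proof -
  define c where "c = \<bar>D 1 x\<bar> / 2"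
  have c: "c > 0" using assms by (simp add: c_def)
  obtain r where "r > 0" and near: "\<And>y. \<bar>y - x\<bar> \<le> r \<Longrightarrow> \<bar>D 1 y\<bar> \<ge> c"
    using D_near[OF _ assms] unfolding c_def by (metis trans_le_add2 one_le_numeral)
  then have r: "r > 0" "\<And>y. y \<in> {x-r..x+r} \<Longrightarrow> \<bar>D 1 y\<bar> \<ge> c" by auto
  obtain K where K: "\<And>y. y \<in> {x-r..x+r} \<Longrightarrow> \<bar>D 2 y\<bar> \<le> K"
    using D_bounded[of 2 "x-r" "x+r"] n0_pos by (metis trans_le_add2 order_refl)
  have "0 \<le> K" using K[of x] r by (smt (verit) atLeastAtMost_iff)
  define C where "C = 2 * r * (1 / c\<^sup>2 + K / c\<^sup>2)"
  have "integral {x-r..x+r} (A \<eta>) \<le> C * \<eta> powr (1 / real n\<^sub>0) \<and> integral {x-r..x+r} (B \<eta>) \<le> C / \<eta>"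
    if \<eta>: "0 < \<eta>" "\<eta> \<le> 1" for \<eta>
  proof
    have c2: "c\<^sup>2 \<le> (D 1 y)\<^sup>2" if "y \<in> {x-r..x+r}" for y
      using power_mono[OF r(2)[OF that], of 2] c by simp
    have pw: "\<eta> \<le> \<eta> powr (1 / real n\<^sub>0)"
      using \<eta> n0_pos powr_mono'[of "1 / real n\<^sub>0" 1 \<eta>] by (simp add: divide_le_eq)
    have "integral {x-r..x+r} (A \<eta>) \<le> integral {x-r..x+r} (\<lambda>_. 1 / c\<^sup>2 * \<eta> powr (1 / real n\<^sub>0))"
    proof (rule integral_le)
      fix y assume y: "y \<in> {x-r..x+r}"
      have "\<eta>\<^sup>2 \<le> \<eta>" using \<eta> by (simp add: power2_eq_square mult_left_le)
      have "A \<eta> y \<le> \<eta>\<^sup>2 / c\<^sup>2" unfolding A_def using c2[OF y] c by (intro divide_left_mono mult_pos_pos add_pos_nonneg) (auto intro: add_increasing2)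
      also have "\<dots> \<le> \<eta> powr (1 / real n\<^sub>0) / c\<^sup>2" using pw \<open>\<eta>\<^sup>2 \<le> \<eta>\<close> by (intro divide_right_mono) auto
      finally show "A \<eta> y \<le> 1 / c\<^sup>2 * \<eta> powr (1 / real n\<^sub>0)" by simp
    qed (auto intro!: integrable_continuous_interval continuous_A \<eta>)
    also have "\<dots> = 2 * r * (1 / c\<^sup>2) * \<eta> powr (1 / real n\<^sub>0)" using r by simp
    also have "\<dots> \<le> C * \<eta> powr (1 / real n\<^sub>0)"
      unfolding C_def using r \<open>0 \<le> K\<close> by (intro mult_right_mono mult_left_mono) auto
    finally show "integral {x-r..x+r} (A \<eta>) \<le> C * \<eta> powr (1 / real n\<^sub>0)" .
    have "integral {x-r..x+r} (B \<eta>) \<le> integral {x-r..x+r} (\<lambda>_. K / c\<^sup>2)"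
    proof (rule integral_le)
      fix y assume y: "y \<in> {x-r..x+r}"
      show "B \<eta> y \<le> K / c\<^sup>2" unfolding B_def using c2[OF y] c K[OF y] \<open>0 \<le> K\<close>
        by (intro frac_le) (auto intro: add_increasing2)
    qed (auto intro!: integrable_continuous_interval continuous_B \<eta>)
    also have "\<dots> = 2 * r * (K / c\<^sup>2)" using r by simp
    also have "\<dots> \<le> C" unfolding C_def using r \<open>0 \<le> K\<close> by (intro mult_left_mono) auto
    also have "\<dots> \<le> C / \<eta>" using \<eta> r \<open>0 \<le> K\<close> by (simp add: le_divide_eq C_def mult_left_le)
    finally show "integral {x-r..x+r} (B \<eta>) \<le> C / \<eta>" .
  qed
  then show ?thesis using r(1) unfolding est_def by blast
qed

text \<open>Taylor expansion at a critical point of order m gives |u'| at least c1 |y - x|^m, so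
  \<open>A\<close> lies below a Lorentzian of width \<open>\<eta>\<close> powr (1/m). It also shows
  that u'' keeps its sign on each side of x, so each half contributes at most
  pi/\<open>\<eta>\<close> to the integral of \<open>B\<close>.\<close>

lemma est_critical:
  assumes x: "D 1 x = 0" shows "\<exists>r>0. est (x - r) (x + r)"
proof -
  obtain m where m: "m \<le> n\<^sub>0" "vanishing_order u x m" using finite_order[of x] x D_1 by metis
  have m1: "m \<ge> 1" and Dx: "\<And>j. 1 \<le> j \<Longrightarrow> j \<le> m \<Longrightarrow> D j x = 0" and Dm: "D (m + 1) x \<noteq> 0"
    using m(2) by (auto simp: vanishing_order_def D_def)
  define c where "c = \<bar>D (m+1) x\<bar> / 2"
  have c: "c > 0" using Dm by (simp add: c_def)
  obtain r where r: "r > 0" and near: "\<And>t. \<bar>t - x\<bar> \<le> r \<Longrightarrow> \<bar>D (m+1) t\<bar> \<ge> c"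
    "\<And>t. \<bar>t - x\<bar> \<le> r \<Longrightarrow> sgn (D (m+1) t) = sgn (D (m+1) x)"
    using D_near[OF _ Dm] m(1) unfolding c_def by (metis add_le_mono one_le_numeral)
  define c1 where "c1 = c / fact m"
  have c1: "c1 > 0" using c by (simp add: c1_def)
  have D1: "\<bar>D 1 y\<bar> \<ge> c1 * \<bar>y - x\<bar> ^ m" if "\<bar>y - x\<bar> \<le> r" for y
  proof -
    obtain t where t: "\<bar>t - x\<bar> \<le> \<bar>y - x\<bar>" "D 1 y = D (m+1) t / fact m * (y - x) ^ m"
      using Taylor_vanishing[of m "\<lambda>j. D (j+1)" x y] DERIV_D Dx m(1) by (auto simp: le_imp_less_Suc)
    have "c1 * \<bar>y - x\<bar> ^ m \<le> \<bar>D (m+1) t\<bar> / fact m * \<bar>y - x\<bar> ^ m"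
      unfolding c1_def using near(1)[of t] t that by (intro mult_right_mono divide_right_mono) auto
    then show ?thesis using t(2) by (simp add: abs_mult power_abs)
  qed
  have D2: "sgn (D 2 y) = sgn (D (m+1) x) * sgn (y - x) ^ (m - 1)" if "\<bar>y - x\<bar> \<le> r" for y
  proof -
    have idx: "m - 1 + 2 = m + 1" using m1 by simp
    have "(D (j+2) has_real_derivative D (Suc j + 2) t) (at t)" if "j < m - 1" for j t
      using DERIV_D[of "j+2" t] that m(1) by simp
    moreover have "D (j+2) x = 0" if "j < m - 1" for j using Dx that by simp
    ultimately obtain t where t: "\<bar>t - x\<bar> \<le> \<bar>y - x\<bar>" "D (0+2) y = D (m-1+2) t / fact (m-1) * (y - x) ^ (m-1)"
      using Taylor_vanishing[of "m-1" "\<lambda>j. D (j+2)" x y] by blast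
    then have "D 2 y = D (m+1) t / fact (m-1) * (y - x) ^ (m-1)" unfolding idx by (simp only: add_0)
    then have "sgn (D 2 y) = sgn (D (m+1) t) * sgn (y - x) ^ (m-1)" 
      by (simp add: sgn_mult sgn_divide)
    then show ?thesis using near(2)[of t] t that by simp
  qed
  \<comment> \<open>\<open>\<omega>\<close> is 1 to the right of \<open>x\<close> and -1 to the
    left, so one argument covers both sides.\<close>
  have side: "(\<forall>y\<in>I. D 2 y \<ge> 0) \<or> (\<forall>y\<in>I. D 2 y \<le> 0)"
    if I: "\<And>y. y \<in> I \<Longrightarrow> \<bar>y - x\<bar> \<le> r \<and> 0 \<le> \<omega> * (y - x)" and \<omega>: "\<omega> = 1 \<or> \<omega> = -1" for I and \<omega> :: real
  proof -
    define e where "e = sgn (D (m+1) x) * \<omega> ^ (m-1)"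
    have eq: "sgn (D 2 y) = e * sgn (\<omega> * (y - x)) ^ (m-1)" if "y \<in> I" for y
    proof -
      have "sgn (y - x) = \<omega> * sgn (\<omega> * (y - x))" using \<omega> by (auto simp: sgn_mult)
      then have "sgn (y - x) ^ (m-1) = \<omega> ^ (m-1) * sgn (\<omega> * (y - x)) ^ (m-1)"
        by (simp only: power_mult_distrib)
      then show ?thesis using D2[of y] I[OF that] by (simp add: e_def mult.assoc)
    qed
    have nn: "0 \<le> sgn (\<omega> * (y - x)) ^ (m-1)" if "y \<in> I" for y
      using I[OF that] by (intro zero_le_power) (simp only: zero_le_sgn_iff)
    show ?thesis
    proof (cases "e \<ge> 0")
      case True
      then have "0 \<le> sgn (D 2 y)" if "y \<in> I" for y
        unfolding eq[OF that] by (rule mult_nonneg_nonneg[OF _ nn[OF that]])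
      then show ?thesis by simp
    next
      case False
      then have "sgn (D 2 y) \<le> 0" if "y \<in> I" for y
        unfolding eq[OF that] by (intro mult_nonpos_nonneg nn[OF that]) simp
      then show ?thesis by simp
    qed
  qed
  have right: "(\<forall>y\<in>{x..x+r}. D 2 y \<ge> 0) \<or> (\<forall>y\<in>{x..x+r}. D 2 y \<le> 0)"
    by (rule side[of _ 1]) auto
  have left: "(\<forall>y\<in>{x-r..x}. D 2 y \<ge> 0) \<or> (\<forall>y\<in>{x-r..x}. D 2 y \<le> 0)"
    by (rule side[of _ "-1"]) auto
  \<comment> \<open>Within distance \<open>\<delta>\<close> of \<open>x\<close> the Lorentzian is at
    least 1/2 while \<open>A\<close> is at most 1. Farther out, at distance s, \<open>A\<close> is
    at most \<open>\<delta>\<close>^2/(c1 s)^2, and 2 s^2 exceeds the denominator of the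
    Lorentzian.\<close>
  define K where "K = max 2 (2 / c1\<^sup>2)"
  have "integral {x-r..x+r} (A \<eta>) \<le> (K * pi + 2 * pi) * \<eta> powr (1 / real n\<^sub>0) \<and> integral {x-r..x+r} (B \<eta>) \<le> (K * pi + 2 * pi) / \<eta>"
    if \<eta>: "0 < \<eta>" "\<eta> \<le> 1" for \<eta>
  proof
    \<comment> \<open>the distance to \<open>x\<close> at which \<open>\<bar>u'\<bar>\<close> is comparable to \<open>\<eta>\<close>\<close>
    define \<delta> where "\<delta> = \<eta> powr (1 / real m)"
    have \<delta>: "\<delta> > 0" "\<delta> ^ m = \<eta>" using \<eta> m1 by (auto simp: \<delta>_def powr_realpow[symmetric] powr_powr)
    have \<delta>le: "\<delta> \<le> \<eta> powr (1 / real n\<^sub>0)"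
      unfolding \<delta>_def using \<eta> m1 m(1) by (intro powr_mono') (auto intro!: divide_left_mono)
    have pos: "\<delta>\<^sup>2 + (y - x)\<^sup>2 > 0" for y using \<delta>(1) by (intro add_pos_nonneg) auto
    have Ale: "A \<eta> y \<le> K * (\<delta>\<^sup>2 / (\<delta>\<^sup>2 + (y - x)\<^sup>2))" if y: "y \<in> {x-r..x+r}" for y
    proof (cases "\<bar>y - x\<bar> \<le> \<delta>")
      case True
      have "A \<eta> y \<le> 1" unfolding A_def using den_pos[OF \<eta>(1), of y] by (simp add: divide_le_eq)
      also have "1 \<le> 2 * (\<delta>\<^sup>2 / (\<delta>\<^sup>2 + (y - x)\<^sup>2))"
        using power_mono[OF True, of 2] pos[of y] by (simp add: le_divide_eq)
      also have "\<dots> \<le> K * (\<delta>\<^sup>2 / (\<delta>\<^sup>2 + (y - x)\<^sup>2))" unfolding K_def using pos[of y] by (intro mult_right_mono) auto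
      finally show ?thesis .
    next
      case False
      define s where "s = \<bar>y - x\<bar>"
      have s: "s > \<delta>" "s > 0" "(y - x)\<^sup>2 = s\<^sup>2" using False \<delta> by (auto simp: s_def)
      have "\<bar>D 1 y\<bar> \<ge> c1 * s ^ m" using D1[of y] y by (auto simp: s_def)
      also have "c1 * s ^ m \<ge> c1 * (\<eta> * (s / \<delta>))"
      proof -
        \<comment> \<open>Outside the core, linear growth of u' is enough whatever \<open>m\<close>
          is: \<open>A\<close> then decays quadratically, which is integrable.\<close>
        have "s / \<delta> \<le> (s / \<delta>) ^ m" using s \<delta> m1 by (intro self_le_power) (auto simp: le_divide_eq)
        then have "\<eta> * (s / \<delta>) \<le> \<eta> * (s / \<delta>) ^ m" using \<eta> by (intro mult_left_mono) auto
        also have "\<dots> = s ^ m" using \<eta> \<delta>(2) by (simp add: power_divide)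
        finally show ?thesis using c1 by (intro mult_left_mono) auto
      qed
      finally have "(c1 * (\<eta> * (s / \<delta>)))\<^sup>2 \<le> \<bar>D 1 y\<bar>\<^sup>2" using c1 \<eta> s \<delta> by (intro power_mono) auto
      then have d: "(c1 * (\<eta> * (s / \<delta>)))\<^sup>2 \<le> (D 1 y)\<^sup>2 + \<eta>\<^sup>2" by (simp add: add_increasing2)
      have "A \<eta> y \<le> \<eta>\<^sup>2 / (c1 * (\<eta> * (s / \<delta>)))\<^sup>2" unfolding A_def using d c1 \<eta> s \<delta>
        by (intro divide_left_mono mult_pos_pos den_pos) auto
      also have "\<dots> = (2 / c1\<^sup>2) * (\<delta>\<^sup>2 / (s\<^sup>2 + s\<^sup>2))" using c1 \<eta> s \<delta> by (simp add: field_simps)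
      also have "\<dots> \<le> K * (\<delta>\<^sup>2 / (\<delta>\<^sup>2 + (y - x)\<^sup>2))"
        unfolding K_def s(3) using s \<delta> by (intro mult_mono divide_left_mono add_right_mono power_mono) (auto intro!: add_pos_pos mult_pos_pos)
      finally show ?thesis .
    qed
    have "integral {x-r..x+r} (A \<eta>) \<le> integral {x-r..x+r} (\<lambda>y. K * (\<delta>\<^sup>2 / (\<delta>\<^sup>2 + (y - x)\<^sup>2)))"
      by (intro integral_le integrable_continuous_interval continuous_A continuous_intros Ale ballI \<eta> less_imp_neq[OF pos, symmetric])
    also have "\<dots> \<le> K * (pi * \<delta>)"
      unfolding Henstock_Kurzweil_Integration.integral_mult_right using r
      by (intro mult_left_mono integral_lorentzian \<delta>) (auto simp: K_def)
    also have "\<dots> \<le> (K * pi + 2 * pi) * \<eta> powr (1 / real n\<^sub>0)"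
    proof -
      have "K * pi * \<delta> \<le> (K * pi + 2 * pi) * \<eta> powr (1 / real n\<^sub>0)"
        using \<delta>le \<delta> by (intro mult_mono) (auto simp: K_def)
      then show ?thesis by (simp add: mult.assoc)
    qed
    finally show "integral {x-r..x+r} (A \<eta>) \<le> (K * pi + 2 * pi) * \<eta> powr (1 / real n\<^sub>0)" .
    have "integral {x-r..x+r} (B \<eta>) = integral {x-r..x} (B \<eta>) + integral {x..x+r} (B \<eta>)"
      using r \<eta> by (intro Henstock_Kurzweil_Integration.integral_combine[symmetric] integrable_continuous_interval continuous_B) auto
    also have "\<dots> \<le> pi / \<eta> + pi / \<eta>"
      using r \<eta> left right by (intro add_mono B_integral_monotone) auto
    also have "\<dots> \<le> (K * pi + 2 * pi) / \<eta>"
      unfolding add_divide_distrib[symmetric] using \<eta> by (intro divide_right_mono) (auto simp: K_def)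
    finally show "integral {x-r..x+r} (B \<eta>) \<le> (K * pi + 2 * pi) / \<eta>" .
  qed
  then show ?thesis using r unfolding est_def by blast
qed

text \<open>Compactness in the form of bisection: a property that holds near every point and is
  additive over adjacent intervals holds on the whole period.\<close>

lemma est_period: "est 0 (2*pi)"
proof (rule Bolzano)
  show "0 \<le> 2*pi" by simp
  show "est a c" if "est a b" "est b c" "a \<le> b" "b \<le> c" for a b c
    by (rule est_join[OF that])
  show "\<exists>d>0. \<forall>a b. a \<le> x \<and> x \<le> b \<and> b - a < d \<longrightarrow> est a b" for x
  proof -
    obtain r where r: "r > 0" "est (x - r) (x + r)" using est_critical est_noncritical by blast
    have "est a b" if "a \<le> x \<and> x \<le> b \<and> b - a < r" for a b
      by (rule est_subset[OF r(2)]) (use that in auto)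
    then show ?thesis using r(1) by blast
  qed
qed

text \<open>One constant must serve all amplitudes, phases and regularisations.
  \<open>\<eta>\<close> stays free because its best value depends on the ratio of the two error
  terms; it is chosen only when the frequency cutoff is known.\<close>

definition mixing_constant :: "real \<Rightarrow> bool" where
  "mixing_constant C \<longleftrightarrow> C > 0 \<and> (\<forall>(w :: real \<Rightarrow> complex) w' \<theta> \<eta> W V.
      (\<forall>y. (w has_vector_derivative w' y) (at y)) \<longrightarrow> continuous_on UNIV w' \<longrightarrow> w (2*pi) = w 0 \<longrightarrow>
      (\<forall>y\<in>{0..2*pi}. cmod (w y) \<le> W) \<longrightarrow> integral {0..2*pi} (\<lambda>y. cmod (w' y)) \<le> V \<longrightarrow>
      \<theta> \<noteq> 0 \<longrightarrow> 0 < \<eta> \<longrightarrow> \<eta> \<le> 1 \<longrightarrow>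
      cmod (integral {0..2*pi} (\<lambda>y. cis (\<theta> * u y) * w y))
        \<le> C * W * \<eta> powr (1 / real n\<^sub>0) + C * (V + W) / (\<eta> * \<bar>\<theta>\<bar>))"

text \<open>With h = u'/(u'^2 + \<open>\<eta>\<close>^2) one has u' h = 1 - \<open>A\<close>, |h| at
  most 1/\<open>\<eta>\<close> and |h'| at most \<open>B\<close>. Integrating the derivative of e^(i
  \<open>\<theta>\<close> u) w h over a period expresses the integral with weight 1 -
  \<open>A\<close> through integrals of w' h and w h', divided by \<open>\<theta>\<close>. The part
  with weight \<open>A\<close> is estimated by absolute values.\<close>

theorem mixing: "\<exists>C. mixing_constant C"
proof -
  obtain C0 where C0: "\<And>\<eta>. 0 < \<eta> \<Longrightarrow> \<eta> \<le> 1 \<Longrightarrow> integral {0..2*pi} (A \<eta>) \<le> C0 * \<eta> powr (1 / real n\<^sub>0)"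
     "\<And>\<eta>. 0 < \<eta> \<Longrightarrow> \<eta> \<le> 1 \<Longrightarrow> integral {0..2*pi} (B \<eta>) \<le> C0 / \<eta>"
    using est_period unfolding est_def by meson
  \<comment> \<open>The term with \<open>V\<close> comes with coefficient 1, hence the maximum with
    1.\<close>
  define C where "C = max 1 C0"
  have C: "C > 0" "C \<ge> 1" "C0 \<le> C" by (auto simp: C_def)
  show ?thesis unfolding mixing_constant_def
  proof (intro exI[of _ C] conjI allI impI)
    show "C > 0" by (rule C(1))
  next
    fix w w' :: "real \<Rightarrow> complex" and \<theta> \<eta> W V :: real
    assume "\<forall>y. (w has_vector_derivative w' y) (at y)" and w': "continuous_on UNIV w'"
      and per: "w (2*pi) = w 0" and "\<forall>y\<in>{0..2*pi}. cmod (w y) \<le> W"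
      and V: "integral {0..2*pi} (\<lambda>y. cmod (w' y)) \<le> V"
      and \<theta>: "\<theta> \<noteq> 0" and \<eta>: "0 < \<eta>" "\<eta> \<le> 1"
    then have w: "\<And>y. (w has_vector_derivative w' y) (at y)"
      and W: "\<And>y. y \<in> {0..2*pi} \<Longrightarrow> cmod (w y) \<le> W" by auto
    have W0: "0 \<le> W" by (rule order_trans[OF norm_ge_zero W[of 0]]) auto
    have wc: "continuous_on S w" for S
      using w by (intro continuous_at_imp_continuous_on) (auto intro: has_vector_derivative_continuous)
    have w'c: "continuous_on S w'" for S using w' continuous_on_subset by blast
    define h where "h y = D 1 y / ((D 1 y)\<^sup>2 + \<eta>\<^sup>2)" for y
    define h' where "h' y = D 2 y * (\<eta>\<^sup>2 - (D 1 y)\<^sup>2) / ((D 1 y)\<^sup>2 + \<eta>\<^sup>2)\<^sup>2" for y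
    note dp = den_pos[OF \<eta>(1)]
    have dnz: "(D 1 y)\<^sup>2 + \<eta>\<^sup>2 \<noteq> 0" for y by (rule less_imp_neq[OF dp, symmetric])
    have h: "(h has_real_derivative h' y) (at y)" for y
    proof -
      have "(h has_real_derivative (D 2 y * ((D 1 y)\<^sup>2 + \<eta>\<^sup>2) - D 1 y * (2 * D 1 y * D 2 y)) / (((D 1 y)\<^sup>2 + \<eta>\<^sup>2) * ((D 1 y)\<^sup>2 + \<eta>\<^sup>2))) (at y)"
        unfolding h_def using DERIV_D[of 1 y] dnz
        by (auto intro!: derivative_eq_intros simp: numeral_2_eq_2)
      then show ?thesis by (simp add: h'_def power2_eq_square algebra_simps)
    qed
    have h'b: "\<bar>h' y\<bar> \<le> B \<eta> y" for y
    proof -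
      have "\<bar>\<eta>\<^sup>2 - (D 1 y)\<^sup>2\<bar> \<le> (D 1 y)\<^sup>2 + \<eta>\<^sup>2" by (simp add: abs_if)
      then have "\<bar>D 2 y\<bar> * \<bar>\<eta>\<^sup>2 - (D 1 y)\<^sup>2\<bar> / ((D 1 y)\<^sup>2 + \<eta>\<^sup>2)\<^sup>2 \<le> \<bar>D 2 y\<bar> * ((D 1 y)\<^sup>2 + \<eta>\<^sup>2) / ((D 1 y)\<^sup>2 + \<eta>\<^sup>2)\<^sup>2"
        by (intro divide_right_mono mult_left_mono) auto
      also have "\<dots> = B \<eta> y" unfolding B_def using dnz[of y] by (simp add: power2_eq_square)
      finally show ?thesis by (simp add: h'_def abs_mult)
    qed
    have hb: "\<bar>h y\<bar> \<le> 1 / \<eta>" for y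
    proof -
      have "\<bar>D 1 y\<bar> * \<eta> \<le> (D 1 y)\<^sup>2 + \<eta>\<^sup>2"
        using sum_squares_bound[of "\<bar>D 1 y\<bar>" \<eta>] mult_nonneg_nonneg[OF abs_ge_zero[of "D 1 y"] less_imp_le[OF \<eta>(1)]]
        unfolding power2_abs by linarith
      then show ?thesis using dp[of y] \<eta> by (simp add: h_def abs_divide divide_le_eq le_divide_eq field_simps abs_of_pos)
    qed
    have hc: "continuous_on S h" for S
      using h by (intro continuous_at_imp_continuous_on) (auto intro: DERIV_isCont)
    have h'c: "continuous_on S h'" for S
      unfolding h'_def using dnz continuous_D[of 1] continuous_D[of 2] n0_pos by (intro continuous_intros) auto
    have uc: "continuous_on S u" for S using continuous_D[of 0] by (simp add: D_0)
    define E where "E y = cis (\<theta> * u y)" for y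
    have Ec: "continuous_on S E" for S unfolding E_def by (intro continuous_intros uc)
    have nE: "cmod (E y) = 1" for y by (simp add: E_def)
    have Ed: "(E has_vector_derivative \<i> * of_real (\<theta> * D 1 y) * E y) (at y)" for y
      unfolding E_def using DERIV_D[of 0 y]
      by (intro has_vector_derivative_cis_comp) (auto intro!: derivative_eq_intros simp: D_0)
    define G where "G y = E y * w y * of_real (h y)" for y
    define R where "R y = E y * w' y * of_real (h y) + E y * w y * of_real (h' y)" for y
    have Rc: "continuous_on S R" for S unfolding R_def by (intro continuous_intros Ec w'c wc hc h'c)
    have "(G has_vector_derivative \<i> * of_real \<theta> * (E y * w y * of_real (1 - A \<eta> y)) + R y) (at y)" for y
    proof -
      have hv: "((\<lambda>y. complex_of_real (h y)) has_vector_derivative of_real (h' y)) (at y)"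
        using h by (rule has_vector_derivative_of_real)
      have e: "1 - A \<eta> y = D 1 y * h y" unfolding A_def h_def using dnz[of y] by (simp add: field_simps power2_eq_square)
      show ?thesis unfolding G_def
        by (rule has_vector_derivative_eq_rhs[OF has_vector_derivative_mult[OF has_vector_derivative_mult[OF Ed w] hv]])
           (simp add: R_def e algebra_simps)
    qed
    then have "((\<lambda>y. \<i> * of_real \<theta> * (E y * w y * of_real (1 - A \<eta> y)) + R y) has_integral (G (2*pi) - G 0)) {0..2*pi}"
      by (intro fundamental_theorem_of_calculus) (auto intro: has_vector_derivative_at_within)
    \<comment> \<open>Periodicity of u, u' and w removes the boundary terms.\<close>
    moreover have "G (2*pi) = G 0"
      using D_periodic[of 0 0] D_periodic[of 1 0] per by (simp add: G_def E_def h_def D_0)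
    ultimately have I0: "integral {0..2*pi} (\<lambda>y. \<i> * of_real \<theta> * (E y * w y * of_real (1 - A \<eta> y)) + R y) = 0"
      by (simp add: integral_unique)
    have int: "f integrable_on {0..2*pi}" if "continuous_on {0..2*pi} f" for f :: "real \<Rightarrow> 'b::banach"
      using that by (rule integrable_continuous_interval)
    have Ac: "continuous_on S (A \<eta>)" for S by (rule continuous_A[OF \<eta>(1)])
    have Bc: "continuous_on S (B \<eta>)" for S by (rule continuous_B[OF \<eta>(1)])
    define J where "J = integral {0..2*pi} (\<lambda>y. E y * w y)"
    have "integral {0..2*pi} (\<lambda>y. \<i> * of_real \<theta> * (E y * w y * of_real (1 - A \<eta> y)) + R y)
        = \<i> * of_real \<theta> * integral {0..2*pi} (\<lambda>y. E y * w y * of_real (1 - A \<eta> y)) + integral {0..2*pi} R"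
      by (subst Henstock_Kurzweil_Integration.integral_add) (auto intro!: int continuous_intros Ec wc Ac Rc)
    also have "integral {0..2*pi} (\<lambda>y. E y * w y * of_real (1 - A \<eta> y)) = J - integral {0..2*pi} (\<lambda>y. E y * w y * of_real (A \<eta> y))"
    proof -
      have "(\<lambda>y. E y * w y * of_real (1 - A \<eta> y)) = (\<lambda>y. E y * w y - E y * w y * of_real (A \<eta> y))"
        by (simp add: algebra_simps)
      then show ?thesis
        unfolding J_def by (simp only:) (intro Henstock_Kurzweil_Integration.integral_diff int continuous_intros Ec wc Ac)
    qed
    finally have "\<i> * of_real \<theta> * (J - integral {0..2*pi} (\<lambda>y. E y * w y * of_real (A \<eta> y))) = - integral {0..2*pi} R"
      using I0 by (simp add: eq_neg_iff_add_eq_0)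
    then have "J = integral {0..2*pi} (\<lambda>y. E y * w y * of_real (A \<eta> y)) - integral {0..2*pi} R / (\<i> * of_real \<theta>)"
      using \<theta> by (simp add: field_simps)
    then have "cmod J \<le> cmod (integral {0..2*pi} (\<lambda>y. E y * w y * of_real (A \<eta> y))) + cmod (integral {0..2*pi} R) / \<bar>\<theta>\<bar>"
      using norm_triangle_ineq4[of "integral {0..2*pi} (\<lambda>y. E y * w y * of_real (A \<eta> y))" "integral {0..2*pi} R / (\<i> * of_real \<theta>)"]
      by (simp add: norm_divide norm_mult)
    also have "cmod (integral {0..2*pi} (\<lambda>y. E y * w y * of_real (A \<eta> y))) \<le> W * (C * \<eta> powr (1 / real n\<^sub>0))"
    proof -
      have "cmod (integral {0..2*pi} (\<lambda>y. E y * w y * of_real (A \<eta> y))) \<le> integral {0..2*pi} (\<lambda>y. W * A \<eta> y)"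
        using W A_nonneg[OF \<eta>(1)] nE
        by (intro integral_norm_bound_integral int continuous_intros Ec wc Ac) (auto simp: norm_mult intro!: mult_right_mono)
      also have "\<dots> = W * integral {0..2*pi} (A \<eta>)" by simp
      also have "\<dots> \<le> W * (C * \<eta> powr (1 / real n\<^sub>0))"
        using W0 by (intro mult_left_mono order_trans[OF C0(1)[OF \<eta>] mult_right_mono[OF C(3)]]) auto
      finally show ?thesis .
    qed
    also have "cmod (integral {0..2*pi} R) \<le> C * (V + W) / \<eta>"
    proof -
      have "cmod (integral {0..2*pi} R) \<le> integral {0..2*pi} (\<lambda>y. 1 / \<eta> * cmod (w' y) + W * B \<eta> y)"
      proof (intro integral_norm_bound_integral int continuous_intros Rc w'c Bc)
        fix y assume y: "y \<in> {0..2*pi}"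
        have "cmod (R y) \<le> cmod (w' y) * \<bar>h y\<bar> + cmod (w y) * \<bar>h' y\<bar>"
          unfolding R_def by (rule order_trans[OF norm_triangle_ineq]) (simp add: norm_mult nE)
        also have "\<dots> \<le> cmod (w' y) * (1 / \<eta>) + W * B \<eta> y"
          using W[OF y] hb[of y] h'b[of y] W0 by (intro add_mono mult_mono) auto
        finally show "cmod (R y) \<le> 1 / \<eta> * cmod (w' y) + W * B \<eta> y" by simp
      qed
      also have "\<dots> = 1 / \<eta> * integral {0..2*pi} (\<lambda>y. cmod (w' y)) + W * integral {0..2*pi} (B \<eta>)"
        by (subst Henstock_Kurzweil_Integration.integral_add) (use \<eta> in \<open>auto intro!: int continuous_intros w'c Bc\<close>)
      also have "\<dots> \<le> 1 / \<eta> * V + W * (C / \<eta>)"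
        using W0 V \<eta> by (intro add_mono mult_left_mono order_trans[OF C0(2)[OF \<eta>] divide_right_mono[OF C(3)]]) auto
      also have "\<dots> \<le> C * V / \<eta> + C * W / \<eta>"
      proof -
        have "0 \<le> V" using V by (rule order_trans[rotated]) (auto intro!: Henstock_Kurzweil_Integration.integral_nonneg int continuous_intros w'c)
        then have "V \<le> C * V" using C by (simp add: mult_le_cancel_right1)
        then show ?thesis using \<eta> by (simp add: divide_right_mono mult.commute)
      qed
      finally show ?thesis by (simp add: ring_distribs add_divide_distrib)
    qed
    finally have "cmod J \<le> W * (C * \<eta> powr (1 / real n\<^sub>0)) + C * (V + W) / \<eta> / \<bar>\<theta>\<bar>"
      by (simp add: divide_right_mono)
    then show "cmod (integral {0..2*pi} (\<lambda>y. cis (\<theta> * u y) * w y))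
        \<le> C * W * \<eta> powr (1 / real n\<^sub>0) + C * (V + W) / (\<eta> * \<bar>\<theta>\<bar>)"
      by (simp add: J_def E_def mult.commute mult.left_commute)
  qed
qed

end

section \<open>Evolution at a fixed frequency in x\<close>

lemma ip_continuous:
  assumes "continuous_on UNIV f" "continuous_on UNIV g"
  shows "ip f g = integral {0..2*pi} (\<lambda>y. f y * cnj (g y)) / of_real (2*pi)"
  unfolding ip_def by (subst integral_torus1) (auto intro!: continuous_intros assms)

lemma continuous_sqint:
  assumes "continuous_on UNIV f" shows "f \<in> sqint torus1"
proof -
  obtain B where B: "\<And>y. y \<in> {0..2*pi} \<Longrightarrow> cmod (f y) \<le> B"
    using continuous_interval_bounded[OF continuous_on_subset[OF assms subset_UNIV]] by blast
  show ?thesis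
    by (rule torus1.sqint_bounded[of _ B])
       (auto intro!: borel_measurable_torus1 borel_measurable_continuous_onI assms B simp: space_torus1)
qed

lemma nsq_le_bound:
  assumes "f \<in> sqint torus1" "\<And>y. y \<in> {0..<2*pi} \<Longrightarrow> cmod (f y) \<le> B"
  shows "nsq f \<le> B\<^sup>2"
proof -
  have "(LINT y|torus1. (cmod (f y))\<^sup>2) \<le> (LINT y|torus1. B\<^sup>2)"
    using assms by (intro integral_mono_AE AE_I2) (auto simp: space_torus1 sqint_integrable intro!: power_mono)
  then show ?thesis by (simp add: nsq_def measure_torus1 field_simps)
qed

lemma nsq_mult_le:
  assumes f: "f \<in> sqint torus1" and h: "h \<in> borel_measurable torus1" "\<And>y. y \<in> {0..<2*pi} \<Longrightarrow> cmod (h y) \<le> B"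
  shows "nsq (\<lambda>y. h y * f y) \<le> B\<^sup>2 * nsq f"
proof -
  have s: "(\<lambda>y. h y * f y) \<in> sqint torus1"
    using sqint_bounded_mult[OF f h(1), of B] h(2) by (simp add: space_torus1)
  have "(LINT y|torus1. (cmod (h y * f y))\<^sup>2) \<le> (LINT y|torus1. B\<^sup>2 * (cmod (f y))\<^sup>2)"
    using h(2) sqint_integrable[OF s] sqint_integrable[OF f]
    by (intro integral_mono_AE AE_I2) (auto simp: space_torus1 norm_mult power_mult_distrib intro!: mult_right_mono power_mono)
  then show ?thesis by (simp add: nsq_def divide_simps)
qed

lemma fc_deriv:
  assumes f: "\<And>y. (f has_vector_derivative f' y) (at y)" and f': "continuous_on UNIV f'" and per: "f (2*pi) = f 0"
  shows "fc f' l = \<i> * of_int l * fc f l"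
proof -
  have fcont: "continuous_on UNIV f"
    using f by (intro continuous_at_imp_continuous_on) (auto intro: has_vector_derivative_continuous)
  define G where "G y = f y * cnj (mode l y)" for y
  have cm: "cnj (mode l y) = mode (-l) y" for y by (simp add: mode_def cis_cnj)
  have "(G has_vector_derivative f' y * cnj (mode l y) - \<i> * of_int l * (f y * cnj (mode l y))) (at y within {0..2*pi})" for y
    unfolding G_def cm
    by (rule has_vector_derivative_eq_rhs[OF has_vector_derivative_mult[OF has_vector_derivative_at_within[OF f] has_vector_derivative_mode]])
       (simp add: algebra_simps)
  then have "((\<lambda>y. f' y * cnj (mode l y) - \<i> * of_int l * (f y * cnj (mode l y))) has_integral (G (2*pi) - G 0)) {0..2*pi}"
    by (intro fundamental_theorem_of_calculus) auto
  moreover have "G (2*pi) = G 0"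
    unfolding G_def cm mode_def using per by (simp add: mult.commute[of "of_int _"] cis_multiple_2pi flip: of_int_minus)
  ultimately have 0: "integral {0..2*pi} (\<lambda>y. f' y * cnj (mode l y) - \<i> * of_int l * (f y * cnj (mode l y))) = 0"
    by (simp add: integral_unique)
  have "integral {0..2*pi} (\<lambda>y. f' y * cnj (mode l y)) - integral {0..2*pi} (\<lambda>y. \<i> * of_int l * (f y * cnj (mode l y))) = 0"
    unfolding 0[symmetric]
    by (intro Henstock_Kurzweil_Integration.integral_diff[symmetric] integrable_continuous_interval continuous_intros
        continuous_on_subset[OF f'] continuous_on_subset[OF fcont] continuous_on_subset[OF continuous_mode]) auto
  then show ?thesis by (simp add: ip_continuous f' fcont continuous_mode)
qed

lemma cmod_ip_le:
  assumes "f \<in> sqint torus1" "g \<in> sqint torus1"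
  shows "cmod (ip f g) \<le> sqrt (nsq f) * sqrt (nsq g)"
  using ip_cauchy_schwarz[OF assms] by (simp add: real_le_rsqrt flip: real_sqrt_mult)

text \<open>The bound is independent of \<open>S\<close>. This is what dominates the truncated
  transport terms uniformly in the truncation.\<close>

lemma partial_parseval_bound:
  assumes "f \<in> sqint torus1" "g \<in> sqint torus1" "finite S"
    and "nsq f \<le> X\<^sup>2" "nsq g \<le> Y\<^sup>2" "0 \<le> X" "0 \<le> Y"
  shows "cmod (\<Sum>l\<in>S. fc f l * cnj (fc g l)) \<le> X * Y"
proof -
  have "cmod (\<Sum>l\<in>S. fc f l * cnj (fc g l)) \<le> sqrt (nsq (proj S f)) * sqrt (nsq g)"
    using cmod_ip_le[OF proj_sqint[of S f] assms(2)] by (simp only: ip_proj_left[OF assms(3,2)])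
  also have "\<dots> \<le> X * Y"
    using bessel[OF assms(1,3)] assms(4-)
    by (intro mult_mono real_le_lsqrt) (auto simp: nsq_proj[OF assms(3)] nsq_nonneg)
  finally show ?thesis .
qed

text \<open>
  The transport term cancels in the balance laws below only after summation over all frequencies
  \<open>l\<close>. For the sum over \<open>\<bar>l\<bar> \<le> M\<close> it leaves the remainder \<open>R M\<close>, which vanishes boundedly as \<open>M \<rightarrow> \<infinity>\<close>.
\<close>

lemma ftc_vanishing_part:
  fixes F :: "nat \<Rightarrow> real \<Rightarrow> 'a :: euclidean_space"
  assumes s: "s1 \<le> s2"
    and F: "\<And>M s. s \<in> {s1..s2} \<Longrightarrow> (F M has_vector_derivative R M s + S M s) (at s within {s1..s2})"
    and S: "\<And>M. continuous_on {s1..s2} (S M)"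
    and R: "\<And>M s. s \<in> {s1..s2} \<Longrightarrow> norm (R M s) \<le> K" "\<And>s. s \<in> {s1..s2} \<Longrightarrow> (\<lambda>M. R M s) \<longlonglongrightarrow> 0"
  shows "(\<lambda>M. F M s2 - F M s1 - integral {s1..s2} (S M)) \<longlonglongrightarrow> 0"
proof -
  have 1: "((\<lambda>s. R M s + S M s) has_integral (F M s2 - F M s1)) {s1..s2}" for M
    using F s by (intro fundamental_theorem_of_calculus) auto
  have 2: "(S M has_integral integral {s1..s2} (S M)) {s1..s2}" for M
    by (intro integrable_integral integrable_continuous_interval S)
  have 3: "(R M has_integral (F M s2 - F M s1 - integral {s1..s2} (S M))) {s1..s2}" for M
    using has_integral_diff[OF 1 2, of M M] by simp
  have "(\<lambda>M. integral {s1..s2} (R M)) \<longlonglongrightarrow> integral {s1..s2} (\<lambda>_. 0)"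
    using 3 R by (intro dominated_convergence(2)[where h="\<lambda>_. K"]) auto
  then show ?thesis using integral_unique[OF 3] by simp
qed

section \<open>Bernstein-type inequalities and mixing for trigonometric sums\<close>

definition trig_sum :: "int set \<Rightarrow> (int \<Rightarrow> complex) \<Rightarrow> real \<Rightarrow> complex" where
  "trig_sum S c y = (\<Sum>l\<in>S. c l * mode l y)"

lemma proj_eq_trig_sum: "proj S f = trig_sum S (fc f)"
  by (simp add: proj_def trig_sum_def fun_eq_iff)

lemma trig_sum_deriv:
  "(trig_sum S c has_vector_derivative trig_sum S (\<lambda>l. \<i> * of_int l * c l) y) (at y within T)"
proof -
  have "((\<lambda>y. c l * mode l y) has_vector_derivative \<i> * of_int l * c l * mode l y) (at y within T)" for l
    using has_vector_derivative_mult_right[OF has_vector_derivative_mode[of l y T], of "c l"] by (simp add: mult_ac)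
  then show ?thesis unfolding trig_sum_def by (intro has_vector_derivative_sum)
qed

lemma trig_sum_continuous: "continuous_on T (trig_sum S c)"
  unfolding trig_sum_def by (intro continuous_intros continuous_on_subset[OF continuous_mode]) auto

lemma trig_sum_period: "trig_sum S c (2*pi) = trig_sum S c 0"
  by (simp add: trig_sum_def mode_def mult.commute[of "of_int _"] cis_multiple_2pi)

lemma nsq_trig_sum:
  assumes "finite S"
  shows "nsq (trig_sum S c) = (\<Sum>l\<in>S. (cmod (c l))\<^sup>2)"
proof -
  have fc: "fc (trig_sum S c) m = (if m \<in> S then c m else 0)" for m
    unfolding trig_sum_def using assms
    by (subst ip_sum_left) (auto simp: ip_scale_left ip_mode mode_sqint sqint_scale if_distrib cong: if_cong)
  have "proj S (trig_sum S c) = trig_sum S c"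
    unfolding proj_def by (auto simp: fc fun_eq_iff trig_sum_def)
  then have "nsq (trig_sum S c) = nsq (proj S (trig_sum S c))" by simp
  also have "\<dots> = (\<Sum>l\<in>S. (cmod (c l))\<^sup>2)" unfolding nsq_proj[OF assms] by (simp add: fc)
  finally show ?thesis .
qed

text \<open>Passing from L^2 to the sup norm costs the square root of the number of modes, by
  Cauchy-Schwarz on the coefficients.\<close>

lemma cmod_trig_sum_le:
  assumes "finite S"
  shows "cmod (trig_sum S c y) \<le> sqrt (card S) * sqrt (nsq (trig_sum S c))"
proof -
  have "cmod (trig_sum S c y) \<le> (\<Sum>l\<in>S. 1 * cmod (c l))"
    unfolding trig_sum_def by (rule sum_norm_le) (simp add: norm_mult)
  also have "\<dots> \<le> sqrt ((\<Sum>l\<in>S. 1\<^sup>2) * (\<Sum>l\<in>S. (cmod (c l))\<^sup>2))"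
    by (rule real_le_rsqrt[OF Cauchy_Schwarz_ineq_sum])
  finally show ?thesis by (simp add: nsq_trig_sum[OF assms] real_sqrt_mult)
qed

lemma nsq_trig_sum_deriv_le:
  assumes "finite S" "\<And>l. l \<in> S \<Longrightarrow> \<bar>real_of_int l\<bar> \<le> N"
  shows "sqrt (nsq (trig_sum S (\<lambda>l. \<i> * of_int l * c l))) \<le> N * sqrt (nsq (trig_sum S c))"
proof (cases "S = {}")
  case False
  then have "0 \<le> N" using assms(2) by (metis abs_ge_zero ex_in_conv order_trans)
  have "(\<Sum>l\<in>S. (cmod (\<i> * of_int l * c l))\<^sup>2) \<le> (\<Sum>l\<in>S. N\<^sup>2 * (cmod (c l))\<^sup>2)"
  proof (rule sum_mono)
    fix l assume "l \<in> S"
    then have "(\<bar>real_of_int l\<bar> * cmod (c l))\<^sup>2 \<le> (N * cmod (c l))\<^sup>2"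
      by (intro power_mono mult_right_mono assms) auto
    then show "(cmod (\<i> * of_int l * c l))\<^sup>2 \<le> N\<^sup>2 * (cmod (c l))\<^sup>2"
      by (simp add: norm_mult power_mult_distrib)
  qed
  then have "sqrt (nsq (trig_sum S (\<lambda>l. \<i> * of_int l * c l))) \<le> sqrt (N\<^sup>2 * nsq (trig_sum S c))"
    unfolding nsq_trig_sum[OF assms(1)] sum_distrib_left by (rule real_sqrt_le_mono)
  then show ?thesis using \<open>0 \<le> N\<close> by (simp add: real_sqrt_mult)
qed (simp add: nsq_trig_sum)

lemma L1_product_le:
  assumes f: "continuous_on UNIV f" and h: "continuous_on UNIV h"
  shows "integral {0..2*pi} (\<lambda>y. cmod (f y) * cmod (h y)) \<le> 2*pi * (sqrt (nsq f) * sqrt (nsq h))"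
proof -
  have "integral {0..2*pi} (\<lambda>y. cmod (f y) * cmod (h y)) = (LINT y|torus1. cmod (f y) * cmod (h y))"
    by (rule integral_torus1[symmetric]) (intro continuous_intros f h)
  moreover have "2*pi * nsq F = (LINT y|torus1. (cmod (F y))\<^sup>2)" for F
    by (simp add: nsq_def)
  ultimately have "(integral {0..2*pi} (\<lambda>y. cmod (f y) * cmod (h y)))\<^sup>2 \<le> (2*pi * nsq f) * (2*pi * nsq h)"
    using sqint_cauchy_schwarz_norm[OF continuous_sqint[OF f] continuous_sqint[OF h]] by simp
  also have "\<dots> = (2*pi * (sqrt (nsq f) * sqrt (nsq h)))\<^sup>2"
    by (simp add: power_mult_distrib nsq_nonneg) (simp add: power2_eq_square)
  finally show ?thesis by (rule power2_le_imp_le) (simp add: nsq_nonneg)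
qed

text \<open>The amplitude is w = \<open>\<alpha>\<close> cnj \<open>\<phi>\<close>. Its sup norm
  costs 2N + 1, at most 3N. The L^1 norm of w' costs 4 pi N, at most 16N; measured in the sup norm,
  w' would cost a further factor N. The 19 is 16 + 3.\<close>

lemma (in shear) mixing_trig_sum:
  fixes N :: nat and a c :: "int \<Rightarrow> complex"
  assumes C: "mixing_constant C" and N: "N \<ge> 1" and \<theta>: "\<theta> \<noteq> 0" and \<eta>: "0 < \<eta>" "\<eta> \<le> 1"
  defines "\<alpha> \<equiv> trig_sum {-int N..int N} a" and "\<phi> \<equiv> trig_sum {-int N..int N} c"
  shows "cmod (integral {0..2*pi} (\<lambda>y. cis (\<theta> * u y) * (\<alpha> y * cnj (\<phi> y))))
    \<le> (3 * C * N * \<eta> powr (1 / real n\<^sub>0) + 19 * C * N / (\<eta> * \<bar>\<theta>\<bar>)) * (sqrt (nsq \<alpha>) * sqrt (nsq \<phi>))"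
proof -
  define L where "L = {-int N..int N}"
  have L: "finite L" "real (card L) = 2 * real N + 1" "\<And>l. l \<in> L \<Longrightarrow> \<bar>real_of_int l\<bar> \<le> real N"
    by (auto simp: L_def abs_if)
  have C0: "C > 0" using C by (simp add: mixing_constant_def)
  define \<alpha>1 where "\<alpha>1 = trig_sum L (\<lambda>l. \<i> * of_int l * a l)"
  define \<phi>1 where "\<phi>1 = trig_sum L (\<lambda>l. \<i> * of_int l * c l)"
  note defs = \<alpha>_def \<phi>_def \<alpha>1_def \<phi>1_def L_def[symmetric]
  have cont: "continuous_on I \<alpha>" "continuous_on I \<phi>" "continuous_on I \<alpha>1" "continuous_on I \<phi>1" for I
    unfolding defs by (rule trig_sum_continuous)+
  define X where "X = sqrt (nsq \<alpha>) * sqrt (nsq \<phi>)"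
  have X0: "X \<ge> 0" by (simp add: X_def nsq_nonneg)
  have n1: "sqrt (nsq \<alpha>1) \<le> N * sqrt (nsq \<alpha>)" "sqrt (nsq \<phi>1) \<le> N * sqrt (nsq \<phi>)"
    unfolding defs by (rule nsq_trig_sum_deriv_le[OF L(1,3)]; assumption)+
  define w where "w y = \<alpha> y * cnj (\<phi> y)" for y
  define w' where "w' y = \<alpha> y * cnj (\<phi>1 y) + \<alpha>1 y * cnj (\<phi> y)" for y
  have dw: "(w has_vector_derivative w' y) (at y)" for y
    unfolding w_def w'_def defs
    by (rule has_vector_derivative_mult[OF trig_sum_deriv has_vector_derivative_cnj[OF trig_sum_deriv]])
  have cw': "continuous_on I w'" for I unfolding w'_def by (intro continuous_intros cont)
  have perw: "w (2*pi) = w 0" unfolding w_def defs by (simp only: trig_sum_period)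
  have Wb: "cmod (w y) \<le> (2 * real N + 1) * X" for y
  proof -
    have "cmod (w y) \<le> (sqrt (card L) * sqrt (nsq \<alpha>)) * (sqrt (card L) * sqrt (nsq \<phi>))"
      unfolding w_def norm_mult complex_mod_cnj defs
      by (intro mult_mono cmod_trig_sum_le L) (auto simp: nsq_nonneg)
    also have "\<dots> = (sqrt (card L) * sqrt (card L)) * X" by (simp only: X_def mult_ac)
    finally show ?thesis by (simp add: L(2))
  qed
  have Vb: "integral {0..2*pi} (\<lambda>y. cmod (w' y)) \<le> 4 * pi * N * X"
  proof -
    have "integral {0..2*pi} (\<lambda>y. cmod (w' y)) \<le> integral {0..2*pi} (\<lambda>y. cmod (\<alpha> y) * cmod (\<phi>1 y) + cmod (\<alpha>1 y) * cmod (\<phi> y))"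
    proof (intro integral_le integrable_continuous_interval continuous_intros cont cw')
      fix y show "cmod (w' y) \<le> cmod (\<alpha> y) * cmod (\<phi>1 y) + cmod (\<alpha>1 y) * cmod (\<phi> y)"
        unfolding w'_def by (rule order_trans[OF norm_triangle_ineq]) (simp add: norm_mult)
    qed
    also have "\<dots> = integral {0..2*pi} (\<lambda>y. cmod (\<alpha> y) * cmod (\<phi>1 y)) + integral {0..2*pi} (\<lambda>y. cmod (\<alpha>1 y) * cmod (\<phi> y))"
      by (intro Henstock_Kurzweil_Integration.integral_add integrable_continuous_interval continuous_intros cont)
    also have "\<dots> \<le> 2*pi * (sqrt (nsq \<alpha>) * (N * sqrt (nsq \<phi>))) + 2*pi * ((N * sqrt (nsq \<alpha>)) * sqrt (nsq \<phi>))"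
      using n1 by (intro add_mono order_trans[OF L1_product_le[OF cont(1,4)]] order_trans[OF L1_product_le[OF cont(3,2)]]
        mult_left_mono mult_right_mono) (auto simp: nsq_nonneg)
    also have "\<dots> = 4 * pi * N * X" by (simp add: X_def)
    finally show ?thesis .
  qed
  have "cmod (integral {0..2*pi} (\<lambda>y. cis (\<theta> * u y) * w y))
      \<le> C * ((2 * real N + 1) * X) * \<eta> powr (1 / real n\<^sub>0) + C * (4 * pi * N * X + (2 * real N + 1) * X) / (\<eta> * \<bar>\<theta>\<bar>)"
    using C dw cw' perw Wb Vb \<theta> \<eta> unfolding mixing_constant_def by blast
  also have "\<dots> \<le> C * (3 * N * X) * \<eta> powr (1 / real n\<^sub>0) + C * (19 * N * X) / (\<eta> * \<bar>\<theta>\<bar>)"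
  proof -
    have W: "(2 * real N + 1) * X \<le> 3 * N * X" using N X0 by (intro mult_right_mono) auto
    moreover have "4 * pi * N * X \<le> 16 * N * X"
      using X0 mult_right_mono[OF less_imp_le[OF pi_less_4], of "real N"] by (intro mult_right_mono) auto
    ultimately have VW: "4 * pi * N * X + (2 * real N + 1) * X \<le> 19 * N * X" by linarith
    show ?thesis using C0 \<eta>
      by (intro add_mono[OF mult_right_mono[OF mult_left_mono[OF W]] divide_right_mono[OF mult_left_mono[OF VW]]]) auto
  qed
  also have "\<dots> = (3 * C * N * \<eta> powr (1 / real n\<^sub>0) + 19 * C * N / (\<eta> * \<bar>\<theta>\<bar>)) * X"
    by (simp add: algebra_simps)
  finally show ?thesis by (simp add: w_def X_def)
qed

text \<open>What is kept of one x-frequency of the solution: square integrability in y, a bound on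
  compact time intervals, and the equation tested against each mode. The multiplication by u couples
  the modes, so the system of ordinary differential equations is infinite.\<close>

locale flow = shear u n\<^sub>0 for u :: "real \<Rightarrow> real" and n\<^sub>0 :: nat +
  fixes \<gamma> \<nu> :: real and k :: int and g :: "real \<Rightarrow> real \<Rightarrow> complex"
  assumes \<gamma>: "0 < \<gamma>" "\<gamma> < 2" and \<nu>: "0 < \<nu>"
    and g_sqint: "\<And>t. t \<ge> 0 \<Longrightarrow> g t \<in> sqint torus1"
    and g_bounded: "\<And>T. \<exists>K. \<forall>t\<in>{0..T}. nsq (g t) \<le> K"
    and g_ode: "\<And>t l. t \<ge> 0 \<Longrightarrow> ((\<lambda>s. fc (g s) l) has_vector_derivative
        (- \<i> * of_int k * fc (\<lambda>y. of_real (u y) * g t y) l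
         - of_real (\<nu> * (of_int k ^ 2 + of_int l ^ 2) powr (\<gamma> / 2)) * fc (g t) l)) (at t within {0..})"
begin

section \<open>Energy balance and dissipation\<close>

definition lam :: "int \<Rightarrow> real" where "lam l = (of_int k ^ 2 + of_int l ^ 2) powr (\<gamma> / 2)"
definition a :: "int \<Rightarrow> real \<Rightarrow> complex" where "a l t = fc (g t) l"
definition b :: "int \<Rightarrow> real \<Rightarrow> complex" where "b l t = fc (\<lambda>y. of_real (u y) * g t y) l"
definition E :: "real \<Rightarrow> real" where "E t = nsq (g t)"

lemma lam_nonneg: "0 \<le> lam l" by (simp add: lam_def)

lemma a_deriv:
  assumes "0 \<le> t" "S \<subseteq> {0..}"
  shows "(a l has_vector_derivative (- \<i> * of_int k * b l t - of_real (\<nu> * lam l) * a l t)) (at t within S)"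
  using has_vector_derivative_within_subset[OF g_ode[OF assms(1), of l] assms(2)]
  unfolding a_def b_def lam_def by simp

lemma a_continuous: "S \<subseteq> {0..} \<Longrightarrow> continuous_on S (a l)"
  unfolding continuous_on_eq_continuous_within
  using a_deriv has_vector_derivative_continuous by blast

lemma u_continuous: "continuous_on S u"
  using continuous_D[of 0 S] by (simp add: D_0)

lemma u_bounded: "\<exists>B. \<forall>y\<in>{0..2*pi}. \<bar>u y\<bar> \<le> B"
  using D_bounded[of 0] by (metis D_0 le0)

lemma u_mult_sqint:
  assumes "f \<in> sqint torus1" shows "(\<lambda>y. of_real (u y) * f y) \<in> sqint torus1"
proof -
  obtain B where B: "\<forall>y\<in>{0..2*pi}. \<bar>u y\<bar> \<le> B" using u_bounded by blast
  show ?thesis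
    by (rule sqint_bounded_mult[OF assms, of _ B])
       (use B in \<open>auto intro!: borel_measurable_torus1 borel_measurable_continuous_onI continuous_intros u_continuous simp: space_torus1\<close>)
qed

lemma u_mult_nsq: "\<exists>B\<ge>0. \<forall>f\<in>sqint torus1. nsq (\<lambda>y. of_real (u y) * f y) \<le> B\<^sup>2 * nsq f"
proof -
  obtain B where B: "\<forall>y\<in>{0..2*pi}. \<bar>u y\<bar> \<le> B" using u_bounded by blast
  have "B \<ge> 0" using B by (smt (verit) atLeastAtMost_iff pi_ge_zero)
  moreover have "nsq (\<lambda>y. of_real (u y) * f y) \<le> B\<^sup>2 * nsq f" if "f \<in> sqint torus1" for f
    by (rule nsq_mult_le[OF that])
       (use B in \<open>auto intro!: borel_measurable_torus1 borel_measurable_continuous_onI continuous_intros u_continuous\<close>)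
  ultimately show ?thesis by blast
qed

lemma u_symmetric: "ip (\<lambda>y. of_real (u y) * f y) h = ip f (\<lambda>y. of_real (u y) * h y)"
  by (simp add: ip_def mult_ac)

text \<open>An a priori bound, needed to dominate the transport remainder before the energy is known
  to decrease.\<close>

lemma E_bounded: "\<exists>K\<ge>0. \<forall>t\<in>{s1..s2}. 0 \<le> t \<longrightarrow> E t \<le> K"
proof -
  obtain K where "\<forall>t\<in>{0..s2}. nsq (g t) \<le> K" using g_bounded by blast
  then show ?thesis by (intro exI[of _ "max K 0"]) (auto simp: E_def le_max_iff_disj)
qed

text \<open>In the derivative of the truncated energy the transport part tends to 2k times the
  imaginary part of the inner product of u g with g. This is 0, as multiplication by a real function
  is symmetric. All dissipation terms are nonnegative, so keeping those in a fixed finite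
  \<open>Q\<close> gives an inequality that survives the limit.\<close>

lemma energy:
  assumes s: "0 \<le> s1" "s1 \<le> s2" and Q: "finite Q"
  shows "E s2 + 2 * \<nu> * integral {s1..s2} (\<lambda>s. \<Sum>l\<in>Q. lam l * (cmod (a l s))\<^sup>2) \<le> E s1"
proof -
  obtain B where B: "B \<ge> 0" "\<And>f. f \<in> sqint torus1 \<Longrightarrow> nsq (\<lambda>y. of_real (u y) * f y) \<le> B\<^sup>2 * nsq f"
    using u_mult_nsq by blast
  obtain K where K: "K \<ge> 0" "\<And>t. t \<in> {s1..s2} \<Longrightarrow> E t \<le> K"
    using E_bounded[of s1 s2] s by force
  define P where "P M = {-int M..int M}" for M
  define F where "F M s = (\<Sum>l\<in>P M. (cmod (a l s))\<^sup>2)" for M s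
  define R where "R M s = 2 * Re (- \<i> * of_int k * (\<Sum>l\<in>P M. b l s * cnj (a l s)))" for M s
  define S where "S M s = - 2 * \<nu> * (\<Sum>l\<in>P M. lam l * (cmod (a l s))\<^sup>2)" for M s
  have sub: "{s1..s2} \<subseteq> {0..}" using s by auto
  have gs: "g t \<in> sqint torus1" if "t \<in> {s1..s2}" for t using g_sqint that s by auto
  have "(\<lambda>M. F M s2 - F M s1 - integral {s1..s2} (S M)) \<longlonglongrightarrow> 0"
  proof (rule ftc_vanishing_part[where R=R and K="2 * \<bar>of_int k\<bar> * (B * K)"])
    show "s1 \<le> s2" by (rule s(2))
    fix M t assume t: "t \<in> {s1..s2}"
    have "((\<lambda>s. (cmod (a l s))\<^sup>2) has_vector_derivative
        2 * Re (- \<i> * of_int k * (b l t * cnj (a l t))) - 2 * \<nu> * lam l * (cmod (a l t))\<^sup>2) (at t within {s1..s2})" for l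
    proof -
      have "(a l has_vector_derivative (- \<i> * of_int k * b l t - of_real (\<nu> * lam l) * a l t)) (at t within {s1..s2})"
        using t s sub by (intro a_deriv) auto
      from bounded_bilinear.has_vector_derivative[OF bounded_bilinear_inner this this]
      show ?thesis unfolding power2_norm_eq_inner
        by (rule has_vector_derivative_eq_rhs) (simp add: inner_complex_def algebra_simps)
    qed
    then have "(F M has_vector_derivative (\<Sum>l\<in>P M. 2 * Re (- \<i> * of_int k * (b l t * cnj (a l t))) - 2 * \<nu> * lam l * (cmod (a l t))\<^sup>2)) (at t within {s1..s2})"
      unfolding F_def by (intro has_vector_derivative_sum)
    moreover have "(\<Sum>l\<in>P M. 2 * Re (- \<i> * of_int k * (b l t * cnj (a l t))) - 2 * \<nu> * lam l * (cmod (a l t))\<^sup>2) = R M t + S M t"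
    proof -
      have "R M t = (\<Sum>l\<in>P M. 2 * Re (- \<i> * of_int k * (b l t * cnj (a l t))))"
        unfolding R_def sum_distrib_left Re_sum ..
      moreover have "S M t = (\<Sum>l\<in>P M. - 2 * \<nu> * (lam l * (cmod (a l t))\<^sup>2))"
        unfolding S_def sum_distrib_left ..
      ultimately show ?thesis unfolding sum.distrib[symmetric] by (simp only: sum.distrib) (simp add: sum_subtractf sum_negf mult.assoc)
    qed
    ultimately show "(F M has_vector_derivative R M t + S M t) (at t within {s1..s2})" by simp
    have "\<bar>R M t\<bar> \<le> 2 * (\<bar>of_int k\<bar> * cmod (\<Sum>l\<in>P M. b l t * cnj (a l t)))"
      unfolding R_def using abs_Re_le_cmod[of "- \<i> * of_int k * (\<Sum>l\<in>P M. b l t * cnj (a l t))"]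
      by (simp add: norm_mult abs_mult)
    also have "cmod (\<Sum>l\<in>P M. b l t * cnj (a l t)) \<le> (B * sqrt K) * sqrt K"
      unfolding a_def b_def P_def using K t B
      by (intro partial_parseval_bound u_mult_sqint gs order_trans[OF B(2)])
         (auto simp: E_def[symmetric] power_mult_distrib intro: mult_left_mono)
    also have "\<dots> = B * K" using K by simp
    finally show "norm (R M t) \<le> 2 * \<bar>of_int k\<bar> * (B * K)" by (simp add: mult_left_mono mult.assoc)
  next
    fix M show "continuous_on {s1..s2} (S M)"
      unfolding S_def using sub by (intro continuous_intros a_continuous)
  next
    fix t assume t: "t \<in> {s1..s2}"
    have "(\<lambda>M. \<Sum>l\<in>P M. b l t * cnj (a l t)) \<longlonglongrightarrow> ip (\<lambda>y. of_real (u y) * g t y) (g t)"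
      unfolding a_def b_def P_def by (intro parseval u_mult_sqint gs t)
    then have "(\<lambda>M. R M t) \<longlonglongrightarrow> 2 * Re (- \<i> * of_int k * ip (\<lambda>y. of_real (u y) * g t y) (g t))"
      unfolding R_def by (intro tendsto_intros)
    moreover have "ip (\<lambda>y. of_real (u y) * g t y) (g t) = cnj (ip (\<lambda>y. of_real (u y) * g t y) (g t))"
      by (metis ip_commute u_symmetric)
    then have "Im (ip (\<lambda>y. of_real (u y) * g t y) (g t)) = 0" by (simp add: complex_eq_iff)
    ultimately show "(\<lambda>M. R M t) \<longlonglongrightarrow> 0" by simp
  qed
  moreover have "(\<lambda>M. F M t) \<longlonglongrightarrow> E t" if "t \<in> {s1..s2}" for t
    unfolding F_def P_def a_def E_def by (rule parseval_nsq[OF gs[OF that]])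
  ultimately have "(\<lambda>M. (F M s2 - F M s1) - (F M s2 - F M s1 - integral {s1..s2} (S M))) \<longlonglongrightarrow> (E s2 - E s1) - 0"
    using s by (intro tendsto_diff) auto
  then have lim: "(\<lambda>M. integral {s1..s2} (S M)) \<longlonglongrightarrow> E s2 - E s1" by simp
  obtain M0 where M0: "Q \<subseteq> P M0"
  proof -
    obtain M0 where M0: "\<And>l. l \<in> Q \<Longrightarrow> nat \<bar>l\<bar> \<le> M0"
      using finite_nat_set_iff_bounded_le[of "(\<lambda>l. nat \<bar>l\<bar>) ` Q"] Q by auto
    have "l \<in> P M0" if "l \<in> Q" for l using M0[OF that] by (auto simp: P_def)
    then show ?thesis using that by blast
  qed
  have "integral {s1..s2} (S M) \<le> integral {s1..s2} (\<lambda>s. - 2 * \<nu> * (\<Sum>l\<in>Q. lam l * (cmod (a l s))\<^sup>2))" if "M \<ge> M0" for M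
  proof (rule integral_le)
    show "S M integrable_on {s1..s2}"
      unfolding S_def using sub by (intro integrable_continuous_interval continuous_intros a_continuous)
    show "(\<lambda>s. - 2 * \<nu> * (\<Sum>l\<in>Q. lam l * (cmod (a l s))\<^sup>2)) integrable_on {s1..s2}"
      using sub by (intro integrable_continuous_interval continuous_intros a_continuous)
    fix s assume "s \<in> {s1..s2}"
    have "(\<Sum>l\<in>Q. lam l * (cmod (a l s))\<^sup>2) \<le> (\<Sum>l\<in>P M. lam l * (cmod (a l s))\<^sup>2)"
    proof (rule sum_mono2)
      show "Q \<subseteq> P M" using M0 that by (force simp: P_def)
    qed (auto simp: P_def lam_nonneg)
    then show "S M s \<le> - 2 * \<nu> * (\<Sum>l\<in>Q. lam l * (cmod (a l s))\<^sup>2)"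
      unfolding S_def using \<nu> by (intro mult_left_mono_neg) auto
  qed
  then have "E s2 - E s1 \<le> integral {s1..s2} (\<lambda>s. - 2 * \<nu> * (\<Sum>l\<in>Q. lam l * (cmod (a l s))\<^sup>2))"
    by (intro LIMSEQ_le_const2[OF lim]) blast
  then show ?thesis by simp
qed

lemma E_antimono: "0 \<le> s1 \<Longrightarrow> s1 \<le> s2 \<Longrightarrow> E s2 \<le> E s1"
  using energy[of s1 s2 "{}"] by simp

lemma E_nonneg: "0 \<le> E s" by (simp add: E_def nsq_nonneg)

text \<open>By Parseval \<open>x\<close> is the energy outside \<open>L\<close>, where the symbol is
  at least \<open>\<Lambda>\<close>. It is a pointwise limit of continuous partial sums bounded by
  \<open>E s1\<close>, which gives both integrability and the convergence of the integrals.\<close>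

lemma dissipation:
  assumes s: "0 \<le> s1" "s1 \<le> s2" and L: "finite L" "\<And>l. l \<notin> L \<Longrightarrow> \<Lambda> \<le> lam l"
  defines "x \<equiv> \<lambda>s. E s - (\<Sum>l\<in>L. (cmod (a l s))\<^sup>2)"
  shows "x integrable_on {s1..s2}" "E s2 + 2 * \<nu> * \<Lambda> * integral {s1..s2} x \<le> E s1"
proof -
  define Q where "Q M = {-int M..int M} - L" for M
  define f where "f M s = (\<Sum>l\<in>Q M. (cmod (a l s))\<^sup>2)" for M s
  have sub: "{s1..s2} \<subseteq> {0..}" using s by auto
  have gs: "g t \<in> sqint torus1" if "t \<in> {s1..s2}" for t using g_sqint that s by auto
  have fint: "f M integrable_on {s1..s2}" for M
    unfolding f_def using sub by (intro integrable_continuous_interval continuous_intros a_continuous)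
  have fb: "norm (f M t) \<le> E s1" if "t \<in> {s1..s2}" for M t
  proof -
    have "f M t \<le> E t" unfolding f_def a_def E_def Q_def by (intro bessel gs that) auto
    also have "\<dots> \<le> E s1" using E_antimono[of s1 t] s that by auto
    finally show ?thesis by (simp add: f_def sum_nonneg)
  qed
  have flim: "(\<lambda>M. f M t) \<longlonglongrightarrow> x t" if "t \<in> {s1..s2}" for t
  proof -
    obtain M0 where M0: "\<And>l. l \<in> L \<Longrightarrow> nat \<bar>l\<bar> \<le> M0"
      using finite_nat_set_iff_bounded_le[of "(\<lambda>l. nat \<bar>l\<bar>) ` L"] L by auto
    have "(\<lambda>M. (\<Sum>l\<in>{-int M..int M}. (cmod (a l t))\<^sup>2) - (\<Sum>l\<in>L. (cmod (a l t))\<^sup>2)) \<longlonglongrightarrow> x t"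
      unfolding x_def E_def a_def by (intro tendsto_intros parseval_nsq gs that)
    moreover have "\<forall>\<^sub>F M in sequentially. (\<Sum>l\<in>{-int M..int M}. (cmod (a l t))\<^sup>2) - (\<Sum>l\<in>L. (cmod (a l t))\<^sup>2) = f M t"
      using eventually_ge_at_top[of M0]
    proof eventually_elim
      case (elim M)
      have "L \<subseteq> {-int M..int M}" using M0 elim by force
      then show ?case unfolding f_def Q_def by (subst sum_diff) auto
    qed
    ultimately show ?thesis by (rule Lim_transform_eventually)
  qed
  have conv: "x integrable_on {s1..s2}" "(\<lambda>M. integral {s1..s2} (f M)) \<longlonglongrightarrow> integral {s1..s2} x"
    by (rule dominated_convergence[where f=f and g=x and h="\<lambda>_. E s1" and S="{s1..s2}", OF fint integrable_const_ivl fb flim]; assumption)+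
  show "x integrable_on {s1..s2}" by (rule conv)
  have "E s2 + 2 * \<nu> * \<Lambda> * integral {s1..s2} (f M) \<le> E s1" for M
  proof -
    have "\<Lambda> * integral {s1..s2} (f M) = integral {s1..s2} (\<lambda>s. \<Lambda> * f M s)" by simp
    also have "\<dots> \<le> integral {s1..s2} (\<lambda>s. \<Sum>l\<in>Q M. lam l * (cmod (a l s))\<^sup>2)"
    proof (rule integral_le)
      show "(\<lambda>s. \<Lambda> * f M s) integrable_on {s1..s2}" using fint[of M] by (rule integrable_on_mult_right)
      show "(\<lambda>s. \<Sum>l\<in>Q M. lam l * (cmod (a l s))\<^sup>2) integrable_on {s1..s2}"
        using sub by (intro integrable_continuous_interval continuous_intros a_continuous)
    qed (auto simp: f_def sum_distrib_left Q_def intro!: sum_mono mult_right_mono L)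
    finally have "2 * \<nu> * (\<Lambda> * integral {s1..s2} (f M)) \<le> 2 * \<nu> * integral {s1..s2} (\<lambda>s. \<Sum>l\<in>Q M. lam l * (cmod (a l s))\<^sup>2)"
      using \<nu> by (intro mult_left_mono) auto
    then show ?thesis using energy[OF s, of "Q M"] by (simp add: Q_def mult.assoc)
  qed
  then show "E s2 + 2 * \<nu> * \<Lambda> * integral {s1..s2} x \<le> E s1"
    by (intro LIMSEQ_le_const2[of "\<lambda>M. E s2 + 2 * \<nu> * \<Lambda> * integral {s1..s2} (f M)"]) (auto intro!: tendsto_intros conv(2))
qed

text \<open>Let X be the integral of the high-frequency energy \<open>x\<close> and
  \<open>\<tau>\<close> the length of the window. Integrating the transfer inequality in time gives
  \<open>\<tau>\<close>/2 (E s2 - 0.08 E s1) at most 3 X, while dissipation gives X at most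
  \<open>\<tau>\<close>/2 (E s1 - E s2). Together E s2 is at most 3.08/4 = 0.77 times E s1.\<close>

lemma contraction_from_transfer:
  assumes s: "0 \<le> s1" "s1 \<le> s2" and L: "finite L" "\<And>l. l \<notin> L \<Longrightarrow> \<Lambda> \<le> lam l"
    and \<Lambda>: "1 \<le> \<nu> * \<Lambda> * (s2 - s1)" and T: "0 < T" "2 * T \<le> s2 - s1"
  defines "p \<equiv> \<lambda>s. \<Sum>l\<in>L. (cmod (a l s))\<^sup>2"
  assumes transfer: "\<And>s. s \<in> {s1+T..s2} \<Longrightarrow> sqrt (p s) \<le> sqrt (E (s - T) - p (s - T)) + 0.2 * sqrt (E s1)"
  shows "E s2 \<le> 0.8 * E s1"
proof -
  define x where "x s = E s - p s" for s
  have x: "x integrable_on {s1..s2}" "E s2 + 2 * \<nu> * \<Lambda> * integral {s1..s2} x \<le> E s1"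
    using dissipation[OF s L] unfolding x_def[abs_def] p_def by auto
  define X where "X = integral {s1..s2} x"
  define \<tau> where "\<tau> = s2 - s1"
  have \<tau>: "\<tau> > 0" "2 * T \<le> \<tau>" using T by (auto simp: \<tau>_def)
  have x0: "0 \<le> x t" if "0 \<le> t" for t
    unfolding x_def p_def E_def a_def using bessel[OF g_sqint[OF that] L(1)] by simp
  have X0: "0 \<le> X" unfolding X_def using x0 s by (intro Henstock_Kurzweil_Integration.integral_nonneg x) auto
  have p0: "0 \<le> p t" for t unfolding p_def by (simp add: sum_nonneg)
  \<comment> \<open>Here 0.08 = 2 * 0.2^2, from squaring the transfer inequality, and E = p +
    x.\<close>
  have pt: "E s2 - 0.08 * E s1 \<le> 2 * x (t - T) + x t" if t: "t \<in> {s1+T..s2}" for t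
  proof -
    have xt: "0 \<le> x (t - T)" using t s by (intro x0) auto
    have "p t = (sqrt (p t))\<^sup>2" using p0 by simp
    also have "\<dots> \<le> (sqrt (x (t - T)) + 0.2 * sqrt (E s1))\<^sup>2"
      using transfer[OF t] p0 by (intro power_mono) (auto simp: x_def)
    also have "\<dots> \<le> 2 * (sqrt (x (t - T)))\<^sup>2 + 2 * (0.2 * sqrt (E s1))\<^sup>2"
      using sum_squares_bound[of "sqrt (x (t - T))" "0.2 * sqrt (E s1)"] by (simp add: power2_sum)
    also have "\<dots> = 2 * x (t - T) + 0.08 * E s1" using xt E_nonneg[of s1] by (simp add: power_mult_distrib power2_eq_square)
    finally have "p t \<le> 2 * x (t - T) + 0.08 * E s1" .
    moreover have "E s2 \<le> E t" using t s T by (intro E_antimono) auto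
    ultimately show ?thesis by (simp add: x_def)
  qed
  have i1: "x integrable_on {s1+T..s2}" "x integrable_on {s1..s2-T}"
    using T by (auto intro!: integrable_on_subinterval[OF x(1)])
  \<comment> \<open>Translation in time: the earlier high-frequency energy is integrated over a
    subinterval of the same window.\<close>
  have sh: "((\<lambda>t. x (t - T)) has_integral integral {s1..s2-T} x) {s1+T..s2}"
    using has_integral_affinity[OF integrable_integral[OF i1(2)[folded cbox_interval]], of 1 "-T"]
    by (simp add: image_affinity_cbox add.commute)
  have "(\<tau> - T) * (E s2 - 0.08 * E s1) = integral {s1+T..s2} (\<lambda>_. E s2 - 0.08 * E s1)"
    using \<tau> T by (simp add: \<tau>_def)
  also have "\<dots> \<le> integral {s1+T..s2} (\<lambda>t. 2 * x (t - T) + x t)"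
    using sh i1 pt by (intro integral_le integrable_add integrable_on_mult_right) auto
  also have "\<dots> = 2 * integral {s1..s2-T} x + integral {s1+T..s2} x"
    using has_integral_add[OF has_integral_mult_right[OF sh, of 2] integrable_integral[OF i1(1)]] by (simp add: integral_unique)
  also have "\<dots> \<le> 2 * X + X"
    unfolding X_def using T x0 s x i1 by (intro add_mono mult_left_mono integral_subset_le) auto
  finally have main: "(\<tau> - T) * (E s2 - 0.08 * E s1) \<le> 3 * X" by simp
  have "X \<le> (\<nu> * \<Lambda> * \<tau>) * X" using \<Lambda> X0 by (simp add: \<tau>_def mult_le_cancel_right1)
  also have "\<dots> = \<tau> / 2 * (2 * \<nu> * \<Lambda> * X)" by simp
  also have "\<dots> \<le> \<tau> / 2 * (E s1 - E s2)" using x(2) \<tau> by (intro mult_left_mono) (auto simp: X_def)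
  finally have X: "X \<le> \<tau> / 2 * (E s1 - E s2)" .
  show ?thesis
  proof (cases "E s2 \<le> 0.08 * E s1")
    case True
    then show ?thesis using E_nonneg[of s1] by simp
  next
    case False
    \<comment> \<open>Only for a positive second factor may \<open>\<tau> - T\<close> be replaced by
      the smaller \<open>\<tau> / 2\<close>.\<close>
    then have "\<tau> / 2 * (E s2 - 0.08 * E s1) \<le> (\<tau> - T) * (E s2 - 0.08 * E s1)"
      using \<tau> by (intro mult_right_mono) auto
    also have "\<dots> \<le> 3 * X" by (rule main)
    also have "\<dots> \<le> 3 * (\<tau> / 2 * (E s1 - E s2))" using X by simp
    also have "\<dots> = \<tau> / 2 * (3 * (E s1 - E s2))" by simp
    finally have "E s2 - 0.08 * E s1 \<le> 3 * (E s1 - E s2)" using \<tau> by (simp add: mult_le_cancel_left)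
    then show ?thesis using E_nonneg[of s1] by simp
  qed
qed

section \<open>Comparison with the inviscid flow\<close>

text \<open>The integer k^2 + l^2 is 0 or at least 1, so its power with exponent
  \<open>\<gamma> / 2\<close> below 1 does not exceed it. This trades the fractional Laplacian for
  the classical one.\<close>

lemma lam_le: "lam l \<le> of_int k ^ 2 + of_int l ^ 2"
proof (cases "k = 0 \<and> l = 0")
  case True
  then show ?thesis unfolding lam_def by simp
next
  case False
  then have "k\<^sup>2 + l\<^sup>2 > 0" by (auto simp: sum_power2_gt_zero_iff)
  then have "k\<^sup>2 + l\<^sup>2 \<ge> 1" by simp
  then have 1: "real_of_int k ^ 2 + real_of_int l ^ 2 \<ge> 1"
    by (metis of_int_1_le_iff of_int_add of_int_power)
  then show ?thesis unfolding lam_def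
    using powr_mono[of "\<gamma>/2" 1 "real_of_int k ^ 2 + real_of_int l ^ 2"] \<gamma> by simp
qed

text \<open>Since \<open>\<psi>\<close> solves the inviscid equation, the transport terms cancel in
  the time derivative of the pairing, by symmetry of the multiplication by u. What remains is the
  viscous pairing, whose symbol is moved onto \<open>\<psi>\<close> and bounded by that of k^2 minus
  the second y-derivative; \<open>P\<close> is a sup bound for this function.\<close>

lemma duality:
  assumes s: "0 \<le> s1" "s1 \<le> s2"
    and transport: "\<And>r y. ((\<lambda>r. \<psi> r y) has_vector_derivative - \<i> * of_int k * of_real (u y) * \<psi> r y) (at r)"
    and joint: "continuous_on UNIV (\<lambda>(r, y). \<psi> r y)"
    and \<psi>1: "\<And>r y. (\<psi> r has_vector_derivative \<psi>1 r y) (at y)"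
    and \<psi>2: "\<And>r y. (\<psi>1 r has_vector_derivative \<psi>2 r y) (at y)" "\<And>r. continuous_on UNIV (\<psi>2 r)"
    and per: "\<And>r. \<psi> r (2*pi) = \<psi> r 0" "\<And>r. \<psi>1 r (2*pi) = \<psi>1 r 0"
    and P: "\<And>r y. r \<in> {s1..s2} \<Longrightarrow> y \<in> {0..<2*pi} \<Longrightarrow> cmod (of_int k ^ 2 * \<psi> r y - \<psi>2 r y) \<le> P"
  shows "cmod (ip (g s2) (\<psi> s2) - ip (g s1) (\<psi> s1)) \<le> \<nu> * (s2 - s1) * sqrt (E s1) * P"
proof -
  obtain B where B: "B \<ge> 0" "\<And>f. f \<in> sqint torus1 \<Longrightarrow> nsq (\<lambda>y. of_real (u y) * f y) \<le> B\<^sup>2 * nsq f"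
    using u_mult_nsq by blast
  have sub: "{s1..s2} \<subseteq> {0..}" using s by auto
  have gs: "g t \<in> sqint torus1" if "t \<in> {s1..s2}" for t using g_sqint that s by auto
  have Et: "E t \<le> E s1" if "t \<in> {s1..s2}" for t using E_antimono[of s1 t] s that by auto
  have P0: "P \<ge> 0" using P[of s1 0] s by (intro order_trans[OF norm_ge_zero P[of s1 0]]) auto
  have \<psi>c: "continuous_on UNIV (\<psi> r)" for r
    using \<psi>1 by (intro continuous_at_imp_continuous_on) (auto intro: has_vector_derivative_continuous)
  have \<psi>1c: "continuous_on UNIV (\<psi>1 r)" for r
    using \<psi>2 by (intro continuous_at_imp_continuous_on) (auto intro: has_vector_derivative_continuous)
  have u\<psi>c: "continuous_on UNIV (\<lambda>y. of_real (u y) * \<psi> r y)" for r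
    by (intro continuous_intros u_continuous \<psi>c)
  note \<psi>s = continuous_sqint[OF \<psi>c] and u\<psi>s = continuous_sqint[OF u\<psi>c]
  define c where "c l r = fc (\<psi> r) l" for l r
  define d where "d l r = fc (\<lambda>y. of_real (u y) * \<psi> r y) l" for l r
  \<comment> \<open>Differentiation under the integral sign, for which joint continuity of
    \<open>\<psi>\<close> is assumed.\<close>
  have c_deriv: "(c l has_vector_derivative - \<i> * of_int k * d l r) (at r within {s1..s2})" if r: "r \<in> {s1..s2}" for l r
  proof -
    have jc: "continuous_on ({s1..s2} \<times> cbox 0 (2*pi)) (\<lambda>(r, y). - \<i> * of_int k * of_real (u y) * \<psi> r y * cnj (mode l y))"
    proof -
      have "continuous_on ({s1..s2} \<times> cbox 0 (2*pi)) (\<lambda>z. \<psi> (fst z) (snd z))"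
        by (rule continuous_on_subset[OF joint[unfolded case_prod_unfold]]) simp
      then show ?thesis unfolding case_prod_unfold
        by (intro continuous_intros continuous_on_compose2[OF u_continuous[of UNIV]] continuous_on_compose2[OF continuous_mode]) auto
    qed
    have "((\<lambda>r. integral (cbox 0 (2*pi)) (\<lambda>y. \<psi> r y * cnj (mode l y))) has_vector_derivative
        integral (cbox 0 (2*pi)) (\<lambda>y. - \<i> * of_int k * of_real (u y) * \<psi> r y * cnj (mode l y))) (at r within {s1..s2})"
    proof (rule leibniz_rule_vector_derivative[OF _ _ jc r])
      fix r t assume "r \<in> {s1..s2}" "t \<in> cbox 0 (2*pi)"
      show "((\<lambda>r. \<psi> r t * cnj (mode l t)) has_vector_derivative - \<i> * of_int k * of_real (u t) * \<psi> r t * cnj (mode l t)) (at r within {s1..s2})"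
        by (rule has_vector_derivative_mult_left[OF has_vector_derivative_at_within[OF transport]])
    next
      show "(\<lambda>y. \<psi> r y * cnj (mode l y)) integrable_on cbox 0 (2*pi)" for r
        by (intro integrable_continuous continuous_intros continuous_on_subset[OF \<psi>c] continuous_on_subset[OF continuous_mode]) auto
    qed auto
    from has_vector_derivative_divide[OF this, of "of_real (2*pi)"]
    have "((\<lambda>r. integral {0..2*pi} (\<lambda>y. \<psi> r y * cnj (mode l y)) / of_real (2*pi)) has_vector_derivative
        integral {0..2*pi} (\<lambda>y. - \<i> * of_int k * of_real (u y) * \<psi> r y * cnj (mode l y)) / of_real (2*pi)) (at r within {s1..s2})"
      by simp
    moreover have "(\<lambda>r. integral {0..2*pi} (\<lambda>y. \<psi> r y * cnj (mode l y)) / of_real (2*pi)) = c l"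
      unfolding c_def by (simp add: fun_eq_iff ip_continuous[OF \<psi>c continuous_mode])
    moreover have "integral {0..2*pi} (\<lambda>y. - \<i> * of_int k * of_real (u y) * \<psi> r y * cnj (mode l y)) = - \<i> * of_int k * integral {0..2*pi} (\<lambda>y. of_real (u y) * \<psi> r y * cnj (mode l y))"
      unfolding Henstock_Kurzweil_Integration.integral_mult_right[symmetric] by (simp add: mult.assoc)
    ultimately show ?thesis unfolding d_def ip_continuous[OF u\<psi>c continuous_mode] by simp
  qed
  have c_cont: "continuous_on {s1..s2} (c l)" for l
    unfolding continuous_on_eq_continuous_within using c_deriv has_vector_derivative_continuous by blast
  \<comment> \<open>Two periodic integrations by parts turn the factor l^2 into the second
    derivative of \<open>\<psi>\<close>.\<close>
  have csq: "lam l * cmod (c l r) \<le> cmod (fc (\<lambda>y. of_int k ^ 2 * \<psi> r y - \<psi>2 r y) l)" for l r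
  proof -
    have "fc (\<psi>2 r) l = \<i> * of_int l * (\<i> * of_int l * fc (\<psi> r) l)"
      using fc_deriv[OF \<psi>2(1) \<psi>2(2) per(2)] fc_deriv[OF \<psi>1 \<psi>1c per(1)] by simp
    then have "fc (\<lambda>y. of_int k ^ 2 * \<psi> r y - \<psi>2 r y) l = of_real (of_int k ^ 2 + of_int l ^ 2) * c l r"
      unfolding ip_diff_left[OF sqint_scale[OF \<psi>s] continuous_sqint[OF \<psi>2(2)] mode_sqint] ip_scale_left
      by (simp add: c_def power2_eq_square algebra_simps)
    then show ?thesis using lam_le[of l] by (simp add: norm_mult mult_right_mono del: of_real_add of_real_power)
  qed
  define PM where "PM M = {-int M..int M}" for M
  define F where "F M r = (\<Sum>l\<in>PM M. a l r * cnj (c l r))" for M r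
  define R where "R M r = - \<i> * of_int k * (\<Sum>l\<in>PM M. b l r * cnj (c l r)) + \<i> * of_int k * (\<Sum>l\<in>PM M. a l r * cnj (d l r))" for M r
  define S where "S M r = - of_real \<nu> * (\<Sum>l\<in>PM M. of_real (lam l) * (a l r * cnj (c l r)))" for M r
  obtain K1 where K1: "\<And>r. r \<in> {s1..s2} \<Longrightarrow> nsq (\<psi> r) \<le> K1\<^sup>2"
  proof -
    have "continuous_on ({s1..s2} \<times> {0..2*pi}) (\<lambda>(r, y). \<psi> r y)"
      using joint by (rule continuous_on_subset) simp
    then have "bounded ((\<lambda>(r, y). \<psi> r y) ` ({s1..s2} \<times> {0..2*pi}))"
      by (intro compact_imp_bounded compact_continuous_image compact_Times) auto
    then obtain K1 where "\<forall>z\<in>(\<lambda>(r, y). \<psi> r y) ` ({s1..s2} \<times> {0..2*pi}). norm z \<le> K1"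
      unfolding bounded_iff by blast
    then have "nsq (\<psi> r) \<le> K1\<^sup>2" if "r \<in> {s1..s2}" for r
      using that by (intro nsq_le_bound \<psi>s) force
    then show ?thesis using that by blast
  qed
  have "(\<lambda>M. F M s2 - F M s1 - integral {s1..s2} (S M)) \<longlonglongrightarrow> 0"
  proof (rule ftc_vanishing_part[where R=R and K="2 * (\<bar>of_int k\<bar> * (B * sqrt (E s1) * \<bar>K1\<bar>))"])
    show "s1 \<le> s2" by (rule s(2))
    fix M r assume r: "r \<in> {s1..s2}"
    have 1: "(a l has_vector_derivative (- \<i> * of_int k * b l r - of_real (\<nu> * lam l) * a l r)) (at r within {s1..s2})" for l
      using r s sub by (intro a_deriv) auto
    have "((\<lambda>r. a l r * cnj (c l r)) has_vector_derivative
       (a l r * cnj (- \<i> * of_int k * d l r) + (- \<i> * of_int k * b l r - of_real (\<nu> * lam l) * a l r) * cnj (c l r))) (at r within {s1..s2})" for l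
      by (rule has_vector_derivative_mult[OF 1 has_vector_derivative_cnj[OF c_deriv[OF r]]])
    then have "(F M has_vector_derivative (\<Sum>l\<in>PM M. a l r * cnj (- \<i> * of_int k * d l r) + (- \<i> * of_int k * b l r - of_real (\<nu> * lam l) * a l r) * cnj (c l r))) (at r within {s1..s2})"
      unfolding F_def by (intro has_vector_derivative_sum)
    moreover have "(\<Sum>l\<in>PM M. a l r * cnj (- \<i> * of_int k * d l r) + (- \<i> * of_int k * b l r - of_real (\<nu> * lam l) * a l r) * cnj (c l r)) = R M r + S M r"
      unfolding R_def S_def sum_distrib_left sum.distrib[symmetric] by (intro sum.cong refl) (simp add: algebra_simps)
    ultimately show "(F M has_vector_derivative R M r + S M r) (at r within {s1..s2})" by simp
    have Er: "nsq (g r) \<le> (sqrt (E s1))\<^sup>2" using Et[OF r] by (simp add: E_def nsq_nonneg)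
    have K1r: "nsq (\<psi> r) \<le> \<bar>K1\<bar>\<^sup>2" using K1[OF r] by simp
    have b1: "cmod (\<Sum>l\<in>PM M. b l r * cnj (c l r)) \<le> (B * sqrt (E s1)) * \<bar>K1\<bar>"
      unfolding b_def c_def PM_def using B(1) E_nonneg
      by (intro partial_parseval_bound u_mult_sqint gs r \<psi>s K1r order_trans[OF B(2)])
         (auto simp: power_mult_distrib E_def[symmetric] intro!: mult_left_mono Et[OF r])
    have "cmod (\<Sum>l\<in>PM M. a l r * cnj (d l r)) \<le> sqrt (E s1) * (B * \<bar>K1\<bar>)"
      unfolding a_def d_def PM_def using B(1) E_nonneg
      by (intro partial_parseval_bound u\<psi>s gs r Er order_trans[OF B(2)[OF \<psi>s]])
         (auto simp: power_mult_distrib intro!: mult_left_mono[OF K1[OF r]])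
    then have b2: "cmod (\<Sum>l\<in>PM M. a l r * cnj (d l r)) \<le> B * sqrt (E s1) * \<bar>K1\<bar>" by (simp add: mult_ac)
    have "cmod (R M r) \<le> \<bar>of_int k\<bar> * cmod (\<Sum>l\<in>PM M. b l r * cnj (c l r)) + \<bar>of_int k\<bar> * cmod (\<Sum>l\<in>PM M. a l r * cnj (d l r))"
      unfolding R_def by (rule order_trans[OF norm_triangle_ineq]) (simp add: norm_mult)
    also have "\<dots> \<le> \<bar>of_int k\<bar> * (B * sqrt (E s1) * \<bar>K1\<bar>) + \<bar>of_int k\<bar> * (B * sqrt (E s1) * \<bar>K1\<bar>)"
      by (intro add_mono mult_left_mono b1 b2) auto
    finally show "cmod (R M r) \<le> 2 * (\<bar>of_int k\<bar> * (B * sqrt (E s1) * \<bar>K1\<bar>))" by (simp only: mult_2)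
  next
    fix M show "continuous_on {s1..s2} (S M)"
      unfolding S_def using sub by (intro continuous_intros a_continuous c_cont)
  next
    fix r assume r: "r \<in> {s1..s2}"
    have "(\<lambda>M. \<Sum>l\<in>PM M. b l r * cnj (c l r)) \<longlonglongrightarrow> ip (\<lambda>y. of_real (u y) * g r y) (\<psi> r)"
      unfolding b_def c_def PM_def by (intro parseval u_mult_sqint gs r \<psi>s)
    moreover have "(\<lambda>M. \<Sum>l\<in>PM M. a l r * cnj (d l r)) \<longlonglongrightarrow> ip (g r) (\<lambda>y. of_real (u y) * \<psi> r y)"
      unfolding a_def d_def PM_def by (intro parseval u\<psi>s gs r)
    ultimately have "(\<lambda>M. R M r) \<longlonglongrightarrow> - \<i> * of_int k * ip (\<lambda>y. of_real (u y) * g r y) (\<psi> r) + \<i> * of_int k * ip (g r) (\<lambda>y. of_real (u y) * \<psi> r y)"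
      unfolding R_def by (intro tendsto_intros)
    then show "(\<lambda>M. R M r) \<longlonglongrightarrow> 0" by (simp add: u_symmetric)
  qed
  then have lim0: "(\<lambda>M. cmod (F M s2 - F M s1 - integral {s1..s2} (S M)) + \<nu> * sqrt (E s1) * P * (s2 - s1)) \<longlonglongrightarrow> cmod 0 + \<nu> * sqrt (E s1) * P * (s2 - s1)"
    by (intro tendsto_intros)
  have Flim: "(\<lambda>M. F M t) \<longlonglongrightarrow> ip (g t) (\<psi> t)" if "t \<in> {s1..s2}" for t
    unfolding F_def PM_def a_def c_def by (intro parseval gs that \<psi>s)
  have lim1: "(\<lambda>M. cmod (F M s2 - F M s1)) \<longlonglongrightarrow> cmod (ip (g s2) (\<psi> s2) - ip (g s1) (\<psi> s1))"
    using s by (intro tendsto_intros Flim) auto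
  have Sb: "cmod (S M r) \<le> \<nu> * sqrt (E s1) * P" if r: "r \<in> {s1..s2}" for M r
  proof -
    define h where "h y = of_int k ^ 2 * \<psi> r y - \<psi>2 r y" for y
    have hs: "h \<in> sqint torus1" unfolding h_def[abs_def] by (intro continuous_sqint continuous_intros \<psi>c \<psi>2)
    have "cmod (\<Sum>l\<in>PM M. of_real (lam l) * (a l r * cnj (c l r))) \<le> (\<Sum>l\<in>PM M. cmod (a l r) * cmod (fc h l))"
    proof (rule sum_norm_le)
      fix l
      show "cmod (of_real (lam l) * (a l r * cnj (c l r))) \<le> cmod (a l r) * cmod (fc h l)"
        using mult_left_mono[OF csq[of l r] norm_ge_zero[of "a l r"]] lam_nonneg[of l]
        by (simp add: norm_mult h_def[abs_def] mult_ac)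
    qed
    also have "\<dots> = sqrt ((\<Sum>l\<in>PM M. cmod (a l r) * cmod (fc h l))\<^sup>2)" by (simp add: sum_nonneg)
    also have "\<dots> \<le> sqrt ((\<Sum>l\<in>PM M. (cmod (a l r))\<^sup>2) * (\<Sum>l\<in>PM M. (cmod (fc h l))\<^sup>2))"
      by (intro real_sqrt_le_mono Cauchy_Schwarz_ineq_sum)
    also have "\<dots> \<le> sqrt (E s1 * P\<^sup>2)"
    proof (intro real_sqrt_le_mono mult_mono)
      show "(\<Sum>l\<in>PM M. (cmod (a l r))\<^sup>2) \<le> E s1"
        using bessel[OF gs[OF r], of "PM M"] Et[OF r] by (simp add: a_def E_def PM_def)
      have "(\<Sum>l\<in>PM M. (cmod (fc h l))\<^sup>2) \<le> nsq h" by (rule bessel[OF hs]) (simp add: PM_def)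
      also have "\<dots> \<le> P\<^sup>2" using P[OF r] by (intro nsq_le_bound hs) (simp add: h_def)
      finally show "(\<Sum>l\<in>PM M. (cmod (fc h l))\<^sup>2) \<le> P\<^sup>2" .
    qed (auto simp: E_nonneg sum_nonneg)
    also have "\<dots> = sqrt (E s1) * P" using P0 by (simp add: real_sqrt_mult)
    finally show ?thesis unfolding S_def using \<nu> by (simp add: norm_mult mult.assoc)
  qed
  have "cmod (F M s2 - F M s1) \<le> cmod (F M s2 - F M s1 - integral {s1..s2} (S M)) + \<nu> * sqrt (E s1) * P * (s2 - s1)" for M
  proof -
    have "cmod (integral {s1..s2} (S M)) \<le> \<nu> * sqrt (E s1) * P * (s2 - s1)"
      using s Sb unfolding S_def
      by (intro integral_bound continuous_intros a_continuous[OF sub] c_cont) auto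
    then show ?thesis
      using norm_triangle_ineq[of "F M s2 - F M s1 - integral {s1..s2} (S M)" "integral {s1..s2} (S M)"] by simp
  qed
  from LIMSEQ_le[OF lim1 lim0] this show ?thesis by (simp add: mult_ac)
qed

text \<open>The transported function is e^(i \<open>\<kappa>\<close> u) \<open>\<phi>\<close> with
  |\<open>\<kappa>\<close>| at most \<open>\<theta>\<close>. Each y-derivative costs at most a
  multiple of \<open>\<theta>\<close> U + N, where U controls u' and u'', and the sup norm of
  \<open>\<phi>\<close> costs at most 2N + 1.\<close>

lemma duality_trig_sum:
  fixes N :: nat and c :: "int \<Rightarrow> complex"
  assumes U: "U \<ge> 1" "\<And>y. y \<in> {0..2*pi} \<Longrightarrow> \<bar>D 1 y\<bar> \<le> U \<and> \<bar>D 2 y\<bar> \<le> U"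
    and k: "\<bar>k\<bar> \<le> int N" and N: "N \<ge> 1" and t: "0 \<le> t" "t \<le> s"
  defines "\<theta> \<equiv> \<bar>of_int k\<bar> * (s - t)" and "\<phi> \<equiv> trig_sum {-int N..int N} c"
  shows "cmod (ip (g s) \<phi> - ip (g t) (\<lambda>y. cis (of_int k * (s - t) * u y) * \<phi> y))
    \<le> \<nu> * (s - t) * (3 * (2 * real N + 1) * (\<theta> * U + N)\<^sup>2) * (sqrt (E t) * sqrt (nsq \<phi>))"
proof -
  define L where "L = {-int N..int N}"
  have L: "finite L" "real (card L) = 2 * real N + 1" "\<And>l. l \<in> L \<Longrightarrow> \<bar>real_of_int l\<bar> \<le> real N"
    by (auto simp: L_def abs_if)
  define \<phi>1 where "\<phi>1 = trig_sum L (\<lambda>l. \<i> * of_int l * c l)"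
  define \<phi>2 where "\<phi>2 = trig_sum L (\<lambda>l. \<i> * of_int l * (\<i> * of_int l * c l))"
  note defs = \<phi>_def \<phi>1_def \<phi>2_def L_def[symmetric]
  have d\<phi>: "(\<phi> has_vector_derivative \<phi>1 y) (at y)" "(\<phi>1 has_vector_derivative \<phi>2 y) (at y)" for y
    unfolding defs by (rule trig_sum_deriv)+
  have c\<phi>: "continuous_on I \<phi>" "continuous_on I \<phi>1" "continuous_on I \<phi>2" for I
    unfolding defs by (rule trig_sum_continuous)+
  have per\<phi>: "\<phi> (2*pi) = \<phi> 0" "\<phi>1 (2*pi) = \<phi>1 0"
    unfolding defs by (rule trig_sum_period)+
  define \<beta> where "\<beta> = (2 * real N + 1) * sqrt (nsq \<phi>)"
  have \<beta>: "\<beta> \<ge> 0" by (simp add: \<beta>_def nsq_nonneg)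
  have n1: "sqrt (nsq \<phi>1) \<le> N * sqrt (nsq \<phi>)" "sqrt (nsq \<phi>2) \<le> N * sqrt (nsq \<phi>1)"
    unfolding defs by (rule nsq_trig_sum_deriv_le[OF L(1,3)]; assumption)+
  have b\<phi>: "cmod (\<phi> y) \<le> \<beta>" "cmod (\<phi>1 y) \<le> N * \<beta>" "cmod (\<phi>2 y) \<le> N\<^sup>2 * \<beta>" for y
  proof -
    have sup: "cmod (trig_sum L d y) \<le> (2 * real N + 1) * m" if "sqrt (nsq (trig_sum L d)) \<le> m" for d m
    proof -
      \<comment> \<open>The square root of 2N + 1 is rounded up to keep integer powers of N; the
        exponents chosen later leave room for it.\<close>
      have "sqrt (card L) \<le> 2 * real N + 1" unfolding L(2) using N by (intro real_le_lsqrt) (auto simp: power2_eq_square)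
      then have "sqrt (card L) * sqrt (nsq (trig_sum L d)) \<le> (2 * real N + 1) * m"
        using that by (intro mult_mono) (auto simp: nsq_nonneg)
      with cmod_trig_sum_le[OF L(1), of d y] show ?thesis by linarith
    qed
    show "cmod (\<phi> y) \<le> \<beta>" unfolding \<beta>_def defs by (rule sup) simp
    have "cmod (\<phi>1 y) \<le> (2 * real N + 1) * (N * sqrt (nsq \<phi>))"
      using n1(1) unfolding \<phi>1_def by (rule sup)
    then show "cmod (\<phi>1 y) \<le> N * \<beta>" by (simp add: \<beta>_def mult_ac)
    have "cmod (\<phi>2 y) \<le> (2 * real N + 1) * (N * (N * sqrt (nsq \<phi>)))"
      using order_trans[OF n1(2) mult_left_mono[OF n1(1)]] unfolding \<phi>2_def by (intro sup) simp
    then show "cmod (\<phi>2 y) \<le> N\<^sup>2 * \<beta>" by (simp add: \<beta>_def mult_ac power2_eq_square)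
  qed
  \<comment> \<open>The phase vanishes at the final time, so \<open>\<psi> s\<close> is
    \<open>\<phi>\<close> itself and \<open>\<psi> t\<close> carries the full oscillation.\<close>
  define \<kappa> where "\<kappa> r = - (of_int k * (r - s))" for r :: real
  define e where "e r y = cis (\<kappa> r * u y)" for r y
  define \<psi> where "\<psi> r y = e r y * \<phi> y" for r y
  define \<psi>1 where "\<psi>1 r y = e r y * (\<i> * of_real (\<kappa> r * D 1 y) * \<phi> y + \<phi>1 y)" for r y
  define \<psi>2 where "\<psi>2 r y = e r y * (\<i> * of_real (\<kappa> r * D 1 y) * (\<i> * of_real (\<kappa> r * D 1 y) * \<phi> y + \<phi>1 y)
      + (\<i> * of_real (\<kappa> r * D 2 y) * \<phi> y + \<i> * of_real (\<kappa> r * D 1 y) * \<phi>1 y + \<phi>2 y))" for r y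
  have \<theta>: "\<theta> \<ge> 0" using t by (simp add: \<theta>_def)
  have ne: "cmod (e r y) = 1" for r y by (simp add: e_def)
  have du: "(u has_real_derivative D 1 y) (at y)" "(D 1 has_real_derivative D 2 y) (at y)" for y
    using DERIV_D[of 0 y] DERIV_D[of 1 y] by (auto simp: D_0 numeral_2_eq_2)
  have de: "(e r has_vector_derivative \<i> * of_real (\<kappa> r * D 1 y) * e r y) (at y)" for r y
    unfolding e_def by (intro has_vector_derivative_cis_comp DERIV_cmult du)
  have d\<psi>: "(\<psi> r has_vector_derivative \<psi>1 r y) (at y)" for r y
    unfolding \<psi>_def \<psi>1_def
    by (rule has_vector_derivative_eq_rhs[OF has_vector_derivative_mult[OF de d\<phi>(1)]]) (simp add: algebra_simps)
  have d\<psi>1: "(\<psi>1 r has_vector_derivative \<psi>2 r y) (at y)" for r y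
  proof -
    have "((\<lambda>y. \<kappa> r * D 1 y) has_real_derivative \<kappa> r * D 2 y) (at y)"
      by (intro DERIV_cmult du)
    from has_vector_derivative_mult_right[OF has_vector_derivative_of_real[OF this], of \<i>]
    have 1: "((\<lambda>y. \<i> * of_real (\<kappa> r * D 1 y)) has_vector_derivative \<i> * of_real (\<kappa> r * D 2 y)) (at y)" .
    show ?thesis unfolding \<psi>1_def \<psi>2_def
      by (rule has_vector_derivative_eq_rhs[OF has_vector_derivative_mult[OF de has_vector_derivative_add[OF has_vector_derivative_mult[OF 1 d\<phi>(1)] d\<phi>(2)]]])
         (simp add: algebra_simps)
  qed
  have c\<psi>2: "continuous_on UNIV (\<psi>2 r)" for r
    unfolding \<psi>2_def e_def using n0_pos
    by (intro continuous_intros u_continuous c\<phi> continuous_D) auto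
  have joint: "continuous_on UNIV (\<lambda>(r, y). \<psi> r y)"
    unfolding \<psi>_def e_def \<kappa>_def case_prod_unfold
    by (intro continuous_intros continuous_on_compose2[OF u_continuous[of UNIV]] continuous_on_compose2[OF c\<phi>(1)[of UNIV]]) auto
  have transport: "((\<lambda>r. \<psi> r y) has_vector_derivative - \<i> * of_int k * of_real (u y) * \<psi> r y) (at r)" for r y
  proof -
    have "((\<lambda>r. \<kappa> r * u y) has_real_derivative - of_int k * u y) (at r)"
      unfolding \<kappa>_def by (auto intro!: derivative_eq_intros)
    from has_vector_derivative_mult_left[OF has_vector_derivative_cis_comp[OF this], of "\<phi> y"]
    show ?thesis unfolding \<psi>_def e_def by (rule has_vector_derivative_eq_rhs) (simp add: algebra_simps)
  qed
  have Dper: "D j (2*pi) = D j 0" for j using D_periodic[of j 0] by simp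
  have per: "\<psi> r (2*pi) = \<psi> r 0" "\<psi>1 r (2*pi) = \<psi>1 r 0" for r
    unfolding \<psi>_def \<psi>1_def e_def using Dper[of 0] Dper[of 1] per\<phi> by (simp_all add: D_0)
  have Pb: "cmod (of_int k ^ 2 * \<psi> r y - \<psi>2 r y) \<le> 3 * \<beta> * (\<theta> * U + N)\<^sup>2"
    if r: "r \<in> {t..s}" and y: "y \<in> {0..<2*pi}" for r y
  proof -
    have "\<bar>\<kappa> r\<bar> \<le> \<theta>" unfolding \<kappa>_def \<theta>_def using r by (auto simp: abs_mult intro!: mult_left_mono)
    then have x: "\<bar>\<kappa> r * D 1 y\<bar> \<le> \<theta> * U" "\<bar>\<kappa> r * D 2 y\<bar> \<le> \<theta> * U"
      unfolding abs_mult using U(2)[of y] y \<theta> by (auto intro!: mult_mono)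
    define q where "q = \<theta> * U"
    have q0: "q \<ge> 0" using \<theta> U by (simp add: q_def)
    define z1 where "z1 = complex_of_real (\<kappa> r * D 1 y)"
    define z2 where "z2 = complex_of_real (\<kappa> r * D 2 y)"
    have z: "cmod z1 \<le> q" "cmod z2 \<le> q" using x by (simp_all add: z1_def z2_def q_def del: of_real_mult)
    have A1: "cmod (\<i> * z1 * \<phi> y + \<phi>1 y) \<le> q * \<beta> + N * \<beta>"
      using z b\<phi> \<beta> q0 by (intro order_trans[OF norm_triangle_ineq] add_mono) (auto simp: norm_mult intro!: mult_mono)
    have A2: "cmod (\<i> * z1 * (\<i> * z1 * \<phi> y + \<phi>1 y)) \<le> q * (q * \<beta> + N * \<beta>)"
      using z A1 q0 by (auto simp: norm_mult intro!: mult_mono)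
    have A3: "cmod (\<i> * z2 * \<phi> y + \<i> * z1 * \<phi>1 y + \<phi>2 y) \<le> q * \<beta> + q * (N * \<beta>) + N\<^sup>2 * \<beta>"
      using z b\<phi> \<beta> q0 by (intro order_trans[OF norm_triangle_ineq] add_mono) (auto simp: norm_mult intro!: mult_mono)
    have "cmod (\<psi>2 r y) \<le> q * (q * \<beta> + N * \<beta>) + (q * \<beta> + q * (N * \<beta>) + N\<^sup>2 * \<beta>)"
      unfolding \<psi>2_def norm_mult ne z1_def[symmetric] z2_def[symmetric]
      using norm_triangle_ineq[of "\<i> * z1 * (\<i> * z1 * \<phi> y + \<phi>1 y)" "\<i> * z2 * \<phi> y + \<i> * z1 * \<phi>1 y + \<phi>2 y"] A2 A3
      by simp
    moreover have "cmod (of_int k ^ 2 * \<psi> r y) \<le> N\<^sup>2 * \<beta>"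
    proof -
      have "\<bar>real_of_int k\<bar> \<le> real N" using k by linarith
      then have "\<bar>real_of_int k\<bar>\<^sup>2 \<le> (real N)\<^sup>2" by (intro power_mono) auto
      then show ?thesis unfolding \<psi>_def using b\<phi>(1)[of y] by (simp add: norm_mult ne norm_power mult_mono)
    qed
    ultimately have "cmod (of_int k ^ 2 * \<psi> r y - \<psi>2 r y) \<le> N\<^sup>2 * \<beta> + (q * (q * \<beta> + N * \<beta>) + (q * \<beta> + q * (N * \<beta>) + N\<^sup>2 * \<beta>))"
      using norm_triangle_ineq4[of "of_int k ^ 2 * \<psi> r y" "\<psi>2 r y"] by linarith
    also have "\<dots> = \<beta> * (q\<^sup>2 + 2 * (N * q) + q + 2 * N\<^sup>2)" by (simp add: algebra_simps power2_eq_square)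
    \<comment> \<open>The linear term \<open>q\<close>, which comes from u'', is absorbed by
      \<open>q \<le> N * q\<close>.\<close>
    also have "\<dots> \<le> \<beta> * (3 * (q + N)\<^sup>2)"
    proof (intro mult_left_mono)
      have "q \<le> N * q" using N q0 by (simp add: mult_le_cancel_right1)
      then have "q\<^sup>2 + 2 * (N * q) + q + 2 * N\<^sup>2 \<le> 3 * q\<^sup>2 + 6 * (N * q) + 3 * N\<^sup>2"
        using mult_nonneg_nonneg[OF of_nat_0_le_iff[of N] q0] zero_le_power2[of q] zero_le_power2[of "real N"] by linarith
      then show "q\<^sup>2 + 2 * (N * q) + q + 2 * N\<^sup>2 \<le> 3 * (q + N)\<^sup>2"
        by (simp add: power2_sum algebra_simps)
    qed (use \<beta> in simp)
    finally show ?thesis by (simp add: q_def mult_ac)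
  qed
  have "cmod (ip (g s) (\<psi> s) - ip (g t) (\<psi> t)) \<le> \<nu> * (s - t) * sqrt (E t) * (3 * \<beta> * (\<theta> * U + N)\<^sup>2)"
    by (rule duality[OF t transport joint d\<psi> d\<psi>1 c\<psi>2 per Pb])
  moreover have "\<psi> s = \<phi>" "\<psi> t = (\<lambda>y. cis (of_int k * (s - t) * u y) * \<phi> y)"
    by (auto simp: \<psi>_def e_def \<kappa>_def fun_eq_iff algebra_simps)
  ultimately show ?thesis by (simp add: \<beta>_def mult_ac)
qed

text \<open>The solution at time s is paired with its own low-frequency part \<open>\<phi>\<close>,
  which gives p(s). Up to the duality error the pairing may be moved back to time t = s - T with the
  oscillating \<open>\<psi>\<close>. There the high part of g(t) contributes at most the square root
  of E(t) - p(t) times the norm of \<open>\<phi>\<close>, and mixing makes the low part small.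
  Dividing by that norm, which is the square root of p(s), gives the claim; the two errors of 0.1
  add up to 0.2.\<close>

lemma transfer:
  fixes N :: nat
  assumes C: "mixing_constant C" and U: "U \<ge> 1" "\<And>y. y \<in> {0..2*pi} \<Longrightarrow> \<bar>D 1 y\<bar> \<le> U \<and> \<bar>D 2 y\<bar> \<le> U"
    and k: "k \<noteq> 0" "\<bar>k\<bar> \<le> int N" and T: "T > 0" and s: "0 \<le> s1" "s1 + T \<le> s"
    and \<eta>: "0 < \<eta>" "\<eta> \<le> 1"
  defines "L \<equiv> {-int N..int N}" and "\<theta> \<equiv> \<bar>of_int k\<bar> * T"
  assumes e1: "\<nu> * T * (3 * (2 * real N + 1) * (\<theta> * U + N)\<^sup>2) \<le> 0.1"
    and e2: "3 * C * N * \<eta> powr (1 / real n\<^sub>0) + 19 * C * N / (\<eta> * \<theta>) \<le> 0.6"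
  defines "p \<equiv> \<lambda>s. \<Sum>l\<in>L. (cmod (a l s))\<^sup>2"
  shows "sqrt (p s) \<le> sqrt (E (s - T) - p (s - T)) + 0.2 * sqrt (E s1)"
proof -
  define t where "t = s - T"
  have t: "0 \<le> t" "s1 \<le> t" "t \<le> s" "s - t = T" using s T by (auto simp: t_def)
  have N1: "N \<ge> 1" using k by auto
  have finL: "finite L" by (simp add: L_def)
  have p0: "0 \<le> p r" for r by (simp add: p_def sum_nonneg)
  have gt: "g t \<in> sqint torus1" and gs: "g s \<in> sqint torus1" using t by (auto intro: g_sqint)
  have pE: "p t \<le> E t" unfolding p_def E_def a_def by (rule bessel[OF gt finL])
  have Ets: "E t \<le> E s1" using t s by (intro E_antimono) auto
  define \<sigma> where "\<sigma> = sqrt (p s)"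
  have \<sigma>: "\<sigma> \<ge> 0" "\<sigma> * \<sigma> = p s" using p0[of s] by (simp_all add: \<sigma>_def)
  define \<phi> where "\<phi> = proj L (g s)"
  define \<alpha> where "\<alpha> = proj L (g t)"
  have nq: "sqrt (nsq \<phi>) = \<sigma>" "sqrt (nsq \<alpha>) = sqrt (p t)"
    unfolding \<phi>_def \<alpha>_def nsq_proj[OF finL] by (simp_all add: \<sigma>_def p_def a_def)
  define \<psi> where "\<psi> y = cis (of_int k * T * u y) * \<phi> y" for y
  have c\<phi>: "continuous_on UNIV \<phi>" "continuous_on UNIV \<alpha>"
    unfolding \<phi>_def \<alpha>_def proj_eq_trig_sum by (rule trig_sum_continuous)+
  have c\<psi>: "continuous_on UNIV \<psi>" unfolding \<psi>_def by (intro continuous_intros u_continuous c\<phi>)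
  note \<psi>s = continuous_sqint[OF c\<psi>]
  have "nsq \<psi> = nsq \<phi>" by (simp add: nsq_def \<psi>_def norm_mult)
  then have n\<psi>: "sqrt (nsq \<psi>) = \<sigma>" by (simp add: nq)
  have dual: "cmod (ip (g s) \<phi> - ip (g t) \<psi>) \<le> 0.1 * (sqrt (E s1) * \<sigma>)"
  proof -
    have "cmod (ip (g s) \<phi> - ip (g t) \<psi>) \<le> \<nu> * T * (3 * (2 * real N + 1) * (\<theta> * U + N)\<^sup>2) * (sqrt (E t) * \<sigma>)"
      using duality_trig_sum[OF U k(2) N1 t(1,3), of "fc (g s)"]
      unfolding t(4) \<theta>_def[symmetric] L_def[symmetric] proj_eq_trig_sum[symmetric] \<phi>_def[symmetric] \<psi>_def[symmetric] nq .
    also have "\<dots> \<le> 0.1 * (sqrt (E s1) * \<sigma>)"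
      using e1 Ets \<sigma> E_nonneg \<nu> T by (intro mult_mono) (auto intro!: mult_nonneg_nonneg)
    finally show ?thesis .
  qed
  have ips: "ip (g s) \<phi> = of_real (p s)"
  proof -
    have "ip (g s) \<phi> = cnj (\<Sum>l\<in>L. a l s * cnj (a l s))"
      unfolding \<phi>_def ip_commute[of "g s"] ip_proj_left[OF finL gs] a_def ..
    also have "\<dots> = of_real (p s)" unfolding p_def of_real_sum cnj_sum
      by (intro sum.cong refl) (simp add: complex_norm_square mult.commute del: of_real_power)
    finally show ?thesis .
  qed
  have split: "ip (g t) \<psi> = ip (\<lambda>y. g t y - \<alpha> y) \<psi> + ip \<alpha> \<psi>"
    unfolding \<alpha>_def using gt \<psi>s proj_sqint by (simp add: ip_diff_left)
  have first: "cmod (ip (\<lambda>y. g t y - \<alpha> y) \<psi>) \<le> sqrt (E t - p t) * \<sigma>"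
    using cmod_ip_le[OF sqint_diff[OF gt proj_sqint[of L "g t"]] \<psi>s]
    unfolding \<alpha>_def nsq_diff_proj[OF gt finL] n\<psi> by (simp add: E_def p_def a_def)
  have second: "cmod (ip \<alpha> \<psi>) \<le> 0.1 * (sqrt (E s1) * \<sigma>)"
  proof -
    define J where "J = integral {0..2*pi} (\<lambda>y. cis (- (of_int k * T) * u y) * (\<alpha> y * cnj (\<phi> y)))"
    have \<theta>: "\<bar>- (of_int k * T)\<bar> = \<theta>" "- (of_int k * T) \<noteq> 0" using T k by (simp_all add: \<theta>_def abs_mult)
    have "cmod J \<le> (3 * C * N * \<eta> powr (1 / real n\<^sub>0) + 19 * C * N / (\<eta> * \<theta>)) * (sqrt (p t) * \<sigma>)"
      using mixing_trig_sum[OF C N1 \<theta>(2) \<eta>, of "fc (g t)" "fc (g s)"]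
      unfolding \<theta>(1) L_def[symmetric] proj_eq_trig_sum[symmetric] \<phi>_def[symmetric] \<alpha>_def[symmetric] nq J_def .
    also have "\<dots> \<le> 0.6 * (sqrt (E s1) * \<sigma>)"
      using e2 Ets pE p0 \<sigma> E_nonneg by (intro mult_mono) auto
    finally have J: "cmod J \<le> 0.6 * (sqrt (E s1) * \<sigma>)" .
    have "(\<lambda>y. \<alpha> y * cnj (\<psi> y)) = (\<lambda>y. cis (- (of_int k * T) * u y) * (\<alpha> y * cnj (\<phi> y)))"
      unfolding \<psi>_def by (simp add: cis_cnj mult_ac)
    then have "cmod (ip \<alpha> \<psi>) = cmod J / (2*pi)"
      unfolding ip_continuous[OF c\<phi>(2) c\<psi>] J_def by (simp add: norm_divide norm_mult)
    \<comment> \<open>The normalisation of \<open>ip\<close> divides by 2 pi, which is at least 6,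
      so 0.6 in \<open>e2\<close> becomes 0.1.\<close>
    also have "\<dots> \<le> 0.6 * (sqrt (E s1) * \<sigma>) / 6" using J pi_gt3 \<sigma> E_nonneg by (intro frac_le) auto
    finally show ?thesis by (simp add: mult.commute)
  qed
  have "\<sigma> * \<sigma> = cmod (ip (g s) \<phi>)" using \<sigma>(2) p0[of s] by (simp add: ips)
  also have "\<dots> \<le> cmod (ip (g s) \<phi> - ip (g t) \<psi>) + cmod (ip (g t) \<psi>)"
    using norm_triangle_ineq[of "ip (g s) \<phi> - ip (g t) \<psi>" "ip (g t) \<psi>"] by simp
  also have "\<dots> \<le> 0.1 * (sqrt (E s1) * \<sigma>) + (sqrt (E t - p t) * \<sigma> + 0.1 * (sqrt (E s1) * \<sigma>))"
    unfolding split using norm_triangle_ineq[of "ip (\<lambda>y. g t y - \<alpha> y) \<psi>" "ip \<alpha> \<psi>"] first second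
      dual[unfolded split] by linarith
  also have "\<dots> = (sqrt (E t - p t) + 0.2 * sqrt (E s1)) * \<sigma>" by (simp add: algebra_simps)
  \<comment> \<open>Cancelling \<open>\<sigma>\<close> is possible unless it is 0, and then the
    claim holds because its right side is nonnegative.\<close>
  finally have "\<sigma> \<le> sqrt (E t - p t) + 0.2 * sqrt (E s1) \<or> \<sigma> = 0" using \<sigma>(1) by (auto simp: mult_le_cancel_right)
  then show ?thesis using pE E_nonneg[of s1] by (auto simp: \<sigma>_def t_def)
qed

lemma lam_ge:
  assumes "0 \<le> R" "R \<le> \<bar>of_int k\<bar> \<or> R \<le> \<bar>of_int l\<bar>"
  shows "R powr \<gamma> \<le> lam l"
proof -
  have "R\<^sup>2 \<le> real_of_int k ^ 2 + real_of_int l ^ 2"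
    using assms(2)
  proof
    assume "R \<le> \<bar>real_of_int k\<bar>"
    then have "R\<^sup>2 \<le> \<bar>real_of_int k\<bar>\<^sup>2" using assms(1) by (intro power_mono)
    then show ?thesis by (simp add: add_increasing2)
  next
    assume "R \<le> \<bar>real_of_int l\<bar>"
    then have "R\<^sup>2 \<le> \<bar>real_of_int l\<bar>\<^sup>2" using assms(1) by (intro power_mono)
    then show ?thesis by (simp add: add_increasing)
  qed
  then have "(R\<^sup>2) powr (\<gamma>/2) \<le> lam l"
    unfolding lam_def using \<gamma> by (intro powr_mono2) auto
  moreover have "(R\<^sup>2) powr (\<gamma>/2) = R powr \<gamma>"
  proof (cases "R = 0")
    case False
    then have "R\<^sup>2 = R powr 2" using assms(1) by (simp add: powr_numeral)
    then show ?thesis by (simp add: powr_powr)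
  qed simp
  ultimately show ?thesis by simp
qed

text \<open>When every mode is damped at rate \<open>\<Lambda>\<close>, the monotone energy bounds
  the dissipation from below by its final value. A rational factor in place of an exponential is
  enough for one window.\<close>

lemma direct_contraction:
  assumes s: "0 \<le> s1" "s1 \<le> s2" and \<Lambda>: "0 \<le> \<Lambda>" "\<And>l. \<Lambda> \<le> lam l"
  shows "(1 + 2 * \<nu> * \<Lambda> * (s2 - s1)) * E s2 \<le> E s1"
proof -
  have d: "E integrable_on {s1..s2}" "E s2 + 2 * \<nu> * \<Lambda> * integral {s1..s2} E \<le> E s1"
    using dissipation[OF s, of "{}" \<Lambda>] \<Lambda> by auto
  have "(s2 - s1) * E s2 = integral {s1..s2} (\<lambda>_. E s2)" using s by simp
  also have "\<dots> \<le> integral {s1..s2} E"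
    using s by (intro integral_le d(1)) (auto intro!: E_antimono)
  finally have "2 * \<nu> * \<Lambda> * ((s2 - s1) * E s2) \<le> 2 * \<nu> * \<Lambda> * integral {s1..s2} E"
    using \<nu> \<Lambda> by (intro mult_left_mono) auto
  with d(2) show ?thesis by (simp add: algebra_simps)
qed

end

section \<open>Choice of the parameters and contraction over one time window\<close>

lemma q_exponent_bounds:
  assumes "0 < \<gamma>" shows "0 < q_exponent n \<gamma>" "q_exponent n \<gamma> < 1"
  using assms by (auto simp: q_exponent_def divide_less_eq add_pos_pos)

text \<open>The balance of damping and mixing that determines the exponent. Apart from 0 < q < 1 the
  later argument uses nothing else about its formula.\<close>

lemma q_exponent_eq:
  assumes "0 < \<gamma>" shows "q_exponent n \<gamma> / (4 * (real n + 1)) * \<gamma> = 1 - q_exponent n \<gamma>"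
proof -
  define d where "d = 2 * (real n + 1)"
  have d: "d > 0" "2 * d + \<gamma> > 0" using assms by (auto simp: d_def add_pos_pos)
  then have q: "q_exponent n \<gamma> = 2 * d / (2 * d + \<gamma>)"
    unfolding q_exponent_def d_def[symmetric] by (simp add: field_simps)
  have "q_exponent n \<gamma> / (2 * d) * \<gamma> = \<gamma> / (2 * d + \<gamma>)" unfolding q using d by simp
  also have "\<dots> = 1 - q_exponent n \<gamma>" unfolding q using d by (simp add: field_simps)
  finally show ?thesis by (simp add: d_def)
qed

context shear
begin

text \<open>Three regimes, with a factor independent of \<open>\<nu>\<close>, k and the solution:
  viscosity above a threshold and |k| > N are settled by direct damping, and the remaining case by
  mixing. The constants are fixed in order: \<open>\<kappa>\<close> for the first mixing error,
  \<open>K\<close> for the second, and the threshold \<open>\<nu>0\<close> for the duality error and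
  for 2T at most \<open>\<tau>\<close>.\<close>

lemma contraction:
  fixes \<gamma> :: real
  assumes \<gamma>: "0 < \<gamma>" "\<gamma> < 2"
  defines "q \<equiv> q_exponent n\<^sub>0 \<gamma>"
  shows "\<exists>\<rho>. 0 < \<rho> \<and> \<rho> < 1 \<and> (\<forall>\<nu> k g s. 0 < \<nu> \<and> \<nu> < 1 \<and> k \<noteq> 0 \<and> flow u n\<^sub>0 \<gamma> \<nu> k g \<and> 0 \<le> s \<longrightarrow>
     nsq (g (s + \<nu> powr - q)) \<le> \<rho> * nsq (g s))"
proof -
  note q = q_exponent_bounds[OF \<gamma>(1), of n\<^sub>0, folded q_def]
  obtain C where C: "mixing_constant C" using mixing by blast
  then have C0: "C > 0" by (simp add: mixing_constant_def)
  have "\<exists>U\<ge>1. \<forall>y\<in>{0..2*pi}. \<bar>D 1 y\<bar> \<le> U \<and> \<bar>D 2 y\<bar> \<le> U"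
  proof -
    obtain B1 B2 where "\<forall>y\<in>{0..2*pi}. \<bar>D 1 y\<bar> \<le> B1" "\<forall>y\<in>{0..2*pi}. \<bar>D 2 y\<bar> \<le> B2"
      using D_bounded[of 1 0 "2*pi"] D_bounded[of 2 0 "2*pi"] by auto
    then show ?thesis by (intro exI[of _ "max 1 (max B1 B2)"]) (auto simp: le_max_iff_disj)
  qed
  then obtain U where U: "U \<ge> 1" "\<And>y. y \<in> {0..2*pi} \<Longrightarrow> \<bar>D 1 y\<bar> \<le> U \<and> \<bar>D 2 y\<bar> \<le> U" by blast
  define m where "m = n\<^sub>0 + 1"
  have m2: "m \<ge> 2" using n0_pos by (simp add: m_def)
  \<comment> \<open>\<open>N \<approx> \<nu>\<^bsup>-\<beta>\<^esup>\<close>, where \<open>\<beta>\<gamma> = 1 - q\<close> gives \<open>\<nu>N\<^sup>\<gamma>\<tau> \<ge> 1\<close> and \<open>\<beta>m = q/4\<close> gives \<open>N\<^sup>m \<lesssim> \<tau>\<^bsup>1/4\<^esup>\<close>\<close>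
  define \<beta> where "\<beta> = q / (4 * real m)"
  have \<beta>: "\<beta> > 0" using q m2 by (simp add: \<beta>_def)
  have \<beta>\<gamma>: "\<beta> * \<gamma> = 1 - q" using q_exponent_eq[OF \<gamma>(1), of n\<^sub>0] by (simp add: \<beta>_def q_def m_def add.commute)
  have \<beta>m: "\<beta> * m = q / 4" using m2 by (simp add: \<beta>_def)
  \<comment> \<open>Makes the first mixing error 3 C \<open>\<kappa>\<close> at most 0.3.\<close>
  define \<kappa> where "\<kappa> = min 1 (1 / (10 * C))"
  have \<kappa>: "\<kappa> > 0" "\<kappa> \<le> 1" "C * \<kappa> \<le> 0.1"
  proof -
    show "\<kappa> > 0" "\<kappa> \<le> 1" using C0 by (auto simp: \<kappa>_def)
    have "C * \<kappa> \<le> C * (1 / (10 * C))" using C0 by (intro mult_left_mono) (auto simp: \<kappa>_def)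
    then show "C * \<kappa> \<le> 0.1" using C0 by simp
  qed
  \<comment> \<open>Makes the second mixing error exactly 0.3 for the choices of
    \<open>\<eta>\<close> and \<open>\<theta>\<close> below.\<close>
  define K where "K = 19 * C / (0.3 * \<kappa> ^ n\<^sub>0)"
  have K: "K > 0" using C0 \<kappa> by (simp add: K_def)
  \<comment> \<open>Collects the constants of the duality error after N is replaced by its bound 2
    \<open>\<nu>\<close> powr -\<open>\<beta>\<close> in N^(3m+1).\<close>
  define K2 where "K2 = 9 * K * (K * U + 1)\<^sup>2 * 2 ^ (3 * m + 1)"
  have K2: "K2 > 0" using K U by (auto simp: K2_def intro!: mult_pos_pos zero_less_power add_pos_pos)
  \<comment> \<open>above \<open>\<nu>0\<close> the direct damping suffices, as \<open>\<tau> \<ge> 1\<close> and \<open>lam l \<ge> 1\<close>\<close>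
  define \<nu>0 where "\<nu>0 = min 1 (min ((0.1 / K2) powr 8) ((1 / (2 ^ (m + 1) * K)) powr (4 / (3 * q))))"
  have \<nu>0: "\<nu>0 > 0" using K K2 by (simp add: \<nu>0_def)
  \<comment> \<open>The two entries belong to viscosities below and above
    \<open>\<nu>0\<close>.\<close>
  define \<rho> where "\<rho> = max 0.8 (1 / (1 + 2 * \<nu>0))"
  have "nsq (g (s + \<nu> powr - q)) \<le> \<rho> * nsq (g s)"
    if \<nu>: "0 < \<nu>" "\<nu> < 1" and k: "k \<noteq> 0" and fl: "flow u n\<^sub>0 \<gamma> \<nu> k g" and s: "0 \<le> s" for \<nu> k g s
  proof -
    interpret F: flow u n\<^sub>0 \<gamma> \<nu> k g by (rule fl)
    define \<tau> where "\<tau> = \<nu> powr - q"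
    have \<tau>: "\<tau> \<ge> 1" using \<nu> q powr_mono'[of "-q" 0 \<nu>] by (simp add: \<tau>_def)
    note E0 = F.E_nonneg
    have "F.E (s + \<tau>) \<le> \<rho> * F.E s"
    proof (cases "\<nu> \<le> \<nu>0")
      case False
      have "(1 + 2 * \<nu>0) * F.E (s + \<tau>) \<le> (1 + 2 * \<nu> * 1 * (s + \<tau> - s)) * F.E (s + \<tau>)"
      proof (intro mult_right_mono E0)
        have "\<nu>0 * 1 \<le> \<nu> * \<tau>" using False \<nu>0 \<tau> by (intro mult_mono) auto
        then show "1 + 2 * \<nu>0 \<le> 1 + 2 * \<nu> * 1 * (s + \<tau> - s)" by simp
      qed
      also have "\<dots> \<le> F.E s"
      proof (rule F.direct_contraction)
        have "1 \<le> \<bar>real_of_int k\<bar>" using k by linarith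
        then show "1 \<le> F.lam l" for l using F.lam_ge[of 1 l] by simp
      qed (use s \<tau> in auto)
      finally have "F.E (s + \<tau>) \<le> 1 / (1 + 2 * \<nu>0) * F.E s" using \<nu>0 by (simp add: field_simps)
      also have "\<dots> \<le> \<rho> * F.E s" unfolding \<rho>_def by (intro mult_right_mono E0) simp
      finally show ?thesis .
    next
      case True
      define N where "N = nat \<lceil>\<nu> powr - \<beta>\<rceil>"
      have pw1: "\<nu> powr - \<beta> \<ge> 1" using \<nu> \<beta> powr_mono'[of "-\<beta>" 0 \<nu>] by simp
      have N: "\<nu> powr - \<beta> \<le> N" "real N \<le> 2 * \<nu> powr - \<beta>" "N \<ge> 1"
      proof -
        show a: "\<nu> powr - \<beta> \<le> N" unfolding N_def by (rule real_nat_ceiling_ge)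
        show "real N \<le> 2 * \<nu> powr - \<beta>" unfolding N_def using pw1 by linarith
        show "N \<ge> 1" using a pw1 by linarith
      qed
      define \<Lambda> where "\<Lambda> = real N powr \<gamma>"
      have \<Lambda>: "1 \<le> \<nu> * \<Lambda> * \<tau>"
      proof -
        have "1 = \<nu> powr (1 + (- \<beta> * \<gamma>) + (- q))" using \<nu> \<beta>\<gamma> by simp
        also have "\<dots> = \<nu> powr 1 * \<nu> powr (- \<beta> * \<gamma>) * \<nu> powr (- q)" by (simp only: powr_add)
        also have "\<dots> = \<nu> * (\<nu> powr - \<beta>) powr \<gamma> * \<tau>" using \<nu> by (simp add: \<tau>_def powr_powr)
        also have "\<dots> \<le> \<nu> * \<Lambda> * \<tau>" unfolding \<Lambda>_def using \<nu> \<tau> N \<gamma>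
          by (intro mult_right_mono mult_left_mono powr_mono2) auto
        finally show ?thesis .
      qed
      have "F.E (s + \<tau>) \<le> 0.8 * F.E s"
      \<comment> \<open>For |k| > N the symbol is at least N^\<open>\<gamma>\<close> at every l, so
        the energy drops to a third.\<close>
      proof (cases "\<bar>k\<bar> \<le> int N")
        case False
        have "3 * F.E (s + \<tau>) \<le> (1 + 2 * \<nu> * \<Lambda> * (s + \<tau> - s)) * F.E (s + \<tau>)"
          using \<Lambda> by (intro mult_right_mono E0) simp
        also have "\<dots> \<le> F.E s"
        proof (rule F.direct_contraction)
          have "real N \<le> \<bar>real_of_int k\<bar>" using False by linarith
          then show "\<Lambda> \<le> F.lam l" for l unfolding \<Lambda>_def by (intro F.lam_ge) auto
        qed (use s \<tau> in \<open>auto simp: \<Lambda>_def\<close>)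
        finally show ?thesis using E0[of s] by simp
      next
        case True
        define \<theta> where "\<theta> = K * real N ^ m"
        \<comment> \<open>The phase |k| T = \<open>\<theta>\<close> is the same for all k, and
          larger |k| only shortens T.\<close>
        define T where "T = \<theta> / \<bar>of_int k\<bar>"
        have \<theta>: "\<theta> > 0" using K N by (simp add: \<theta>_def)
        have kr: "\<bar>real_of_int k\<bar> \<ge> 1" using k by linarith
        have T: "T > 0" "\<bar>of_int k\<bar> * T = \<theta>" "T \<le> \<theta>"
          using \<theta> kr k by (auto simp: T_def divide_le_eq mult_le_cancel_left1)
        \<comment> \<open>Now \<open>\<eta>\<close> powr (1/\<open>n\<^sub>0\<close>) =
          \<open>\<kappa>\<close>/N cancels the factor N of the first mixing error. In the second,
          \<open>\<eta>\<close> * \<open>\<theta>\<close> is a constant times N because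
          \<open>\<theta>\<close> = K N^(\<open>n\<^sub>0\<close> + 1).\<close>
        define \<eta> where "\<eta> = (\<kappa> / N) ^ n\<^sub>0"
        have \<eta>: "0 < \<eta>" "\<eta> \<le> 1" "\<eta> powr (1 / real n\<^sub>0) = \<kappa> / N"
        proof -
          show "0 < \<eta>" using \<kappa> N by (simp add: \<eta>_def)
          have "\<kappa> / N \<le> 1" using \<kappa> N by (simp add: divide_le_eq)
          then show "\<eta> \<le> 1" unfolding \<eta>_def using \<kappa> by (intro power_le_one) auto
          show "\<eta> powr (1 / real n\<^sub>0) = \<kappa> / N"
            unfolding \<eta>_def using \<kappa> N n0_pos by (simp add: powr_realpow[symmetric] powr_powr)
        qed
        have Nm: "real N ^ j \<le> 2 ^ j * \<nu> powr - (\<beta> * j)" for j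
        proof -
          have "real N ^ j \<le> (2 * \<nu> powr - \<beta>) ^ j" using N by (intro power_mono) auto
          also have "\<dots> = 2 ^ j * \<nu> powr - (\<beta> * j)"
            using \<nu> by (simp add: power_mult_distrib powr_realpow[symmetric] powr_powr)
          finally show ?thesis .
        qed
        have N1: "1 \<le> real N" using N by simp
        have e2: "3 * C * N * \<eta> powr (1 / real n\<^sub>0) + 19 * C * N / (\<eta> * \<theta>) \<le> 0.6"
        proof -
          have "3 * C * N * \<eta> powr (1 / real n\<^sub>0) = 3 * (C * \<kappa>)" using N1 by (simp add: \<eta>)
          moreover have "19 * C * N / (\<eta> * \<theta>) = 0.3"
          proof -
            have "\<eta> * \<theta> = \<kappa> ^ n\<^sub>0 * K * N" using N1 by (simp add: \<eta>_def \<theta>_def m_def power_divide)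
            also have "\<dots> = 19 * C / 0.3 * N" using \<kappa> by (simp add: K_def)
            finally show ?thesis using N1 C0 by (simp only:) simp
          qed
          ultimately show ?thesis using \<kappa>(3) by linarith
        qed
        have e1: "\<nu> * T * (3 * (2 * real N + 1) * (\<theta> * U + N)\<^sup>2) \<le> 0.1"
        proof -
          have NNm: "real N \<le> real N ^ m" using N1 m2 by (intro self_le_power) auto
          have "\<theta> * U + N \<le> (K * U + 1) * real N ^ m" using NNm by (simp add: \<theta>_def algebra_simps)
          then have "(\<theta> * U + N)\<^sup>2 \<le> ((K * U + 1) * real N ^ m)\<^sup>2" using \<theta> U by (intro power_mono) auto
          then have "\<nu> * T * (3 * (2 * real N + 1) * (\<theta> * U + N)\<^sup>2) \<le> \<nu> * \<theta> * (3 * (3 * real N) * ((K * U + 1) * real N ^ m)\<^sup>2)"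
            using \<nu> T \<theta> N1 by (intro mult_mono) auto
          also have "\<dots> = \<nu> * (9 * K * (K * U + 1)\<^sup>2) * real N ^ (3 * m + 1)"
            by (simp add: \<theta>_def power_mult_distrib power_add power_mult[symmetric] power2_eq_square power3_eq_cube mult.commute[of 3] numeral_3_eq_3)
          also have "\<dots> \<le> \<nu> * (9 * K * (K * U + 1)\<^sup>2) * (2 ^ (3 * m + 1) * \<nu> powr - (\<beta> * real (3 * m + 1)))"
            using \<nu> K U by (intro mult_left_mono Nm) auto
          also have "\<dots> = K2 * (\<nu> * \<nu> powr - (\<beta> * real (3 * m + 1)))" by (simp add: K2_def)
          also have "\<nu> * \<nu> powr - (\<beta> * real (3 * m + 1)) = \<nu> powr (1 - \<beta> * real (3 * m + 1))"
            using \<nu> by (simp add: powr_diff powr_minus_divide)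
          also have "K2 * \<nu> powr (1 - \<beta> * real (3 * m + 1)) \<le> K2 * \<nu> powr (1 / 8)"
          proof -
            \<comment> \<open>Since m is at least 2 and q is below 1, a factor \<open>\<nu>\<close>
              powr (1/8) is left over; this is why \<open>\<nu>0\<close> contains an eighth
              power.\<close>
            have "\<beta> * real (3 * m + 1) = q * (3 / 4 + 1 / (4 * real m))" using m2 by (simp add: \<beta>_def field_simps)
            also have "\<dots> \<le> 1 * (7 / 8)"
            proof (rule mult_mono)
              have "1 / (4 * real m) \<le> 1 / 8" using m2 by (intro divide_left_mono) auto
              then show "3 / 4 + 1 / (4 * real m) \<le> 7 / 8" by simp
            qed (use q in auto)
            finally show ?thesis using \<nu> K2 by (intro mult_left_mono powr_mono') auto
          qed
          also have "\<dots> \<le> K2 * (0.1 / K2)"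
          proof -
            have "\<nu> \<le> (0.1 / K2) powr 8" using \<open>\<nu> \<le> \<nu>0\<close> by (simp add: \<nu>0_def)
            then have "\<nu> powr (1 / 8) \<le> ((0.1 / K2) powr 8) powr (1 / 8)" using \<nu> by (intro powr_mono2) auto
            also have "\<dots> = 0.1 / K2" unfolding powr_powr using K2 by simp
            finally show ?thesis using K2 by (intro mult_left_mono) auto
          qed
          finally show ?thesis using K2 by simp
        qed
        have T2: "2 * T \<le> \<tau>"
        proof -
          have "2 * T \<le> 2 * K * real N ^ m" using T by (simp add: \<theta>_def)
          also have "\<dots> \<le> 2 * K * (2 ^ m * \<nu> powr - (\<beta> * m))" using K by (intro mult_left_mono Nm) auto
          also have "\<dots> = 2 ^ (m + 1) * K * \<nu> powr - (q / 4)" by (simp add: \<beta>m)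
          also have "\<dots> \<le> \<nu> powr - (3 * q / 4) * \<nu> powr - (q / 4)"
          proof (rule mult_right_mono)
            \<comment> \<open>N^m uses up only the power q/4 of the window length; the other 3q/4
              absorbs the constants.\<close>
            have "\<nu> \<le> (1 / (2 ^ (m + 1) * K)) powr (4 / (3 * q))" using \<open>\<nu> \<le> \<nu>0\<close> by (simp add: \<nu>0_def)
            then have "\<nu> powr (3 * q / 4) \<le> ((1 / (2 ^ (m + 1) * K)) powr (4 / (3 * q))) powr (3 * q / 4)"
              using \<nu> q by (intro powr_mono2) auto
            also have "\<dots> = 1 / (2 ^ (m + 1) * K)" using K q by (simp add: powr_powr)
            finally show "2 ^ (m + 1) * K \<le> \<nu> powr - (3 * q / 4)"
              using K \<nu> by (simp add: powr_minus_divide field_simps)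
          qed simp
          also have "\<dots> = \<tau>" by (simp add: \<tau>_def powr_add[symmetric])
          finally show ?thesis .
        qed
        show ?thesis
        proof (rule F.contraction_from_transfer[where L="{-int N..int N}" and \<Lambda>=\<Lambda> and T=T])
          show "\<Lambda> \<le> F.lam l" if "l \<notin> {-int N..int N}" for l
          proof -
            have "real N \<le> \<bar>real_of_int l\<bar>" using that by auto
            then show ?thesis unfolding \<Lambda>_def by (intro F.lam_ge) auto
          qed
          show "sqrt (\<Sum>l = - int N..int N. (cmod (F.a l t))\<^sup>2)
            \<le> sqrt (F.E (t - T) - (\<Sum>l = - int N..int N. (cmod (F.a l (t - T)))\<^sup>2)) + 0.2 * sqrt (F.E s)"
            if "t \<in> {s + T..s + \<tau>}" for t
            using that s T e1 e2 by (intro F.transfer[OF C U k True T(1) _ _ \<eta>(1,2)]) auto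
        qed (use s \<tau> \<Lambda> T T2 in auto)
      qed
      also have "\<dots> \<le> \<rho> * F.E s" unfolding \<rho>_def by (intro mult_right_mono E0) simp
      finally show ?thesis .
    qed
    then show ?thesis by (simp add: F.E_def \<tau>_def)
  qed
  moreover have "0 < \<rho>" "\<rho> < 1" using \<nu>0 by (auto simp: \<rho>_def)
  ultimately show ?thesis by blast
qed

end

section \<open>Reduction to a fixed frequency in x\<close>

text \<open>The Fourier coefficient in x as a function of y. It is meaningful for almost every y,
  and the value of the integral at exceptional sections does not affect L^2 statements.\<close>

definition slice :: "int \<Rightarrow> (real \<times> real \<Rightarrow> complex) \<Rightarrow> real \<Rightarrow> complex" where
  "slice k f y = fc (\<lambda>x. f (x, y)) k"

definition plane_wave :: "int \<Rightarrow> int \<Rightarrow> real \<times> real \<Rightarrow> complex" where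
  "plane_wave p q z = mode p (fst z) * mode q (snd z)"

lemma cnj_mode: "cnj (mode l y) = mode (-l) y"
  by (simp add: mode_def cis_cnj)

lemma L2_torus_eq: "L2_torus = sqint torus2"
  by (simp add: L2_torus_def sqint_def)

interpretation torus2: finite_measure torus2
  unfolding torus2_def by (intro finite_measure_pair_measure) unfold_locales

lemma plane_wave_sqint: "plane_wave p q \<in> sqint torus2"
proof (rule torus2.sqint_bounded[of _ 1])
  show "plane_wave p q \<in> borel_measurable torus2"
    unfolding plane_wave_def[abs_def] torus2_def by measurable
qed (simp add: plane_wave_def norm_mult)

lemma slice_measurable:
  assumes "f \<in> sqint torus2" shows "slice k f \<in> borel_measurable torus1"
proof -
  have [measurable]: "f \<in> borel_measurable (torus1 \<Otimes>\<^sub>M torus1)"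
    using sqint_measurable[OF assms] by (simp add: torus2_def)
  show ?thesis unfolding slice_def[abs_def] ip_def cnj_mode by measurable
qed

lemma slice_section_sqint:
  assumes f: "f \<in> sqint torus2" shows "AE y in torus1. (\<lambda>x. f (x, y)) \<in> sqint torus1"
proof -
  have [measurable]: "f \<in> borel_measurable (torus1 \<Otimes>\<^sub>M torus1)"
    using sqint_measurable[OF f] by (simp add: torus2_def)
  have "integrable (torus1 \<Otimes>\<^sub>M torus1) (\<lambda>(x, y). (cmod (f (x, y)))\<^sup>2)"
    using sqint_integrable[OF f] by (simp add: torus2_def case_prod_unfold)
  from torus_pair.AE_integrable_snd[OF this] AE_space show ?thesis
  proof eventually_elim
    case (elim y)
    then show ?case by (intro sqintI) measurable
  qed
qed

lemma L2_torus_norm_sq: "(L2_torus_norm f)\<^sup>2 = (LINT z|torus2. (cmod (f z))\<^sup>2)"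
  unfolding L2_torus_norm_def by (auto intro!: real_sqrt_pow2 integral_nonneg_AE)

lemma slice_section_nsq:
  assumes f: "f \<in> sqint torus2"
  shows "integrable torus1 (\<lambda>y. nsq (\<lambda>x. f (x, y)))"
    and "(LINT y|torus1. nsq (\<lambda>x. f (x, y))) = (L2_torus_norm f)\<^sup>2 / (2*pi)"
proof -
  have "integrable (torus1 \<Otimes>\<^sub>M torus1) (\<lambda>(x, y). (cmod (f (x, y)))\<^sup>2)"
    using sqint_integrable[OF f] by (simp add: torus2_def case_prod_unfold)
  note * = torus_pair.integrable_snd[OF this] torus_pair.integral_snd[OF this]
  show "integrable torus1 (\<lambda>y. nsq (\<lambda>x. f (x, y)))" using *(1) by (simp add: nsq_def)
  show "(LINT y|torus1. nsq (\<lambda>x. f (x, y))) = (L2_torus_norm f)\<^sup>2 / (2*pi)"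
    using *(2) by (simp add: L2_torus_norm_sq nsq_def torus2_def case_prod_unfold)
qed

lemma slice_sqint:
  assumes f: "f \<in> sqint torus2" shows "slice k f \<in> sqint torus1"
proof (rule sqintI[OF slice_measurable[OF f]])
  have [measurable]: "slice k f \<in> borel_measurable torus1" by (rule slice_measurable[OF f])
  show "integrable torus1 (\<lambda>y. (cmod (slice k f y))\<^sup>2)"
  proof (rule Bochner_Integration.integrable_bound[OF slice_section_nsq(1)[OF f]])
    show "AE y in torus1. norm ((cmod (slice k f y))\<^sup>2) \<le> norm (nsq (\<lambda>x. f (x, y)))"
      using slice_section_sqint[OF f]
    proof eventually_elim
      case (elim y)
      show ?case using bessel[OF elim, of "{k}"] by (simp add: slice_def nsq_nonneg)
    qed
  qed measurable
qed

text \<open>Parseval in x for almost every y, integrated in y; the norms of the sections dominate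
  the partial sums. Each of the two normalised circles contributes one factor 2 pi.\<close>

lemma parseval_slices:
  assumes f: "f \<in> sqint torus2"
  shows "(\<lambda>M. \<Sum>k\<in>{-int M..int M}. nsq (slice k f)) \<longlonglongrightarrow> (L2_torus_norm f)\<^sup>2 / (2*pi)\<^sup>2"
    and "finite S \<Longrightarrow> (\<Sum>k\<in>S. nsq (slice k f)) \<le> (L2_torus_norm f)\<^sup>2 / (2*pi)\<^sup>2"
proof -
  have [measurable]: "slice k f \<in> borel_measurable torus1" for k by (rule slice_measurable[OF f])
  have sum: "(\<Sum>k\<in>S. nsq (slice k f)) = (LINT y|torus1. (\<Sum>k\<in>S. (cmod (slice k f y))\<^sup>2)) / (2*pi)" for S
    unfolding nsq_def sum_divide_distrib[symmetric] using sqint_integrable[OF slice_sqint[OF f]]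
    by (subst Bochner_Integration.integral_sum) auto
  have bound: "AE y in torus1. (\<Sum>k\<in>S. (cmod (slice k f y))\<^sup>2) \<le> nsq (\<lambda>x. f (x, y))" if "finite S" for S
    using slice_section_sqint[OF f]
    by eventually_elim (simp add: slice_def bessel that)
  have "(\<lambda>M. LINT y|torus1. (\<Sum>k\<in>{-int M..int M}. (cmod (slice k f y))\<^sup>2)) \<longlonglongrightarrow> (LINT y|torus1. nsq (\<lambda>x. f (x, y)))"
  proof (rule integral_dominated_convergence[OF _ _ slice_section_nsq(1)[OF f]])
    show "(\<lambda>y. nsq (\<lambda>x. f (x, y))) \<in> borel_measurable torus1"
      using slice_section_nsq(1)[OF f] by (rule borel_measurable_integrable)
    show "AE y in torus1. (\<lambda>M. \<Sum>k\<in>{-int M..int M}. (cmod (slice k f y))\<^sup>2) \<longlonglongrightarrow> nsq (\<lambda>x. f (x, y))"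
      using slice_section_sqint[OF f] by eventually_elim (simp add: slice_def parseval_nsq)
    show "AE y in torus1. norm (\<Sum>k\<in>{-int M..int M}. (cmod (slice k f y))\<^sup>2) \<le> nsq (\<lambda>x. f (x, y))" for M
      using bound[of "{-int M..int M}"] by (simp add: sum_nonneg)
  qed measurable
  then show "(\<lambda>M. \<Sum>k\<in>{-int M..int M}. nsq (slice k f)) \<longlonglongrightarrow> (L2_torus_norm f)\<^sup>2 / (2*pi)\<^sup>2"
    unfolding sum slice_section_nsq(2)[OF f]
    by (auto intro!: tendsto_eq_intros simp: power2_eq_square)
  show "(\<Sum>k\<in>S. nsq (slice k f)) \<le> (L2_torus_norm f)\<^sup>2 / (2*pi)\<^sup>2" if S: "finite S"
  proof -
    have "(LINT y|torus1. (\<Sum>k\<in>S. (cmod (slice k f y))\<^sup>2)) \<le> (LINT y|torus1. nsq (\<lambda>x. f (x, y)))"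
      using bound[OF S] sqint_integrable[OF slice_sqint[OF f]] slice_section_nsq(1)[OF f]
      by (intro integral_mono_AE) auto
    then show ?thesis unfolding sum slice_section_nsq(2)[OF f]
      by (simp add: power2_eq_square divide_right_mono flip: divide_divide_eq_left)
  qed
qed

text \<open>Fubini. As the pairing of the weak formulation is bilinear, the conjugate is taken by
  the plane wave with opposite frequencies.\<close>

lemma fc_slice:
  assumes f: "f \<in> sqint torus2"
  shows "fc (slice k f) l = (LINT z|torus2. f z * plane_wave (-k) (-l) z) / of_real ((2*pi)\<^sup>2)"
proof -
  define F where "F x y = f (x, y) * cnj (plane_wave k l (x, y))" for x y
  have "integrable torus2 (\<lambda>z. f z * cnj (plane_wave k l z))"
    by (rule sqint_mult_cnj_integrable[OF f plane_wave_sqint])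
  then have i: "integrable (torus1 \<Otimes>\<^sub>M torus1) (case_prod F)"
    by (simp add: torus2_def F_def case_prod_unfold)
  have "slice k f y * cnj (mode l y) = (LINT x|torus1. F x y) / of_real (2*pi)" for y
    unfolding slice_def ip_def F_def plane_wave_def by (simp add: mult.assoc[symmetric])
  then have "fc (slice k f) l = (LINT y|torus1. LINT x|torus1. F x y) / of_real ((2*pi)\<^sup>2)"
    unfolding ip_def[of "slice k f"] by (simp add: power2_eq_square)
  also have "(LINT y|torus1. LINT x|torus1. F x y) = (LINT z|torus2. f z * plane_wave (-k) (-l) z)"
    unfolding torus_pair.integral_snd[OF i] by (simp add: torus2_def F_def case_prod_unfold plane_wave_def cnj_mode)
  finally show ?thesis .
qed

text \<open>The initial datum is attained only almost everywhere, so it is compared through Fourier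
  coefficients and not through pointwise values of the slices.\<close>

lemma fc_slice_cong:
  assumes "f \<in> sqint torus2" "h \<in> sqint torus2" "AE z in torus2. f z = h z"
  shows "fc (slice k f) l = fc (slice k h) l"
proof -
  have [measurable]: "f \<in> borel_measurable torus2" "h \<in> borel_measurable torus2" "plane_wave p q \<in> borel_measurable torus2" for p q
    using assms plane_wave_sqint by (auto simp: sqint_measurable)
  have "(LINT z|torus2. f z * plane_wave (-k) (-l) z) = (LINT z|torus2. h z * plane_wave (-k) (-l) z)"
    by (rule integral_cong_AE) (use assms(3) in auto)
  then show ?thesis by (simp add: fc_slice assms)
qed

section \<open>Plane waves as test functions\<close>

lemma fourier_coeff_plane_wave: "fourier_coeff (plane_wave p q) k l = of_bool (k = p \<and> l = q)"
proof -
  have sl: "slice k (plane_wave p q) y = of_bool (p = k) * mode q y" for y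
  proof -
    have "(\<lambda>x. plane_wave p q (x, y)) = (\<lambda>x. mode q y * mode p x)"
      by (simp add: plane_wave_def fun_eq_iff)
    then show ?thesis by (simp only: slice_def ip_scale_left ip_mode) (rule mult.commute)
  qed
  have "fc (slice k (plane_wave p q)) l = of_bool (p = k) * of_bool (q = l)"
    unfolding sl[abs_def] ip_scale_left ip_mode ..
  moreover have "plane_wave (-k) (-l) z = cis (- (of_int k * fst z + of_int l * snd z))" for z
    by (simp add: plane_wave_def mode_def cis_mult)
  then have "fourier_coeff (plane_wave p q) k l = fc (slice k (plane_wave p q)) l"
    unfolding fourier_coeff_def by (simp add: fc_slice[OF plane_wave_sqint] case_prod_unfold)
  ultimately show ?thesis by auto
qed

lemma frac_laplacian_plane_wave:
  "frac_laplacian \<gamma> (plane_wave p q) z = of_real ((of_int p ^ 2 + of_int q ^ 2) powr (\<gamma> / 2)) * plane_wave p q z"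
proof -
  define G where "G = (\<lambda>(k, l). complex_of_real ((of_int k ^ 2 + of_int l ^ 2) powr (\<gamma> / 2)) *
       fourier_coeff (plane_wave p q) k l * cis (of_int k * fst z + of_int l * snd z))"
  have "frac_laplacian \<gamma> (plane_wave p q) z = infsum G UNIV"
    unfolding frac_laplacian_def G_def by (simp add: case_prod_unfold)
  also have "\<dots> = infsum G {(p, q)}"
    by (rule infsum_cong_neutral) (auto simp: G_def fourier_coeff_plane_wave)
  also have "\<dots> = of_real ((of_int p ^ 2 + of_int q ^ 2) powr (\<gamma> / 2)) * plane_wave p q z"
    by (simp add: G_def fourier_coeff_plane_wave plane_wave_def mode_def cis_mult)
  finally show ?thesis .
qed

text \<open>The free scalar \<open>c\<close> makes the eigenfunction property iterable, as the
  induction over the number of derivatives needs.\<close>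

lemma partial_x_plane_wave: "partial_x (\<lambda>z. c * plane_wave p q z) = (\<lambda>z. \<i> * of_int p * c * plane_wave p q z)"
proof (intro ext, clarify)
  fix x y
  have "((\<lambda>s. c * mode q y * mode p s) has_vector_derivative c * mode q y * (\<i> * of_int p * mode p x)) (at x)"
    by (rule has_vector_derivative_mult_right[OF has_vector_derivative_mode])
  from vector_derivative_at[OF this]
  show "partial_x (\<lambda>z. c * plane_wave p q z) (x, y) = \<i> * of_int p * c * plane_wave p q (x, y)"
    by (simp add: partial_x_def plane_wave_def mult_ac)
qed

lemma partial_y_plane_wave: "partial_y (\<lambda>z. c * plane_wave p q z) = (\<lambda>z. \<i> * of_int q * c * plane_wave p q z)"
proof (intro ext, clarify)
  fix x y
  have "((\<lambda>s. c * mode p x * mode q s) has_vector_derivative c * mode p x * (\<i> * of_int q * mode q y)) (at y)"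
    by (rule has_vector_derivative_mult_right[OF has_vector_derivative_mode])
  from vector_derivative_at[OF this]
  show "partial_y (\<lambda>z. c * plane_wave p q z) (x, y) = \<i> * of_int q * c * plane_wave p q (x, y)"
    by (simp add: partial_y_def plane_wave_def mult_ac)
qed

lemma plane_wave_differentiable: "(\<lambda>z. c * plane_wave p q z) differentiable (at z)"
proof -
  have m: "mode l differentiable (at y)" for l y
    using has_vector_derivative_mode[of l y UNIV] by (auto simp: differentiable_def has_vector_derivative_def)
  have "(mode l \<circ> fst) differentiable (at z)" "(mode l \<circ> snd) differentiable (at z)" for l
    by (intro differentiable_chain_at m; simp add: bounded_linear_imp_differentiable bounded_linear_fst bounded_linear_snd)+
  then show ?thesis unfolding plane_wave_def[abs_def] o_def
    by (intro differentiable_mult) auto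
qed

lemma test_function_plane_wave: "test_function (plane_wave p q)"
  unfolding test_function_def
proof (intro conjI allI)
  have per: "mode l (x + 2*pi) = mode l x" for l x
    by (simp add: mode_def ring_distribs mult.commute[of "of_int _" "2*pi"] cis_multiple_2pi flip: cis_mult)
  show "plane_wave p q (x + 2*pi, y) = plane_wave p q (x, y)" "plane_wave p q (x, y + 2*pi) = plane_wave p q (x, y)" for x y
    by (simp_all add: plane_wave_def per)
  fix a b z
  have y: "\<exists>c. (partial_y ^^ b) (plane_wave p q) = (\<lambda>z. c * plane_wave p q z)" for b
  proof (induction b)
    case 0
    show ?case by (intro exI[of _ 1]) auto
  next
    case (Suc b)
    then show ?case by (auto simp: partial_y_plane_wave)
  qed
  have "\<exists>c. (partial_x ^^ a) ((partial_y ^^ b) (plane_wave p q)) = (\<lambda>z. c * plane_wave p q z)" for a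
  proof (induction a)
    case 0
    show ?case using y[of b] by simp
  next
    case (Suc a)
    then show ?case by (auto simp: partial_x_plane_wave)
  qed
  then show "(partial_x ^^ a) ((partial_y ^^ b) (plane_wave p q)) differentiable (at z)"
    by (metis plane_wave_differentiable)
qed

lemma L2_torus_norm_nonneg: "0 \<le> L2_torus_norm f"
  unfolding L2_torus_norm_def by (auto intro!: integral_nonneg_AE)

lemma L2_torus_norm_triangle:
  assumes f: "f \<in> sqint torus2" and h: "h \<in> sqint torus2"
  shows "(L2_torus_norm f)\<^sup>2 \<le> 2 * (L2_torus_norm (\<lambda>z. f z - h z))\<^sup>2 + 2 * (L2_torus_norm h)\<^sup>2"
proof -
  have "(cmod (f z))\<^sup>2 \<le> 2 * (cmod (f z - h z))\<^sup>2 + 2 * (cmod (h z))\<^sup>2" for z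
    using norm_add_power2_le[of "f z - h z" "h z"] by simp
  then have "(LINT z|torus2. (cmod (f z))\<^sup>2) \<le> (LINT z|torus2. 2 * (cmod (f z - h z))\<^sup>2 + 2 * (cmod (h z))\<^sup>2)"
    using sqint_integrable[OF f] sqint_integrable[OF h] sqint_integrable[OF sqint_diff[OF f h]]
    by (intro integral_mono) auto
  also have "\<dots> = 2 * (LINT z|torus2. (cmod (f z - h z))\<^sup>2) + 2 * (LINT z|torus2. (cmod (h z))\<^sup>2)"
    using sqint_integrable[OF h] sqint_integrable[OF sqint_diff[OF f h]] by simp
  finally show ?thesis by (simp add: L2_torus_norm_sq)
qed

section \<open>From weak solutions to the equation at a fixed frequency\<close>

text \<open>Continuity in time gives a bound near each time, and bisection extends it to the compact
  interval.\<close>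

lemma is_solution_bounded:
  assumes "is_solution \<gamma> u \<nu> fin f"
  shows "\<exists>K. \<forall>t\<in>{0..T}. (L2_torus_norm (f t))\<^sup>2 \<le> K"
proof (cases "0 \<le> T")
  case True
  have f: "\<And>t. 0 \<le> t \<Longrightarrow> f t \<in> sqint torus2"
    and lim: "\<And>t. 0 \<le> t \<Longrightarrow> ((\<lambda>s. L2_torus_norm (\<lambda>z. f s z - f t z)) \<longlongrightarrow> 0) (at t within {0..})"
    using assms by (auto simp: is_solution_def L2_torus_eq)
  \<comment> \<open>The restriction to nonnegative times is needed because the intervals around 0 in
    the bisection reach below 0.\<close>
  define P where "P a b \<longleftrightarrow> (\<exists>K. \<forall>t\<in>{a..b}. 0 \<le> t \<longrightarrow> (L2_torus_norm (f t))\<^sup>2 \<le> K)" for a b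
  have "P 0 T"
  proof (rule Bolzano[OF True])
    show "P a c" if ab: "P a b" "P b c" "a \<le> b" "b \<le> c" for a b c
    proof -
      obtain K1 K2 where K: "\<forall>t\<in>{a..b}. 0 \<le> t \<longrightarrow> (L2_torus_norm (f t))\<^sup>2 \<le> K1"
        "\<forall>t\<in>{b..c}. 0 \<le> t \<longrightarrow> (L2_torus_norm (f t))\<^sup>2 \<le> K2" using ab unfolding P_def by blast
      have "(L2_torus_norm (f t))\<^sup>2 \<le> max K1 K2" if "t \<in> {a..c}" "0 \<le> t" for t
        using K that by (cases "t \<le> b") (auto simp: le_max_iff_disj)
      then show ?thesis unfolding P_def by blast
    qed
    show "\<exists>d>0. \<forall>a b. a \<le> x \<and> x \<le> b \<and> b - a < d \<longrightarrow> P a b" if x: "0 \<le> x" for x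
    proof -
      have "\<forall>\<^sub>F s in at x within {0..}. L2_torus_norm (\<lambda>z. f s z - f x z) < 1"
        using order_tendstoD(2)[OF lim[OF x]] by simp
      then obtain d where d: "d > 0" "\<And>s. s \<ge> 0 \<Longrightarrow> s \<noteq> x \<Longrightarrow> \<bar>s - x\<bar> < d \<Longrightarrow> L2_torus_norm (\<lambda>z. f s z - f x z) < 1"
        unfolding eventually_at dist_real_def by auto
      have "(L2_torus_norm (f s))\<^sup>2 \<le> 2 + 2 * (L2_torus_norm (f x))\<^sup>2" if s: "0 \<le> s" "\<bar>s - x\<bar> < d" for s
      proof (cases "s = x")
        case False
        have "(L2_torus_norm (\<lambda>z. f s z - f x z))\<^sup>2 \<le> 1\<^sup>2"
          using d(2)[OF s(1) False s(2)] L2_torus_norm_nonneg by (intro power_mono) auto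
        then show ?thesis using L2_torus_norm_triangle[OF f[OF s(1)] f[OF x]] by simp
      next
        case True
        then show ?thesis using zero_le_power2[of "L2_torus_norm (f x)"] by simp
      qed
      then have "P a b" if "a \<le> x \<and> x \<le> b \<and> b - a < d" for a b
        unfolding P_def using that by (intro exI[of _ "2 + 2 * (L2_torus_norm (f x))\<^sup>2"]) auto
      then show ?thesis using d(1) by blast
    qed
  qed
  then show ?thesis unfolding P_def by auto
qed auto

text \<open>Testing with the plane wave of frequencies -k and -l: the x-derivative gives -ik, and
  the even symbol of the fractional Laplacian is unchanged. Only the product with u leaves this
  mode.\<close>

lemma solution_flow:
  assumes sh: "shear u n\<^sub>0" and \<gamma>: "0 < \<gamma>" "\<gamma> < 2" and \<nu>: "0 < \<nu>" and sol: "is_solution \<gamma> u \<nu> fin f"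
  shows "flow u n\<^sub>0 \<gamma> \<nu> k (\<lambda>t. slice k (f t))"
proof -
  interpret shear u n\<^sub>0 by (rule sh)
  have f: "\<And>t. 0 \<le> t \<Longrightarrow> f t \<in> sqint torus2"
    and weak: "\<And>\<phi> t. test_function \<phi> \<Longrightarrow> 0 \<le> t \<Longrightarrow> ((\<lambda>s. LINT z|torus2. f s z * \<phi> z) has_vector_derivative
          (LINT z|torus2. f t z * (of_real (u (snd z)) * partial_x \<phi> z - of_real \<nu> * frac_laplacian \<gamma> \<phi> z)))
          (at t within {0..})"
    using sol by (auto simp: is_solution_def L2_torus_eq)
  have uc: "continuous_on UNIV u" using continuous_D[of 0 UNIV] by (simp add: D_0)
  obtain B where B: "\<And>y. y \<in> {0..2*pi} \<Longrightarrow> \<bar>u y\<bar> \<le> B"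
    using D_bounded[OF le0, of 0 "2*pi"] unfolding D_0 by blast
  have [measurable]: "u \<in> borel_measurable torus1"
    by (intro borel_measurable_torus1 borel_measurable_continuous_onI uc)
  have uf: "(\<lambda>z. of_real (u (snd z)) * h z) \<in> sqint torus2" if "h \<in> sqint torus2" for h
  proof (rule sqint_bounded_mult[OF that, of _ B])
    show "(\<lambda>z. complex_of_real (u (snd z))) \<in> borel_measurable torus2" unfolding torus2_def by measurable
  qed (use B in \<open>auto simp: torus2_def space_pair_measure space_torus1\<close>)
  show ?thesis
  proof (unfold_locales)
    show "0 < \<gamma>" "\<gamma> < 2" "0 < \<nu>" by fact+
    show "slice k (f t) \<in> sqint torus1" if "0 \<le> t" for t by (rule slice_sqint[OF f[OF that]])
    show "\<exists>K. \<forall>t\<in>{0..T}. nsq (slice k (f t)) \<le> K" for T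
    proof -
      obtain K where K: "\<And>t. t \<in> {0..T} \<Longrightarrow> (L2_torus_norm (f t))\<^sup>2 \<le> K" using is_solution_bounded[OF sol] by blast
      have "nsq (slice k (f t)) \<le> K / (2*pi)\<^sup>2" if t: "t \<in> {0..T}" for t
      proof -
        have "f t \<in> sqint torus2" using t f by simp
        from parseval_slices(2)[OF this, of "{k}"] have "nsq (slice k (f t)) \<le> (L2_torus_norm (f t))\<^sup>2 / (2*pi)\<^sup>2" by simp
        also have "\<dots> \<le> K / (2*pi)\<^sup>2" using K[OF t] by (intro divide_right_mono) auto
        finally show ?thesis .
      qed
      then show ?thesis by blast
    qed
    fix t :: real and l :: int assume t: "0 \<le> t"
    define \<phi> where "\<phi> = plane_wave (-k) (-l)"
    define \<mu> where "\<mu> = \<nu> * (of_int k ^ 2 + of_int l ^ 2) powr (\<gamma> / 2)"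
    have px: "partial_x \<phi> z = - \<i> * of_int k * \<phi> z" for z
      unfolding \<phi>_def using fun_cong[OF partial_x_plane_wave[of 1 "-k" "-l"], of z] by simp
    have fl: "of_real \<nu> * frac_laplacian \<gamma> \<phi> z = of_real \<mu> * \<phi> z" for z
      unfolding \<phi>_def frac_laplacian_plane_wave \<mu>_def by simp
    have i: "integrable torus2 (\<lambda>z. h z * \<phi> z)" if "h \<in> sqint torus2" for h
      using sqint_mult_cnj_integrable[OF that plane_wave_sqint[of k l]]
      by (simp add: \<phi>_def plane_wave_def cnj_mode)
    have "(LINT z|torus2. f t z * (of_real (u (snd z)) * partial_x \<phi> z - of_real \<nu> * frac_laplacian \<gamma> \<phi> z))
       = (LINT z|torus2. - \<i> * of_int k * (of_real (u (snd z)) * f t z * \<phi> z) - of_real \<mu> * (f t z * \<phi> z))"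
      by (intro Bochner_Integration.integral_cong refl) (simp add: px fl algebra_simps)
    also have "\<dots> = - \<i> * of_int k * (LINT z|torus2. of_real (u (snd z)) * f t z * \<phi> z) - of_real \<mu> * (LINT z|torus2. f t z * \<phi> z)"
      using i[OF uf[OF f[OF t]]] i[OF f[OF t]] by simp
    finally have "((\<lambda>s. LINT z|torus2. f s z * \<phi> z) has_vector_derivative
        - \<i> * of_int k * (LINT z|torus2. of_real (u (snd z)) * f t z * \<phi> z) - of_real \<mu> * (LINT z|torus2. f t z * \<phi> z)) (at t within {0..})"
      using weak[OF _ t, of \<phi>] test_function_plane_wave by (simp add: \<phi>_def)
    from has_vector_derivative_divide[OF this, of "of_real ((2*pi)\<^sup>2)"]
    have d: "((\<lambda>s. (LINT z|torus2. f s z * \<phi> z) / of_real ((2*pi)\<^sup>2)) has_vector_derivative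
        - \<i> * of_int k * ((LINT z|torus2. of_real (u (snd z)) * f t z * \<phi> z) / of_real ((2*pi)\<^sup>2))
        - of_real \<mu> * ((LINT z|torus2. f t z * \<phi> z) / of_real ((2*pi)\<^sup>2))) (at t within {0..})"
      by (simp add: diff_divide_distrib del: of_real_power of_real_mult)
    have e: "fc (slice k (f s)) l = (LINT z|torus2. f s z * \<phi> z) / of_real ((2*pi)\<^sup>2)" if "0 \<le> s" for s
      unfolding \<phi>_def by (rule fc_slice[OF f[OF that]])
    have "(\<lambda>y. of_real (u y) * slice k (f t) y) = slice k (\<lambda>z. of_real (u (snd z)) * f t z)"
      by (simp add: slice_def ip_scale_left fun_eq_iff)
    then have e': "fc (\<lambda>y. of_real (u y) * slice k (f t) y) l = (LINT z|torus2. of_real (u (snd z)) * f t z * \<phi> z) / of_real ((2*pi)\<^sup>2)"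
      unfolding \<phi>_def by (simp only: fc_slice[OF uf[OF f[OF t]]])
    show "((\<lambda>s. fc (slice k (f s)) l) has_vector_derivative
        (- \<i> * of_int k * fc (\<lambda>y. of_real (u y) * slice k (f t) y) l
         - of_real (\<nu> * (of_int k ^ 2 + of_int l ^ 2) powr (\<gamma> / 2)) * fc (slice k (f t)) l)) (at t within {0..})"
      unfolding e' e[OF t] \<mu>_def[symmetric]
      by (rule has_vector_derivative_transform[OF _ _ d]) (use t e in auto)
  qed
qed

section \<open>Critical points and orders of vanishing\<close>

lemma vanishing_order_unique:
  assumes "vanishing_order u y m" "vanishing_order u y m'" shows "m = m'"
proof (rule ccontr)
  assume "m \<noteq> m'"
  then consider "m + 1 \<le> m'" | "m' + 1 \<le> m" by linarith
  then show False
  proof cases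
    case 1
    then have "(deriv ^^ (m + 1)) u y = 0" using assms(2) unfolding vanishing_order_def by (auto simp del: funpow.simps)
    then show False using assms(1) unfolding vanishing_order_def by blast
  next
    case 2
    then have "(deriv ^^ (m' + 1)) u y = 0" using assms(1) unfolding vanishing_order_def by (auto simp del: funpow.simps)
    then show False using assms(2) unfolding vanishing_order_def by blast
  qed
qed

text \<open>Finitely many critical points with unique orders make the set under \<open>Max\<close>
  finite, so \<open>n\<^sub>0\<close> bounds its elements. Periodicity carries the bound to all of
  the line. Rolle's theorem on a period supplies a critical point, whence \<open>n\<^sub>0\<close>
  is at least 1.\<close>

lemma C_torus_shear:
  assumes C: "C_torus (n\<^sub>0 + 2) u" and fin: "finite (critical_points u)"
    and order: "\<forall>y\<in>critical_points u. \<exists>m. vanishing_order u y m"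
    and n0: "n\<^sub>0 = Max {m. \<exists>y\<in>critical_points u. vanishing_order u y m}"
  shows "shear u n\<^sub>0"
proof -
  define S where "S = {m. \<exists>y\<in>critical_points u. vanishing_order u y m}"
  have per: "u (y + 2*pi) = u y" for y using C by (simp add: C_torus_def)
  have dper: "(deriv ^^ j) u (y + 2*pi) = (deriv ^^ j) u y" for j y
    by (induction j arbitrary: y) (simp_all add: per deriv_shift)
  have du: "(u has_real_derivative deriv u y) (at y)" for y
    using C unfolding C_torus_def by (auto simp: DERIV_deriv_iff_field_differentiable dest: spec[of _ 0])
  have "S = (\<lambda>y. THE m. vanishing_order u y m) ` critical_points u"
  proof -
    have "(THE m. vanishing_order u y m) = m" if "vanishing_order u y m" for y m
      using that vanishing_order_unique by (intro the_equality) auto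
    then show ?thesis using order unfolding S_def by force
  qed
  then have finS: "finite S" using fin by simp
  have le: "m \<le> n\<^sub>0" if "y \<in> critical_points u" "vanishing_order u y m" for y m
    unfolding n0 S_def[symmetric] using finS that by (intro Max_ge) (auto simp: S_def)
  have main: "\<exists>m\<le>n\<^sub>0. vanishing_order u y m" if "deriv u y = 0" for y
  proof -
    \<comment> \<open>Reduction modulo the period; all derivatives agree at the two points.\<close>
    define j where "j = \<lfloor>y / (2*pi)\<rfloor>"
    define y0 where "y0 = y - 2*pi * of_int j"
    have shift: "(deriv ^^ i) u (x + 2*pi * of_int k) = (deriv ^^ i) u x" for i x k
    proof (induction k rule: int_induct[of _ 0])
      case (step1 k)
      then show ?case using dper[of i "x + 2*pi * of_int k"] by (simp add: algebra_simps)
    next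
      case (step2 k)
      then show ?case using dper[of i "x + 2*pi * of_int (k - 1)"] by (simp add: algebra_simps)
    qed simp
    have eq: "(deriv ^^ i) u y = (deriv ^^ i) u y0" for i
      using shift[of i y0 j] by (simp add: y0_def)
    have "0 \<le> y0" "y0 < 2*pi"
    proof -
      have "of_int j \<le> y / (2*pi)" "y / (2*pi) < of_int j + 1" unfolding j_def by linarith+
      then show "0 \<le> y0" "y0 < 2*pi" unfolding y0_def by (simp_all add: field_simps)
    qed
    moreover have "deriv u y0 = 0" using eq[of 1] that by simp
    ultimately have "y0 \<in> critical_points u" by (simp add: critical_points_def)
    moreover have "vanishing_order u y m = vanishing_order u y0 m" for m
      unfolding vanishing_order_def eq ..
    ultimately show ?thesis using order le by blast
  qed
  have "\<exists>z. 0 < z \<and> z < 2*pi \<and> (u has_real_derivative 0) (at z)"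
  proof (rule Rolle)
    show "u 0 = u (2*pi)" using per[of 0] by simp
    show "continuous_on {0..2*pi} u"
      using du by (intro continuous_at_imp_continuous_on) (auto intro: DERIV_isCont)
    show "u differentiable (at x)" for x using du[of x] by (auto simp: real_differentiable_def)
  qed simp
  then obtain z where "deriv u z = 0" using DERIV_imp_deriv by blast
  with main obtain m where "m \<le> n\<^sub>0" "vanishing_order u z m" by blast
  then have "n\<^sub>0 \<ge> 1" by (simp add: vanishing_order_def)
  then show ?thesis using C main by unfold_locales auto
qed

section \<open>Iteration over time windows and summation over the frequencies in x\<close>

theorem proposition4p7:
  fixes \<gamma> :: real and u :: "real \<Rightarrow> real" and n\<^sub>0 :: nat
  assumes "0 < \<gamma>" and "\<gamma> < 2"
    and "C_torus (n\<^sub>0 + 2) u"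
    and "finite (critical_points u)"
    and "\<forall>y\<in>critical_points u. \<exists>m. vanishing_order u y m"
    and "n\<^sub>0 = Max {m. \<exists>y\<in>critical_points u. vanishing_order u y m}"
  shows "\<exists>c>0. \<forall>\<nu>. 0 < \<nu> \<and> \<nu> < 1 \<longrightarrow>
           (\<forall>fin\<in>H_space. \<forall>f. is_solution \<gamma> u \<nu> fin f \<longrightarrow>
             (\<forall>t > 1 / \<nu> powr q_exponent n\<^sub>0 \<gamma>.
                L2_torus_norm (f t)
                  \<le> exp (- c * \<nu> powr q_exponent n\<^sub>0 \<gamma> * t) * L2_torus_norm fin))"
proof -
  have sh: "shear u n\<^sub>0" by (rule C_torus_shear) fact+
  define q where "q = q_exponent n\<^sub>0 \<gamma>"
  obtain \<rho> where \<rho>: "0 < \<rho>" "\<rho> < 1" and contr: "\<And>\<nu> k g s. 0 < \<nu> \<Longrightarrow> \<nu> < 1 \<Longrightarrow> k \<noteq> 0 \<Longrightarrow> flow u n\<^sub>0 \<gamma> \<nu> k g \<Longrightarrow> 0 \<le> s \<Longrightarrow>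
     nsq (g (s + \<nu> powr - q)) \<le> \<rho> * nsq (g s)"
    using shear.contraction[OF sh assms(1,2)] unfolding q_def by blast
  \<comment> \<open>One factor 1/2 is lost in counting whole windows, the other in passing from the
    squared norm to the norm.\<close>
  define c where "c = - ln \<rho> / 4"
  have c: "c > 0" using \<rho> by (simp add: c_def)
  have "L2_torus_norm (f t) \<le> exp (- c * \<nu> powr q * t) * L2_torus_norm fin"
    if \<nu>: "0 < \<nu>" "\<nu> < 1" and fin: "fin \<in> H_space" and sol: "is_solution \<gamma> u \<nu> fin f" and t: "t > 1 / \<nu> powr q" for \<nu> fin f t
  proof -
    define \<tau> where "\<tau> = \<nu> powr - q"
    have \<tau>: "\<tau> > 0" "\<tau> = 1 / \<nu> powr q" using \<nu> by (simp_all add: \<tau>_def powr_minus_divide)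
    have f: "\<And>t. 0 \<le> t \<Longrightarrow> f t \<in> sqint torus2" and ae: "AE z in torus2. f 0 z = fin z"
      using sol by (auto simp: is_solution_def L2_torus_eq)
    have fins: "fin \<in> sqint torus2" and fin0: "AE y in torus1. (LINT x|torus1. fin (x, y)) = 0"
      using fin by (auto simp: H_space_def L2_torus_eq)
    have norm0: "L2_torus_norm (f 0) = L2_torus_norm fin"
      unfolding L2_torus_norm_def
      using sqint_measurable[OF f[of 0]] sqint_measurable[OF fins] ae
      by (intro arg_cong[of _ _ sqrt] integral_cong_AE) auto
    define g where "g k t = slice k (f t)" for k t
    have fl: "flow u n\<^sub>0 \<gamma> \<nu> k (g k)" for k
      unfolding g_def by (rule solution_flow[OF sh assms(1,2) \<nu>(1) sol])
    have gs: "g k s \<in> sqint torus1" if "0 \<le> s" for k s unfolding g_def by (rule slice_sqint[OF f[OF that]])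
    have mono: "nsq (g k s2) \<le> nsq (g k s1)" if "0 \<le> s1" "s1 \<le> s2" for k s1 s2
      using flow.E_antimono[OF fl that] by (simp add: flow.E_def[OF fl])
    define n where "n = nat \<lfloor>t / \<tau>\<rfloor>"
    have t1: "t / \<tau> > 1" using t \<tau>(1) unfolding \<tau>(2)[symmetric] by simp
    \<comment> \<open>As t exceeds one window length, rounding down to whole windows loses at most
      half. This is why the final estimate has no constant in front of the exponential.\<close>
    have n: "real n \<le> t / \<tau>" "real n \<ge> t / \<tau> / 2"
    proof -
    define r where "r = t / \<tau>"
    have "\<lfloor>r\<rfloor> \<ge> 1" using t1 by (simp add: r_def)
    then have "real n = of_int \<lfloor>r\<rfloor>" "real n \<ge> 1" by (simp_all add: n_def r_def)
    moreover have "of_int \<lfloor>r\<rfloor> \<le> r" "r < of_int \<lfloor>r\<rfloor> + 1" by linarith+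
    ultimately have "real n \<le> r" "real n \<ge> r / 2" by linarith+
    then show "real n \<le> t / \<tau>" "real n \<ge> t / \<tau> / 2" by (simp_all add: r_def)
  qed
    have iter: "nsq (g k (real j * \<tau>)) \<le> \<rho> ^ j * nsq (g k 0)" if k: "k \<noteq> 0" for k j
    proof (induction j)
      case (Suc j)
      have "nsq (g k (real (Suc j) * \<tau>)) = nsq (g k (real j * \<tau> + \<nu> powr - q))"
        by (simp add: \<tau>_def algebra_simps)
      also have "\<dots> \<le> \<rho> * nsq (g k (real j * \<tau>))" using \<tau> by (intro contr[OF \<nu> k fl]) auto
      also have "\<dots> \<le> \<rho> * (\<rho> ^ j * nsq (g k 0))" using Suc \<rho> by (intro mult_left_mono) auto
      finally show ?case by simp
    qed simp
    \<comment> \<open>The x-average is not mixed and its contraction is not claimed. It vanishes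
      initially by the definition of \<open>H_space\<close> and stays zero because the energy of
      each frequency decreases.\<close>
    have zero: "nsq (g 0 0) = 0"
    proof -
      have "fc (g 0 0) l = 0" for l
      proof -
        have "fc (g 0 0) l = fc (slice 0 fin) l" unfolding g_def by (rule fc_slice_cong[OF f fins ae]) simp
        also have "\<dots> = 0"
        proof -
          have "AE y in torus1. slice 0 fin y * cnj (mode l y) = 0"
            using fin0 by eventually_elim (simp add: slice_def ip_def mode_def)
          then have "(LINT y|torus1. slice 0 fin y * cnj (mode l y)) = 0" by (rule integral_eq_zero_AE)
          then show ?thesis by (simp add: ip_def)
        qed
        finally show ?thesis .
      qed
      then have "(\<lambda>M::nat. 0) \<longlonglongrightarrow> nsq (g 0 0)" using parseval_nsq[OF gs[of 0 0]] by simp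
      then show ?thesis by (simp add: LIMSEQ_const_iff)
    qed
    have tn: "0 \<le> real n * \<tau>" "real n * \<tau> \<le> t" using n(1) \<tau>(1) by (auto simp: le_divide_eq)
    have each: "nsq (g k t) \<le> \<rho> ^ n * nsq (g k 0)" for k
    proof (cases "k = 0")
      case True
      then show ?thesis using mono[of 0 t 0] tn zero by simp
    next
      case False
      show ?thesis using mono[OF tn, of k] iter[OF False, of n] by simp
    qed
    have t0: "0 \<le> t" using tn by linarith
    \<comment> \<open>The factor is the same for all k, so the estimates can be added and the sum at
      time 0 bounded by Bessel's inequality.\<close>
    have "(\<Sum>k\<in>{-int M..int M}. nsq (g k t)) \<le> \<rho> ^ n * ((L2_torus_norm fin)\<^sup>2 / (2*pi)\<^sup>2)" for M
    proof -
      have "(\<Sum>k\<in>{-int M..int M}. nsq (g k t)) \<le> \<rho> ^ n * (\<Sum>k\<in>{-int M..int M}. nsq (g k 0))"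
        unfolding sum_distrib_left by (intro sum_mono each)
      also have "\<dots> \<le> \<rho> ^ n * ((L2_torus_norm (f 0))\<^sup>2 / (2*pi)\<^sup>2)"
        unfolding g_def using \<rho> by (intro mult_left_mono parseval_slices(2) f) auto
      finally show ?thesis by (simp add: norm0)
    qed
    then have "(L2_torus_norm (f t))\<^sup>2 / (2*pi)\<^sup>2 \<le> \<rho> ^ n * ((L2_torus_norm fin)\<^sup>2 / (2*pi)\<^sup>2)"
      unfolding g_def by (intro LIMSEQ_le_const2[OF parseval_slices(1)[OF f[OF t0]]]) blast
    then have sq: "(L2_torus_norm (f t))\<^sup>2 \<le> \<rho> ^ n * (L2_torus_norm fin)\<^sup>2"
      by (simp add: divide_le_cancel)
    have "\<rho> ^ n = exp (real n * ln \<rho>)" using \<rho> by (simp add: exp_of_nat_mult)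
    also have "\<dots> \<le> exp ((t / \<tau> / 2) * ln \<rho>)" using n \<rho> by (intro exp_mono mult_right_mono_neg) auto
    also have "\<dots> = (exp (- c * \<nu> powr q * t))\<^sup>2"
      unfolding \<tau>(2) c_def by (simp add: exp_double[symmetric])
    finally have "\<rho> ^ n \<le> (exp (- c * \<nu> powr q * t))\<^sup>2" .
    then have "(L2_torus_norm (f t))\<^sup>2 \<le> (exp (- c * \<nu> powr q * t) * L2_torus_norm fin)\<^sup>2"
      unfolding power_mult_distrib by (intro order_trans[OF sq] mult_right_mono) auto
    then show ?thesis by (rule power2_le_imp_le) (simp add: L2_torus_norm_nonneg)
  qed
  then show ?thesis using c unfolding q_def by blast
qed

end
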